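(* Let $s=\sigma+it$ with $0<\sigma<1$, $t\ge0$, and let $a(n)$ be defined by $\sqrt{\zeta(s)}=\sum_{n\ge1}a(n)n^{-s}$ for $\sigma>1$. For $x>0$ and $y$ with $xy=\sqrt{t/2\pi}$, write $$\sqrt{\zeta(s)}=\sum_{n\le x}a(n)n^{-s}+\sqrt{\chi(s)}\sum_{n\le y}a(n)n^{s-1}+E_{1/2}(s,x).$$ Then, for $X\gg1$, $Y\gg1$ with $XY=t/2\pi$, the remainder $E_1(s,X)$ defined by $\zeta(s)=\sum_{n\le X}n^{-s}+\chi(s)\sum_{n\le Y}n^{s-1}+E_1(s,X)$ satisfies $$E_1(s,X)=2\Big\{\sum_{n\le\sqrt X}a(n)n^{-s}E_{1/2}\Big(s,\frac Xn\Big)+\chi(s)\sum_{n\le\sqrt Y}a(n)n^{s-1}E_{1/2}\Big(1-s,\frac Yn\Big)+\sqrt{\chi(s)}\Big(\sqrt{\tfrac XY}\Big)^{-s}\sum_{n\le\sqrt Y}\frac{a(n)\,a\big(n\sqrt{X/Y}\big)}{n}\Big\}+E_{1/2}^2(s,\sqrt X)$$ and $$E_1(s,X)\ll X^{-\sigma}+\frac{X^{1-\sigma}}{\sqrt t}.$$ Here the third term in the curly bracket vanishes if $\sqrt{X/Y}$ is irrational.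
   Context: $\zeta$ is the Riemann zeta function and $\chi(s)$ is defined by the functional equation $\zeta(s)=\chi(s)\zeta(1-s)$. For $\sigma>1$, $\sqrt{\zeta(s)}=\exp(\tfrac12\log\zeta(s))$ with the branch of the logarithm that is real for real $s>1$. In the strip $0<\sigma<1$, $\sqrt{\zeta}$ and $\sqrt{\chi}$ denote square roots of $\zeta$ and $\chi$, chosen compatibly so that $\sqrt{\zeta(s)}=\sqrt{\chi(s)}\sqrt{\zeta(1-s)}$ and $\sqrt{\chi(s)}\sqrt{\chi(1-s)}=1$. The remainder $E_{1/2}(s,x)$ is defined by the displayed relation for all $s=\sigma+it$ in the strip (with $xy=\sqrt{|t|/2\pi}$ when $t<0$). By convention $a(u)=0$ if $u$ is not a positive integer. The conditions $X\gg1$, $Y\gg1$ with the bound $\ll$ mean: for every $c>0$ there is a constant $C$ depending only on $c$ such that the bound holds with constant $C$ whenever $X,Y\ge c$. *)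

theory Defs
  imports "HOL-Complex_Analysis.Complex_Analysis"
begin

(* The analytic continuation of the Dirichlet series to the plane without 1. It is unique on
   that set by the identity theorem; the value at 1 is unspecified and never used. *)
definition zeta :: "complex \<Rightarrow> complex" where
  "zeta = (SOME f. f holomorphic_on (- {1}) \<and>
             (\<forall>s. Re s > 1 \<longrightarrow> (\<lambda>n. of_nat (Suc n) powr (- s)) sums f s))"

(* The meromorphic function determined by zeta s = chi s * zeta (1 - s). The removable
   singularities of the quotient have to be filled in, because at a common zero of zeta s
   and zeta (1 - s) the division itself would give 0. *)
definition chi :: "complex \<Rightarrow> complex" where
  "chi = remove_sings (\<lambda>s. zeta s / zeta (1 - s))"

definition critical_strip :: "complex set" where
  "critical_strip = {s. 0 < Re s \<and> Re s < 1}"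

definition nats_upto :: "real \<Rightarrow> nat set" where
  "nats_upto x = {n. 1 \<le> n \<and> real n \<le> x}"

definition dirichlet_psum :: "(nat \<Rightarrow> complex) \<Rightarrow> real \<Rightarrow> complex \<Rightarrow> complex" where
  "dirichlet_psum a x s = (\<Sum>n\<in>nats_upto x. a n * of_nat n powr (- s))"

(* The convention a(u) = 0 when u is not a positive integer. *)
definition ext_coeff :: "(nat \<Rightarrow> complex) \<Rightarrow> real \<Rightarrow> complex" where
  "ext_coeff a u = (if u \<in> \<nat> \<and> u > 0 then a (nat \<lfloor>u\<rfloor>) else 0)"

(* Here rz and rchi are the chosen square roots of zeta and chi, and
   y = sqrt (|t| / 2 pi) / x with t = Im s. *)
definition E_half ::
  "(complex \<Rightarrow> complex) \<Rightarrow> (complex \<Rightarrow> complex) \<Rightarrow> (nat \<Rightarrow> complex) \<Rightarrow> complex \<Rightarrow> real \<Rightarrow> complex" where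
  "E_half rz rchi a s x =
     rz s - dirichlet_psum a x s
       - rchi s * dirichlet_psum a (sqrt (\<bar>Im s\<bar> / (2 * pi)) / x) (1 - s)"

(* Y = t / (2 pi X) with t = Im s. *)
definition E_one :: "complex \<Rightarrow> real \<Rightarrow> complex" where
  "E_one s X =
     zeta s - dirichlet_psum (\<lambda>_. 1) X s
       - chi s * dirichlet_psum (\<lambda>_. 1) (Im s / (2 * pi) / X) (1 - s)"

definition diagonal_term ::
  "(complex \<Rightarrow> complex) \<Rightarrow> (nat \<Rightarrow> complex) \<Rightarrow> complex \<Rightarrow> real \<Rightarrow> real \<Rightarrow> complex" where
  "diagonal_term rchi a s X Y =
     rchi s * of_real (sqrt (X / Y)) powr (- s) *
       (\<Sum>n\<in>nats_upto (sqrt Y). a n * ext_coeff a (real n * sqrt (X / Y)) / of_nat n)"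

end

theory Submission
  imports Defs
begin

text \<open>
  The identity is the Dirichlet hyperbola method for \<open>a * a = 1\<close>: substituting the relation that
  defines \<open>E\<^sub>1\<^sub>/\<^sub>2\<close> into the two hyperbola sums, the mixed terms form the product of the two short
  sums, except that the pairs \<open>(m, n)\<close> with \<open>m = n \<surd>(X/Y)\<close> are counted twice.

  The bound is the approximate functional equation without logarithm, obtained here by real-variable
  Poisson summation. With \<open>b(u) = ({u} - {u}\<^sup>2) / 2 = \<Sum>\<^sub>\<nu> (1 - cos 2\<pi>\<nu>u) / (2\<pi>\<^sup>2\<nu>\<^sup>2)\<close>, Euler-Maclaurin
  summation gives
  \<open>\<zeta>(s) = \<Sum>\<^bsub>n \<le> N\<^esub> n\<^bsup>-s\<^esup> - N\<^bsup>-s\<^esup>/2 + N\<^bsup>1-s\<^esup>/(s-1) + s(s+1) \<integral>\<^sub>N b(u) u\<^bsup>-s-2\<^esup> du\<close>, and the same kernel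
  integrated over the whole positive axis gives the functional equation, with \<open>\<chi>(s) \<nu>\<^bsup>s-1\<^esup>\<close> as
  the contribution of frequency \<open>\<nu>\<close>. Up to two integrations by parts the frequency \<open>\<nu>\<close> contributes
  \<open>\<integral> 2 cos(2\<pi>\<nu>u) u\<^bsup>-s\<^esup> du\<close>, whose stationary point is \<open>u = t/2\<pi>\<nu>\<close>. For \<open>t = 2\<pi>NY\<close> and \<open>Y \<le> N\<close> one
  keeps \<open>[N,\<infinity>)\<close> for \<open>\<nu> > Y\<close> and \<open>(0,N]\<close> for \<open>\<nu> \<le> Y\<close>, so that no stationary point is interior.
  The boundary terms at \<open>N\<close> add up to \<open>N\<^bsup>-s\<^esup>\<close> times a symmetric sum of \<open>1/(\<nu> - Y)\<close> over positive and
  negative \<open>\<nu>\<close>, which is bounded, so no logarithm appears; the two frequencies next to \<open>Y\<close>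
  are bounded by \<open>N\<^bsup>1-\<sigma>\<^esup>/\<surd>t\<close>. The case \<open>X < Y\<close> follows by reflecting \<open>s\<close> to \<open>1 - cnj s\<close>.
\<close>

section \<open>The hyperbola identity\<close>

text \<open>Three choices shape the estimate. The kernel \<open>saw\<close> vanishes at the integers
  and its Fourier terms are nonnegative: \<open>saw\<close> itself dominates the partial sums, and
  every interchange is dominated convergence. Each term with \<open>1 - cos\<close> vanishes to
  second order at 0, the full kernel only to first order. The whole-axis integral of one frequency
  therefore reaches Re s < 1, that of \<open>saw\<close> only Re s < 0; this is why the functional
  equation is proved left of the strip and then continued into it. The cut point must be an integer
  N: there all boundary terms of the kernel vanish and exp(2 pi i v N) = 1, so the frequencies
  contribute real multiples of one number and can cancel. For real X the cut is N = floor X + 1 with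
  the same t, which for Y <= X changes each of the two sums by at most one term. Finally t may be
  small, since only X, Y >= c is known. A bound \<kappa> for sqrt (t + 1) / sqrt t is carried along
  and is expressed in terms of c at the very end.\<close>

lemma nats_upto_eq: "nats_upto x = {1..nat \<lfloor>x\<rfloor>}"
proof -
  have "n \<le> nat \<lfloor>x\<rfloor> \<longleftrightarrow> real n \<le> x" if "1 \<le> n" for n
  proof (cases "x \<ge> 0")
    case True
    then show ?thesis by (simp add: le_nat_iff le_floor_iff)
  next
    case False
    then show ?thesis using that by simp
  qed
  then show ?thesis unfolding nats_upto_def by auto
qed

lemma finite_nats_upto [simp]: "finite (nats_upto x)"
  by (simp add: nats_upto_eq)

lemma nats_upto_iff: "n \<in> nats_upto x \<longleftrightarrow> 0 < n \<and> real n \<le> x"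
  by (auto simp: nats_upto_def)

text \<open>A pair with m n <= X cannot have both entries above sqrt X. So the region is the union
  of the part \<open>A\<close> with m <= sqrt X and its mirror image \<open>B\<close>, which overlap
  in the square m, n <= sqrt X; for the symmetric summand both parts have the same sum.\<close>

lemma hyperbola_sum:
  fixes f :: "nat \<Rightarrow> 'a :: comm_ring_1"
  assumes "X > 0"
  shows "(\<Sum>(m,n)\<in>{(m,n). 0 < m \<and> 0 < n \<and> real (m * n) \<le> X}. f m * f n) =
     2 * (\<Sum>n\<in>nats_upto (sqrt X). f n * (\<Sum>m\<in>nats_upto (X / n). f m)) - (\<Sum>n\<in>nats_upto (sqrt X). f n)\<^sup>2"
proof -
  let ?h = "\<lambda>(m,n). f m * f n"
  define A where "A = (SIGMA m:nats_upto (sqrt X). nats_upto (X / m))"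
  define B where "B = prod.swap ` A"
  have inA: "(m, n) \<in> A \<longleftrightarrow> 0 < m \<and> 0 < n \<and> real m \<le> sqrt X \<and> real (m * n) \<le> X" for m n
    by (auto simp: A_def nats_upto_iff field_simps)
  have inB: "(m, n) \<in> B \<longleftrightarrow> 0 < m \<and> 0 < n \<and> real n \<le> sqrt X \<and> real (m * n) \<le> X" for m n
    using inA[of n m] by (force simp: B_def image_iff mult.commute)
  have fin: "finite A" "finite B" by (auto simp: A_def B_def)
  have un: "{(m,n). 0 < m \<and> 0 < n \<and> real (m * n) \<le> X} = A \<union> B"
  proof -
    have "real m \<le> sqrt X \<or> real n \<le> sqrt X" if "real (m * n) \<le> X" for m n
    proof (rule ccontr)
      assume "\<not> ?thesis"
      then have "sqrt X < real m" "sqrt X < real n" by auto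
      moreover have "0 < sqrt X" using assms by simp
      ultimately have "sqrt X * sqrt X < real m * real n" by (intro mult_strict_mono) linarith+
      then show False using that assms by simp
    qed
    then have "(m, n) \<in> A \<union> B \<longleftrightarrow> 0 < m \<and> 0 < n \<and> real (m * n) \<le> X" for m n
      unfolding Un_iff inA inB by blast
    then show ?thesis by (auto simp del: of_nat_mult Un_iff)
  qed
  have int: "A \<inter> B = nats_upto (sqrt X) \<times> nats_upto (sqrt X)"
  proof -
    have "real (m * n) \<le> X" if "real m \<le> sqrt X" "real n \<le> sqrt X" for m n
      using mult_mono[OF that] assms by simp
    then show ?thesis using inA inB by (auto simp: nats_upto_iff)
  qed
  have sA: "sum ?h A = (\<Sum>n\<in>nats_upto (sqrt X). f n * (\<Sum>m\<in>nats_upto (X / n). f m))"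
    by (simp add: A_def sum.Sigma[symmetric] sum_distrib_left)
  have sB: "sum ?h B = sum ?h A"
    unfolding B_def by (subst sum.reindex) (auto simp: inj_on_def mult.commute intro!: sum.cong)
  have sAB: "sum ?h (A \<inter> B) = (\<Sum>n\<in>nats_upto (sqrt X). f n)\<^sup>2"
    unfolding int by (simp add: sum.cartesian_product[symmetric] power2_eq_square sum_product)
  have "sum ?h (A \<union> B) + sum ?h (A \<inter> B) = sum ?h A + sum ?h B"
    by (rule sum.union_inter) (use fin in auto)
  then show ?thesis unfolding un sA sB sAB by (simp add: algebra_simps)
qed

lemma sum_divisor_pairs:
  fixes h :: "nat \<Rightarrow> nat \<Rightarrow> 'a :: comm_monoid_add"
  shows "(\<Sum>k\<in>nats_upto X. \<Sum>d | d dvd k. h d (k div d)) =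
     (\<Sum>(m,n)\<in>{(m,n). 0 < m \<and> 0 < n \<and> real (m * n) \<le> X}. h m n)"
proof -
  have "(\<Sum>k\<in>nats_upto X. \<Sum>d | d dvd k. h d (k div d)) =
     (\<Sum>(k,d)\<in>(SIGMA k:nats_upto X. {d. d dvd k}). h d (k div d))"
    by (subst sum.Sigma) (auto simp: nats_upto_iff)
  also have "\<dots> = (\<Sum>(m,n)\<in>{(m,n). 0 < m \<and> 0 < n \<and> real (m * n) \<le> X}. h m n)"
    by (rule sum.reindex_bij_witness[where i = "\<lambda>(m,n). (m * n, m)" and j = "\<lambda>(k,d). (d, k div d)"])
       (auto simp: nats_upto_iff elim!: dvdE)
  finally show ?thesis .
qed

text \<open>The line m = n r cuts the rectangle m <= r y, n <= y into a part \<open>A\<close> (n <=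
  m / r) and a part \<open>B\<close> (m <= n r); lattice points on the line lie in both. With r =
  sqrt (X / Y) and y = sqrt Y this is the source of the diagonal term.\<close>

lemma diagonal_double_count:
  fixes f g :: "nat \<Rightarrow> complex" and r y :: real
  assumes "r > 0"
  shows "(\<Sum>m\<in>nats_upto (r * y). f m * (\<Sum>n\<in>nats_upto (m / r). g n)) +
      (\<Sum>n\<in>nats_upto y. g n * (\<Sum>m\<in>nats_upto (n * r). f m)) =
      (\<Sum>m\<in>nats_upto (r * y). f m) * (\<Sum>n\<in>nats_upto y. g n) +
      (\<Sum>n\<in>nats_upto y. g n * ext_coeff f (real n * r))"
proof -
  let ?h = "\<lambda>(m,n). f m * g n"
  define A where "A = (SIGMA m:nats_upto (r * y). nats_upto (m / r))"
  define B where "B = prod.swap ` (SIGMA n:nats_upto y. nats_upto (n * r))"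
  have inA: "(m, n) \<in> A \<longleftrightarrow> 0 < m \<and> 0 < n \<and> real m \<le> r * y \<and> real n * r \<le> real m" for m n
    using assms by (auto simp: A_def nats_upto_iff field_simps)
  have inB: "(m, n) \<in> B \<longleftrightarrow> 0 < m \<and> 0 < n \<and> real n \<le> y \<and> real m \<le> real n * r" for m n
    by (auto simp: B_def image_iff nats_upto_iff)
  have fin: "finite A" "finite B" by (auto simp: A_def B_def)
  have un: "nats_upto (r * y) \<times> nats_upto y = A \<union> B"
  proof -
    have "real n \<le> y" if "real m \<le> r * y" "real n * r \<le> real m" for m n
      using order_trans[OF that(2,1)] assms by simp
    moreover have "real m \<le> r * y" if "real n \<le> y" "real m \<le> real n * r" for m n
    proof -
      have "real n * r \<le> y * r" using that(1) assms by (intro mult_right_mono) auto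
      then show ?thesis using that(2) by (metis mult.commute order_trans)
    qed
    ultimately show ?thesis using inA inB by (auto simp: nats_upto_iff)
  qed
  \<comment> \<open>On the line each n has at most one partner, namely n r when that is a natural
    number; this is what \<open>ext_coeff\<close> encodes.\<close>
  have int: "A \<inter> B = (\<lambda>n. (nat \<lfloor>real n * r\<rfloor>, n)) ` {n \<in> nats_upto y. real n * r \<in> \<nat>}" (is "_ = ?R")
  proof (intro equalityI subrelI)
    fix m n assume "(m, n) \<in> A \<inter> B"
    then have mn: "0 < m" "0 < n" "real n \<le> y" and e: "real n * r = real m" using inA inB by force+
    show "(m, n) \<in> ?R"
      by (rule image_eqI[of _ _ n]) (use mn in \<open>auto simp: e nats_upto_iff\<close>)
  next
    fix m n assume "(m, n) \<in> ?R"
    then have n: "n \<in> nats_upto y" "real n * r \<in> \<nat>" "m = nat \<lfloor>real n * r\<rfloor>" by auto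
    then obtain k where k: "real n * r = real k" by (auto elim: Nats_cases)
    then have "m = k" using n by simp
    have "0 < n" "real n \<le> y" using n by (auto simp: nats_upto_iff)
    then have "real n * r > 0" using assms by simp
    then have "0 < m" using k \<open>m = k\<close> by simp
    moreover have "real m \<le> r * y" using k \<open>m = k\<close> \<open>real n \<le> y\<close> assms 
      by (metis less_eq_real_def mult.commute mult_left_mono)
    ultimately show "(m, n) \<in> A \<inter> B"
      using k \<open>m = k\<close> \<open>0 < n\<close> \<open>real n \<le> y\<close> inA inB by simp
  qed
  have sA: "sum ?h A = (\<Sum>m\<in>nats_upto (r * y). f m * (\<Sum>n\<in>nats_upto (m / r). g n))"
    by (simp add: A_def sum.Sigma[symmetric] sum_distrib_left)
  have sB: "sum ?h B = (\<Sum>n\<in>nats_upto y. g n * (\<Sum>m\<in>nats_upto (n * r). f m))"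
  proof -
    have "sum ?h B = (\<Sum>(n,m)\<in>(SIGMA n:nats_upto y. nats_upto (n * r)). g n * f m)"
      unfolding B_def by (subst sum.reindex) (auto simp: inj_on_def mult.commute intro!: sum.cong)
    then show ?thesis by (simp add: sum.Sigma[symmetric] sum_distrib_left)
  qed
  have sU: "sum ?h (A \<union> B) = (\<Sum>m\<in>nats_upto (r * y). f m) * (\<Sum>n\<in>nats_upto y. g n)"
    unfolding un[symmetric] by (simp add: sum.cartesian_product[symmetric] sum_product)
  have "sum ?h (A \<inter> B) = (\<Sum>n | n \<in> nats_upto y \<and> real n * r \<in> \<nat>. f (nat \<lfloor>real n * r\<rfloor>) * g n)"
    unfolding int by (subst sum.reindex) (auto simp: inj_on_def)
  also have "\<dots> = (\<Sum>n\<in>nats_upto y. g n * ext_coeff f (real n * r))"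
    using assms by (intro sum.mono_neutral_cong_left) (auto simp: ext_coeff_def nats_upto_iff mult.commute)
  finally have sI: "sum ?h (A \<inter> B) = (\<Sum>n\<in>nats_upto y. g n * ext_coeff f (real n * r))" .
  have "sum ?h (A \<union> B) + sum ?h (A \<inter> B) = sum ?h A + sum ?h B"
    by (rule sum.union_inter) (use fin in auto)
  then show ?thesis unfolding sA sB sU sI by simp
qed


section \<open>Absolutely convergent Dirichlet series and their coefficients\<close>

lemma dirichlet_series_has_sum:
  fixes a :: "nat \<Rightarrow> complex"
  assumes bound: "\<And>n. n > 0 \<Longrightarrow> norm (a n) \<le> C * real n ^ 2" and x: "x \<ge> 4"
    and sums: "(\<lambda>n. a (Suc n) * of_nat (Suc n) powr (- of_real x)) sums S"
  shows "((\<lambda>n. a n * of_nat n powr (- of_real x)) has_sum S) {0<..}"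
    and "(\<lambda>n. norm (a n * of_nat n powr (- of_real x))) summable_on {0<..}"
proof -
  let ?F = "\<lambda>n. a n * of_nat n powr (- complex_of_real x)"
  have im: "Suc ` UNIV = {0<..}" by (auto simp: image_iff gr0_conv_Suc)
  have le: "norm (?F (Suc n)) \<le> C * inverse (real (Suc n) ^ 2)" for n
  proof -
    have n: "norm (of_nat (Suc n) powr (- complex_of_real x)) = real (Suc n) powr (-x)"
      by (subst norm_powr_real_powr) auto
    have "norm (?F (Suc n)) \<le> (C * real (Suc n) ^ 2) * real (Suc n) powr (-x)"
      unfolding norm_mult n by (intro mult_right_mono bound) auto
    \<comment> \<open>With coefficients of order n^2, x >= 4 leaves the majorant C / n^2.\<close>
    also have "\<dots> \<le> (C * real (Suc n) ^ 2) * real (Suc n) powr (-4)"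
    proof (intro mult_left_mono powr_mono)
      have "0 \<le> norm (a (Suc n))" by simp
      also have "\<dots> \<le> C * real (Suc n) ^ 2" by (rule bound) simp
      finally show "C * real (Suc n) ^ 2 \<ge> 0" .
    qed (use x in auto)
    also have "real (Suc n) powr (-4) = inverse (real (Suc n) ^ 4)"
      by (simp add: powr_minus powr_numeral)
    also have "(C * real (Suc n) ^ 2) * inverse (real (Suc n) ^ 4) = C * inverse (real (Suc n) ^ 2)"
      by (simp add: field_simps power2_eq_square power4_eq_xxxx del: of_nat_Suc)
    finally show ?thesis .
  qed
  have "summable (\<lambda>n. C * inverse (real (Suc n) ^ 2))"
    using inverse_squares_sums by (intro summable_mult) (auto simp: sums_iff inverse_eq_divide)
  then have sm: "summable (\<lambda>n. norm (?F (Suc n)))"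
    by (rule summable_comparison_test') (use le in auto)
  from norm_summable_imp_has_sum[OF sm sums]
  have "(?F has_sum S) (Suc ` UNIV)" by (subst has_sum_reindex) (auto simp: o_def)
  then show "(?F has_sum S) {0<..}" by (simp add: im)
  have "(\<lambda>n. norm (?F n)) summable_on (Suc ` UNIV)"
    by (subst summable_on_reindex) (auto simp: o_def intro!: summable_nonneg_imp_summable_on sm simp del: of_nat_Suc)
  then show "(\<lambda>n. norm (?F n)) summable_on {0<..}" by (simp add: im)
qed

text \<open>By induction the terms before m vanish, so at x = 4 + k the m-th term equals minus the
  tail. As k grows, the term shrinks like m^(-k) but the tail like (m + 1)^(-k), which forces b m =
  0.\<close>

lemma dirichlet_series_zero:
  fixes b :: "nat \<Rightarrow> complex"
  assumes zero: "\<And>x. x \<ge> 4 \<Longrightarrow> ((\<lambda>n. b n * of_nat n powr (- of_real x)) has_sum 0) {0<..}"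
    and "m > 0"
  shows "b m = 0"
  using \<open>m > 0\<close>
proof (induction m rule: less_induct)
  case (less m)
  let ?F = "\<lambda>x n. b n * of_nat n powr (- complex_of_real x)"
  have "?F 4 summable_on {0<..}"
    by (rule has_sum_imp_summable, rule zero) simp
  \<comment> \<open>Unordered summability of complex families is absolute, so the constant
    \<open>S\<close> for the tails comes out of the hypothesis at x = 4.\<close>
  then have abs4: "(\<lambda>n. norm (?F 4 n)) summable_on {0<..}"
    by (simp only: summable_on_iff_abs_summable_on_complex)
  then have abs4': "(\<lambda>n. norm (?F 4 n)) summable_on {m<..}"
    by (rule summable_on_subset_banach) (use less.prems in auto)
  define S where "S = infsum (\<lambda>n. norm (?F 4 n)) {m<..}"
  have bound: "norm (b m) \<le> real m ^ 4 * S * (real m / real (Suc m)) ^ k" for k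
  proof -
    define x where "x = 4 + real k"
    have "((?F x) has_sum 0) {0<..}" by (rule zero) (simp add: x_def)
    then have "((?F x) has_sum 0) {m..}"
      by (rule has_sum_cong_neutral[THEN iffD1, rotated -1]) (use less in auto)
    moreover have eq: "{m..} = insert m {m<..}" by auto
    moreover have "?F x summable_on {m<..}"
      by (rule summable_on_subset_banach[OF has_sum_imp_summable[OF zero[of x]]]) (use less.prems in \<open>auto simp: x_def\<close>)
    then have hs: "(?F x has_sum (infsum (?F x) {m<..})) {m<..}" by simp
    then have "(?F x has_sum (?F x m + infsum (?F x) {m<..})) {m..}"
      unfolding eq by (intro has_sum_insert) auto
    ultimately have "?F x m + infsum (?F x) {m<..} = 0" using has_sum_unique by blast
    then have e: "norm (?F x m) = norm (infsum (?F x) {m<..})"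
      by (metis add_eq_0_iff norm_minus_cancel)
    have pw: "norm (?F x n) = norm (b n) * inverse (real n ^ 4) * inverse (real n ^ k)" if "x = 4 + real k" "n > 0" for n x k
    proof -
      have "norm (of_nat n powr (- complex_of_real x)) = real n powr (-x)"
        using that by (subst norm_powr_real_powr) auto
      also have "\<dots> = inverse (real n powr (4 + real k))" by (simp only: that(1) powr_minus)
      also have "\<dots> = inverse (real n ^ 4) * inverse (real n ^ k)"
        using that by (simp add: powr_add powr_realpow powr_numeral)
      finally show ?thesis by (simp add: norm_mult)
    qed
    have "norm (infsum (?F x) {m<..}) \<le> S * inverse (real (Suc m) ^ k)"
    proof (rule norm_infsum_le[OF has_sum_infsum has_sum_cmult_left])
      show "?F x summable_on {m<..}" by fact
      show "((\<lambda>n. norm (?F 4 n)) has_sum S) {m<..}" unfolding S_def using abs4' by simp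
      fix n assume n: "n \<in> {m<..}"
      have "norm (?F x n) = norm (?F 4 n) * inverse (real n ^ k)"
        using pw[OF x_def, of n] pw[of 4 0 n] n by simp
      also have "\<dots> \<le> norm (?F 4 n) * inverse (real (Suc m) ^ k)"
        using n by (intro mult_left_mono le_imp_inverse_le power_mono) auto
      finally show "norm (?F x n) \<le> norm (?F 4 n) * inverse (real (Suc m) ^ k)" .
    qed
    then have "norm (b m) * inverse (real m ^ 4) * inverse (real m ^ k) \<le> S * inverse (real (Suc m) ^ k)"
      using e pw[OF x_def, of m] less.prems by simp
    then show ?thesis using less.prems by (simp add: field_simps power_divide del: of_nat_Suc)
  qed
  have "(\<lambda>k. real m ^ 4 * S * (real m / real (Suc m)) ^ k) \<longlonglongrightarrow> real m ^ 4 * S * 0"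
    by (intro tendsto_mult tendsto_const LIMSEQ_power_zero) auto
  then have "norm (b m) \<le> real m ^ 4 * S * 0"
    by (rule LIMSEQ_le_const) (use bound in auto)
  then show ?case by simp
qed

text \<open>The convolution of \<open>a\<close> with itself and the constant 1 have the same
  Dirichlet series (w s)^2 for real s >= 4, hence the same coefficients.\<close>

lemma dirichlet_square_root_coeffs:
  fixes a :: "nat \<Rightarrow> complex" and w :: "complex \<Rightarrow> complex"
  assumes a: "\<And>s. Re s > 1 \<Longrightarrow> (\<lambda>n. a (Suc n) * of_nat (Suc n) powr (- s)) sums w s"
    and one: "\<And>s. Re s > 1 \<Longrightarrow> (\<lambda>n. of_nat (Suc n) powr (- s)) sums (w s)\<^sup>2"
    and k: "k > 0"
  shows "(\<Sum>d | d dvd k. a d * a (k div d)) = 1"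
proof -
  \<comment> \<open>The growth of \<open>a\<close> is derived: convergence at s = 2 makes a n / n^2
    bounded, which suffices for x >= 4.\<close>
  have "(\<lambda>n. a (Suc n) * of_nat (Suc n) powr (- 2)) \<longlonglongrightarrow> 0"
    using a[of 2] by (intro summable_LIMSEQ_zero) (auto simp: sums_iff)
  then have "Bseq (\<lambda>n. a (Suc n) * of_nat (Suc n) powr (- 2))" by (intro convergent_imp_Bseq) (auto simp: convergent_def)
  then obtain C where C: "norm (a (Suc n) * of_nat (Suc n) powr (- 2)) \<le> C" for n
    by (auto simp: Bseq_def)
  have bound: "norm (a n) \<le> C * real n ^ 2" if "n > 0" for n
  proof -
    obtain l where l: "n = Suc l" using gr0_implies_Suc \<open>n > 0\<close> by blast
    have "norm (of_nat (Suc l) powr (- 2 :: complex)) = inverse (real (Suc l) ^ 2)"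
      by (subst norm_powr_real_powr) (auto simp: powr_minus powr_numeral simp del: of_nat_Suc)
    then show ?thesis using C[of l] unfolding norm_mult l by (simp add: inverse_eq_divide pos_divide_le_eq del: of_nat_Suc)
  qed
  define b where "b = (\<lambda>k. (\<Sum>d | d dvd k. a d * a (k div d)) - 1)"
  have "b k = 0"
  proof (rule dirichlet_series_zero[OF _ k])
    fix x :: real assume x: "x \<ge> 4"
    let ?F = "\<lambda>n. a n * of_nat n powr (- complex_of_real x)"
    let ?P = "{0<..} :: nat set"
    have s1: "1 < Re (complex_of_real x)" using x by simp
    note F = dirichlet_series_has_sum[OF bound x a[OF s1]]
    have O: "((\<lambda>n. of_nat n powr (- complex_of_real x)) has_sum (w x)\<^sup>2) ?P"
      using dirichlet_series_has_sum(1)[of "\<lambda>_. 1" 1 x, OF _ x] one[OF s1] by (simp add: one_le_power)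
    have abs: "(\<lambda>p. norm (case p of (m,n) \<Rightarrow> ?F m * ?F n)) summable_on ?P \<times> ?P"
      unfolding Infinite_Sum.abs_summable_on_Sigma_iff
    proof (intro conjI ballI)
      show "(\<lambda>n. norm (case (m, n) of (m, n) \<Rightarrow> ?F m * ?F n)) summable_on ?P" for m
        unfolding prod.case norm_mult[of "?F m"] by (intro summable_on_cmult_right F(2))
      have "infsum (\<lambda>n. norm (case (m, n) of (m, n) \<Rightarrow> ?F m * ?F n)) ?P = norm (?F m) * infsum (\<lambda>n. norm (?F n)) ?P" for m
        unfolding prod.case norm_mult[of "?F m"] by (intro infsum_cmult_right F(2))
      then show "(\<lambda>m. norm (infsum (\<lambda>n. norm (case (m, n) of (m, n) \<Rightarrow> ?F m * ?F n)) ?P)) summable_on ?P"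
        using F(2) by (simp only: norm_mult[of "of_real _"] abs_mult real_norm_def abs_norm_cancel summable_on_cmult_left)
    qed
    have prod: "((\<lambda>(m,n). ?F m * ?F n) has_sum (w x)\<^sup>2) (?P \<times> ?P)"
    proof (rule has_sum_SigmaI)
      show "((\<lambda>n. case (m, n) of (m, n) \<Rightarrow> ?F m * ?F n) has_sum ?F m * w x) ?P" for m
        unfolding prod.case by (intro has_sum_cmult_right F(1))
      show "((\<lambda>m. ?F m * w x) has_sum (w x)\<^sup>2) ?P"
        unfolding power2_eq_square by (intro has_sum_cmult_left F(1))
      show "(\<lambda>(m,n). ?F m * ?F n) summable_on ?P \<times> ?P"
        using abs by (rule abs_summable_summable)
    qed
    \<comment> \<open>Absolute summability over pairs permits regrouping by the product k = m
      n.\<close>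
    have "((\<lambda>(k,d). ?F d * ?F (k div d)) has_sum (w x)\<^sup>2) (SIGMA k:?P. {d. d dvd k})"
      by (rule has_sum_reindex_bij_witness[where j = "\<lambda>(k,d). (d, k div d)" and i = "\<lambda>(m,n). (m * n, m)", THEN iffD2, OF _ _ _ _ _ _ prod])
         (auto elim!: dvdE intro: dvd_pos_nat)
    then have "((\<lambda>k. \<Sum>d | d dvd k. ?F d * ?F (k div d)) has_sum (w x)\<^sup>2) ?P"
      by (rule has_sum_Sigma') (auto intro!: has_sum_finite)
    from has_sum_add[OF this has_sum_uminusI[OF O]]
    have "((\<lambda>k. (\<Sum>d | d dvd k. ?F d * ?F (k div d)) - of_nat k powr (- complex_of_real x)) has_sum 0) ?P" by simp
    also have "?this \<longleftrightarrow> ((\<lambda>k. b k * of_nat k powr (- complex_of_real x)) has_sum 0) ?P"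
    proof (rule has_sum_cong)
      fix k :: nat assume "k \<in> ?P"
      then have "?F d * ?F (k div d) = a d * a (k div d) * of_nat k powr (- complex_of_real x)" if "d dvd k" for d
        using that by (auto elim!: dvdE simp: powr_times_real)
      then have e: "(\<Sum>d | d dvd k. ?F d * ?F (k div d)) = (\<Sum>d | d dvd k. a d * a (k div d)) * of_nat k powr (- complex_of_real x)"
        unfolding sum_distrib_right by (intro sum.cong) auto
      show "(\<Sum>d | d dvd k. ?F d * ?F (k div d)) - of_nat k powr (- complex_of_real x) = b k * of_nat k powr (- complex_of_real x)"
        unfolding e b_def by (simp add: left_diff_distrib)
    qed
    finally show "((\<lambda>k. b k * of_nat k powr (- complex_of_real x)) has_sum 0) ?P" .
  qed
  then show ?thesis by (simp add: b_def)
qed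


text \<open>The pure algebra of the identity. The intended reading is w = sqrt zeta(s), w' = sqrt
  zeta(1-s), \<rho> = sqrt chi(s), cc = chi(s); S and T are the inner sums of the two hyperbola
  formulas. Their mixed sums enter as 2 \<rho> (FX GY + D), and the part 2 \<rho> FX GY is just the
  cross term that completes the square E^2.\<close>

lemma hyperbola_remainder_identity:
  fixes S T \<epsilon> \<epsilon>' :: "nat \<Rightarrow> complex" and f g :: "nat \<Rightarrow> complex"
  fixes w w' cc \<rho> \<rho>' FX GY D E :: complex
  assumes "finite A" "finite B"
    and S: "\<And>n. n \<in> A \<Longrightarrow> S n = w - \<rho> * G n - \<epsilon> n"
    and T: "\<And>n. n \<in> B \<Longrightarrow> T n = w' - \<rho>' * F n - \<epsilon>' n"
    and w: "w = \<rho> * w'" and rho: "\<rho>\<^sup>2 = cc" "\<rho> * \<rho>' = 1"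
    and FX: "FX = sum f A" and GY: "GY = sum g B" and E: "E = w - FX - \<rho> * GY"
    and D: "(\<Sum>n\<in>A. f n * G n) + (\<Sum>n\<in>B. g n * F n) = FX * GY + D"
  shows "w\<^sup>2 - (2 * (\<Sum>n\<in>A. f n * S n) - FX\<^sup>2) - cc * (2 * (\<Sum>n\<in>B. g n * T n) - GY\<^sup>2)
     = 2 * ((\<Sum>n\<in>A. f n * \<epsilon> n) + cc * (\<Sum>n\<in>B. g n * \<epsilon>' n) + \<rho> * D) + E\<^sup>2"
proof -
  have s: "(\<Sum>n\<in>A. f n * S n) = w * FX - \<rho> * (\<Sum>n\<in>A. f n * G n) - (\<Sum>n\<in>A. f n * \<epsilon> n)"
    unfolding FX sum_distrib_left sum_subtractf[symmetric] by (rule sum.cong) (auto simp: S algebra_simps)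
  have t: "(\<Sum>n\<in>B. g n * T n) = w' * GY - \<rho>' * (\<Sum>n\<in>B. g n * F n) - (\<Sum>n\<in>B. g n * \<epsilon>' n)"
    unfolding GY sum_distrib_left sum_subtractf[symmetric] by (rule sum.cong) (auto simp: T algebra_simps)
  define U where "U = (\<Sum>n\<in>A. f n * G n)"
  define V where "V = (\<Sum>n\<in>B. g n * F n)"
  \<comment> \<open>These two relations turn chi(s) times the square roots at 1 - s into square
    roots at s.\<close>
  have chi1: "cc * w' = \<rho> * w" using w rho by (simp add: power2_eq_square)
  have chi2: "cc * \<rho>' = \<rho>" unfolding rho(1)[symmetric] power2_eq_square mult.assoc rho(2) by simp
  have UV: "U + V = FX * GY + D" using D by (simp add: U_def V_def)
  have "cc * (2 * (\<Sum>n\<in>B. g n * T n) - GY\<^sup>2) = 2 * (cc * w') * GY - 2 * (cc * \<rho>') * V - 2 * cc * (\<Sum>n\<in>B. g n * \<epsilon>' n) - cc * GY\<^sup>2"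
    unfolding t V_def by (simp add: algebra_simps)
  also have "\<dots> = 2 * \<rho> * w * GY - 2 * \<rho> * V - 2 * cc * (\<Sum>n\<in>B. g n * \<epsilon>' n) - \<rho>\<^sup>2 * GY\<^sup>2"
    unfolding chi1 chi2 rho by simp
  finally have x: "cc * (2 * (\<Sum>n\<in>B. g n * T n) - GY\<^sup>2) = \<dots>" .
  have rD: "\<rho> * D = \<rho> * (U + V) - \<rho> * FX * GY" using UV by (simp add: algebra_simps)
  show ?thesis
    unfolding x s U_def[symmetric] E rD by (simp add: algebra_simps power2_eq_square)
qed

lemma E_one_hyperbola:
  fixes a :: "nat \<Rightarrow> complex" and rz rchi :: "complex \<Rightarrow> complex"
  assumes conv: "\<And>k. k > 0 \<Longrightarrow> (\<Sum>d | d dvd k. a d * a (k div d)) = 1"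
    and rz: "(rz s)\<^sup>2 = zeta s" and rchi: "(rchi s)\<^sup>2 = chi s"
    and compat: "rz s = rchi s * rz (1 - s)" and reflect: "rchi s * rchi (1 - s) = 1"
    and X: "X > 0" and Y: "Y > 0" and t: "X * Y = Im s / (2 * pi)"
  shows "E_one s X =
          2 * ((\<Sum>n\<in>nats_upto (sqrt X).
                  a n * of_nat n powr (- s) * E_half rz rchi a s (X / real n))
             + chi s * (\<Sum>n\<in>nats_upto (sqrt Y).
                  a n * of_nat n powr (s - 1) * E_half rz rchi a (1 - s) (Y / real n))
             + diagonal_term rchi a s X Y)
          + (E_half rz rchi a s (sqrt X))\<^sup>2"
proof -
  define f where "f = (\<lambda>n. a n * of_nat n powr (- s))"
  define g where "g = (\<lambda>n. a n * of_nat n powr (s - 1))"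
  define r where "r = sqrt (X / Y)"
  have r: "r > 0" using X Y by (simp add: r_def)
  have XY: "sqrt X = r * sqrt Y" using X Y by (simp add: r_def real_sqrt_divide)
  have Yt: "Im s / (2 * pi) / X = Y" using t X by (simp add: field_simps)
  \<comment> \<open>Positivity removes the absolute value in \<open>E_half\<close>, at s and at 1 -
    s alike.\<close>
  have t0: "Im s > 0" 
  proof -
    have "Im s = 2 * pi * (X * Y)" using t by simp
    then show ?thesis using X Y by simp
  qed
  have sq: "sqrt (\<bar>Im s\<bar> / (2 * pi)) = sqrt X * sqrt Y" using t t0 by (simp add: real_sqrt_mult[symmetric])
  have psum: "(\<Sum>k\<in>nats_upto Z. of_nat k powr z) = 2 * (\<Sum>n\<in>nats_upto (sqrt Z). h n * (\<Sum>m\<in>nats_upto (Z / n). h m)) - (\<Sum>n\<in>nats_upto (sqrt Z). h n)\<^sup>2"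
    if Z: "Z > 0" and h: "h = (\<lambda>n. a n * of_nat n powr z)" for Z z h
  proof -
    have "(\<Sum>k\<in>nats_upto Z. of_nat k powr z) = (\<Sum>k\<in>nats_upto Z. \<Sum>d | d dvd k. h d * h (k div d))"
    proof (rule sum.cong[OF refl])
      fix k assume "k \<in> nats_upto Z"
      then have k: "k > 0" by (simp add: nats_upto_iff)
      have "h d * h (k div d) = a d * a (k div d) * of_nat k powr z" if "d dvd k" for d
        using that by (auto elim!: dvdE simp: h powr_times_real)
      then have "(\<Sum>d | d dvd k. h d * h (k div d)) = (\<Sum>d | d dvd k. a d * a (k div d)) * of_nat k powr z"
        unfolding sum_distrib_right by (intro sum.cong) auto
      then show "of_nat k powr z = (\<Sum>d | d dvd k. h d * h (k div d))" using conv[OF k] by simp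
    qed
    then show ?thesis using sum_divisor_pairs[of "\<lambda>m n. h m * h n" Z] hyperbola_sum[OF Z, of h] by simp
  qed
  have p: "a n * of_nat n powr - (1 - s) = g n" for n by (simp add: g_def)
  have E1: "E_one s X = (rz s)\<^sup>2 - (2 * (\<Sum>n\<in>nats_upto (sqrt X). f n * (\<Sum>m\<in>nats_upto (X / n). f m)) - (\<Sum>n\<in>nats_upto (sqrt X). f n)\<^sup>2)
     - chi s * (2 * (\<Sum>n\<in>nats_upto (sqrt Y). g n * (\<Sum>m\<in>nats_upto (Y / n). g m)) - (\<Sum>n\<in>nats_upto (sqrt Y). g n)\<^sup>2)"
    unfolding E_one_def Yt rz dirichlet_psum_def using psum[OF X f_def] psum[OF Y g_def] by simp
  have Eh: "E_half rz rchi a s (sqrt X) = rz s - (\<Sum>n\<in>nats_upto (sqrt X). f n) - rchi s * (\<Sum>n\<in>nats_upto (sqrt Y). g n)"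
    using X unfolding E_half_def dirichlet_psum_def sq p by (simp add: f_def)
  \<comment> \<open>For m = n r the factor n^(s-1) (n r)^(-s) is r^(-s) / n.\<close>
  have dg: "rchi s * (\<Sum>n\<in>nats_upto (sqrt Y). g n * ext_coeff f (real n * r)) = diagonal_term rchi a s X Y"
  proof -
    have "g n * ext_coeff f (real n * r) = of_real r powr (- s) * (a n * ext_coeff a (real n * r) / of_nat n)" if "n > 0" for n
    proof (cases "real n * r \<in> \<nat>")
      case True
      then obtain m where m: "real n * r = real m" by (auto elim: Nats_cases)
      have "of_nat m = of_nat n * complex_of_real r" using m by (metis of_real_mult of_real_of_nat_eq)
      then have mp: "of_nat m powr (-s) = of_nat n powr (-s) * complex_of_real r powr (-s)"
        using r by (simp add: powr_times_real)
      have "of_nat n powr (s - 1) * of_nat n powr (-s) = (of_nat n powr (-1) :: complex)"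
        by (simp add: powr_add[symmetric])
      also have "\<dots> = 1 / of_nat n" using that by (simp add: powr_minus field_simps)
      finally have np: "of_nat n powr (s - 1) * of_nat n powr (-s) = (1 / of_nat n :: complex)" .
      have "real m > 0" using m that r by (metis mult_pos_pos of_nat_0_less_iff)
      then have "g n * ext_coeff f (real n * r) = a n * a m * (of_nat n powr (s - 1) * of_nat n powr (-s)) * of_real r powr (-s)"
        unfolding ext_coeff_def m by (simp add: g_def f_def mp)
      then show ?thesis unfolding np using \<open>real m > 0\<close> by (simp add: ext_coeff_def m)
    qed (simp add: ext_coeff_def)
    then have "(\<Sum>n\<in>nats_upto (sqrt Y). g n * ext_coeff f (real n * r)) = of_real r powr (- s) * (\<Sum>n\<in>nats_upto (sqrt Y). a n * ext_coeff a (real n * r) / of_nat n)"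
      unfolding sum_distrib_left by (intro sum.cong) (auto simp: nats_upto_iff)
    then show ?thesis by (simp add: diagonal_term_def r_def)
  qed
  have "E_one s X = 2 * ((\<Sum>n\<in>nats_upto (sqrt X). f n * E_half rz rchi a s (X / real n)) + 
      chi s * (\<Sum>n\<in>nats_upto (sqrt Y). g n * E_half rz rchi a (1 - s) (Y / real n)) +
      rchi s * (\<Sum>n\<in>nats_upto (sqrt Y). g n * ext_coeff f (real n * r))) + (E_half rz rchi a s (sqrt X))\<^sup>2"
    unfolding E1
  proof (rule hyperbola_remainder_identity[where w' = "rz (1 - s)" and \<rho>' = "rchi (1 - s)" and
      G = "\<lambda>n. \<Sum>m\<in>nats_upto (n / r). g m" and F = "\<lambda>n. \<Sum>m\<in>nats_upto (n * r). f m"])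
    fix n assume "n \<in> nats_upto (sqrt X)"
    then have n: "n > 0" by (simp add: nats_upto_iff)
    \<comment> \<open>The dual sum in \<open>E_half\<close> at X / n ends at n / r, exactly on the
      dividing line of \<open>diagonal_double_count\<close>.\<close>
    have "sqrt X * sqrt Y / (X / real n) = real n / r"
      using X Y n by (simp add: r_def real_sqrt_divide field_simps)
    then show "(\<Sum>m\<in>nats_upto (X / n). f m) = rz s - rchi s * (\<Sum>m\<in>nats_upto (real n / r). g m) - E_half rz rchi a s (X / real n)"
      unfolding E_half_def dirichlet_psum_def sq p by (simp add: f_def)
  next
    fix n assume "n \<in> nats_upto (sqrt Y)"
    then have n: "n > 0" by (simp add: nats_upto_iff)
    have "sqrt X * sqrt Y / (Y / real n) = real n * r"
      using X Y n by (simp add: r_def real_sqrt_divide field_simps)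
    moreover have "sqrt (\<bar>Im (1 - s)\<bar> / (2 * pi)) = sqrt X * sqrt Y" using sq by simp
    ultimately show "(\<Sum>m\<in>nats_upto (Y / n). g m) = rz (1 - s) - rchi (1 - s) * (\<Sum>m\<in>nats_upto (real n * r). f m) - E_half rz rchi a (1 - s) (Y / real n)"
      unfolding E_half_def dirichlet_psum_def p by (simp add: f_def)
  next
    show "(\<Sum>n\<in>nats_upto (sqrt X). f n * (\<Sum>m\<in>nats_upto (real n / r). g m)) +
      (\<Sum>n\<in>nats_upto (sqrt Y). g n * (\<Sum>m\<in>nats_upto (real n * r). f m)) =
      (\<Sum>n\<in>nats_upto (sqrt X). f n) * (\<Sum>n\<in>nats_upto (sqrt Y). g n) + (\<Sum>n\<in>nats_upto (sqrt Y). g n * ext_coeff f (real n * r))"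
      unfolding XY by (rule diagonal_double_count[OF r])
  qed (use compat rchi reflect Eh in auto)
  then show ?thesis unfolding dg by (simp only: f_def g_def)
qed

lemma diagonal_term_irrational:
  assumes "sqrt (X / Y) \<notin> \<rat>"
  shows "diagonal_term rchi a s X Y = 0"
proof -
  have "ext_coeff a (real n * sqrt (X / Y)) = 0" if "n > 0" for n
  proof -
    have "real n * sqrt (X / Y) \<notin> \<nat>"
    proof
      assume "real n * sqrt (X / Y) \<in> \<nat>"
      then obtain k where "real n * sqrt (X / Y) = real k" by (elim Nats_cases)
      then have "sqrt (X / Y) = real k / real n" using that by (simp add: field_simps)
      also have "\<dots> \<in> \<rat>" by (intro Rats_divide Rats_of_nat)
      finally show False using assms by simp
    qed
    then show ?thesis by (simp add: ext_coeff_def)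
  qed
  then show ?thesis by (simp add: diagonal_term_def nats_upto_iff)
qed

section \<open>Oscillatory integrals with logarithmic phase\<close>

text \<open>The bound is demanded on all subintervals because the second mean value theorem cuts at
  an unknown point. In this form the property survives multiplication by any number of monotone
  weights.\<close>

definition osc :: "real \<Rightarrow> real \<Rightarrow> (real \<Rightarrow> complex) \<Rightarrow> real \<Rightarrow> bool" where
  "osc A B F M \<longleftrightarrow> (\<forall>a b. A \<le> a \<and> a \<le> b \<and> b \<le> B \<longrightarrow>
     F integrable_on {a..b} \<and> norm (integral {a..b} F) \<le> M)"

definition mono_upto :: "real \<Rightarrow> real \<Rightarrow> (real \<Rightarrow> real) \<Rightarrow> real \<Rightarrow> bool" where
  "mono_upto A B p P \<longleftrightarrow> (mono_on {A..B} p \<or> antimono_on {A..B} p) \<and> (\<forall>u\<in>{A..B}. \<bar>p u\<bar> \<le> P)"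

lemma real_second_mean_value_bound:
  fixes f p :: "real \<Rightarrow> real"
  assumes f: "\<And>c d. a \<le> c \<Longrightarrow> c \<le> d \<Longrightarrow> d \<le> b \<Longrightarrow> f integrable_on {c..d} \<and> \<bar>integral {c..d} f\<bar> \<le> M"
    and "a \<le> b" and p: "mono_upto a b p P"
  shows "(\<lambda>u. p u * f u) integrable_on {a..b} \<and> \<bar>integral {a..b} (\<lambda>u. p u * f u)\<bar> \<le> 2 * P * M"
proof -
  have M: "M \<ge> 0" using f[of a a] \<open>a \<le> b\<close> by (meson abs_ge_zero order_refl order_trans)
  have mono: "(\<lambda>u. q u * f u) integrable_on {a..b} \<and> \<bar>integral {a..b} (\<lambda>u. q u * f u)\<bar> \<le> 2 * P * M"
    if m: "mono_on {a..b} q" and q: "\<forall>u\<in>{a..b}. \<bar>q u\<bar> \<le> P" for q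
  proof -
    have fi: "f integrable_on {a..b}" using f[of a b] \<open>a \<le> b\<close> by auto
    have qm: "\<And>x y. \<lbrakk>a \<le> x; x \<le> y; y \<le> b\<rbrakk> \<Longrightarrow> q x \<le> q y"
      using m by (auto simp: mono_on_def)
    obtain c where c: "c \<in> {a..b}" and
      hi: "((\<lambda>x. q x * f x) has_integral (q a * integral {a..c} f + q b * integral {c..b} f)) {a..b}"
      using second_mean_value_theorem_full[where g = q, OF fi \<open>a \<le> b\<close> qm] by blast
    have "\<bar>q a * integral {a..c} f + q b * integral {c..b} f\<bar>
        \<le> \<bar>q a\<bar> * \<bar>integral {a..c} f\<bar> + \<bar>q b\<bar> * \<bar>integral {c..b} f\<bar>"
      by (metis abs_mult abs_triangle_ineq)
    also have "\<dots> \<le> P * M + P * M"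
      using q f[of a c] f[of c b] c \<open>a \<le> b\<close> M
      by (intro add_mono mult_mono) (auto intro: order_trans[of 0 "\<bar>q a\<bar>" P])
    finally show ?thesis using hi by (auto simp: integrable_on_def integral_unique mult_ac)
  qed
  from p consider "mono_on {a..b} p" | "mono_on {a..b} (\<lambda>u. - p u)"
    unfolding mono_upto_def monotone_on_def by force
  then show ?thesis
  proof cases
    case 1 then show ?thesis using mono[of p] p by (auto simp: mono_upto_def)
  next
    case 2
    have "(\<lambda>u. - p u * f u) integrable_on {a..b} \<and> \<bar>integral {a..b} (\<lambda>u. - p u * f u)\<bar> \<le> 2 * P * M"
      using mono[OF 2] p by (auto simp: mono_upto_def)
    then show ?thesis by (simp add: integrable_neg_iff)
  qed
qed

text \<open>Each monotone weight costs a factor 4: 2 from the second mean value theorem, and 2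
  because real and imaginary parts have different cut points. Starting from the 2 of
  \<open>osc_base\<close>, two, three or four weights give the constants 32, 128 and 512
  below.\<close>

lemma osc_mono_mult:
  assumes F: "osc A B F M" and p: "mono_upto A B p P"
  shows "osc A B (\<lambda>u. of_real (p u) * F u) (4 * P * M)"
  unfolding osc_def
proof (intro allI impI)
  fix a b assume ab: "A \<le> a \<and> a \<le> b \<and> b \<le> B"
  have p': "mono_upto a b p P"
    using p ab unfolding mono_upto_def by (auto intro: monotone_on_subset)
  have FF: "F integrable_on {c..d}" "norm (integral {c..d} F) \<le> M" if "a \<le> c" "c \<le> d" "d \<le> b" for c d
    using F that ab unfolding osc_def by auto
  have R: "(\<lambda>u. p u * Re (F u)) integrable_on {a..b} \<and> \<bar>integral {a..b} (\<lambda>u. p u * Re (F u))\<bar> \<le> 2 * P * M"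
  proof (rule real_second_mean_value_bound)
    fix c d assume cd: "a \<le> c" "c \<le> d" "d \<le> b"
    have hi: "((\<lambda>u. Re (F u)) has_integral Re (integral {c..d} F)) {c..d}"
      using has_integral_linear[OF integrable_integral[OF FF(1)[OF cd]] bounded_linear_Re] by (simp add: o_def)
    show "(\<lambda>u. Re (F u)) integrable_on {c..d} \<and> \<bar>integral {c..d} (\<lambda>u. Re (F u))\<bar> \<le> M"
      using hi abs_Re_le_cmod[of "integral {c..d} F"] FF(2)[OF cd]
      by (auto simp: integrable_on_def integral_unique)
  qed (use ab p' in auto)
  have I: "(\<lambda>u. p u * Im (F u)) integrable_on {a..b} \<and> \<bar>integral {a..b} (\<lambda>u. p u * Im (F u))\<bar> \<le> 2 * P * M"
  proof (rule real_second_mean_value_bound)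
    fix c d assume cd: "a \<le> c" "c \<le> d" "d \<le> b"
    have hi: "((\<lambda>u. Im (F u)) has_integral Im (integral {c..d} F)) {c..d}"
      using has_integral_linear[OF integrable_integral[OF FF(1)[OF cd]] bounded_linear_Im] by (simp add: o_def)
    show "(\<lambda>u. Im (F u)) integrable_on {c..d} \<and> \<bar>integral {c..d} (\<lambda>u. Im (F u))\<bar> \<le> M"
      using hi abs_Im_le_cmod[of "integral {c..d} F"] FF(2)[OF cd]
      by (auto simp: integrable_on_def integral_unique)
  qed (use ab p' in auto)
  let ?I = "Complex (integral {a..b} (\<lambda>u. p u * Re (F u))) (integral {a..b} (\<lambda>u. p u * Im (F u)))"
  have "((\<lambda>u. complex_of_real (p u * Re (F u)) + \<i> * complex_of_real (p u * Im (F u))) has_integral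
      (complex_of_real (integral {a..b} (\<lambda>u. p u * Re (F u))) + \<i> * complex_of_real (integral {a..b} (\<lambda>u. p u * Im (F u))))) {a..b}"
    by (intro has_integral_add has_integral_mult_right has_integral_of_real integrable_integral)
       (use R I in auto)
  then have hi: "((\<lambda>u. of_real (p u) * F u) has_integral ?I) {a..b}"
    by (rule has_integral_eq_rhs[OF has_integral_eq, rotated]) (auto simp: complex_eq_iff)
  have "norm ?I \<le> \<bar>Re ?I\<bar> + \<bar>Im ?I\<bar>" by (rule cmod_le)
  also have "\<dots> \<le> 4 * P * M" using R I by auto
  finally show "(\<lambda>u. of_real (p u) * F u) integrable_on {a..b} \<and> norm (integral {a..b} (\<lambda>u. of_real (p u) * F u)) \<le> 4 * P * M"
    using hi by (auto simp: integrable_on_def integral_unique)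
qed

text \<open>This is exp(2 pi i v u) u^(-it); its phase is stationary at u = t / (2 pi v).\<close>

definition osc_unit :: "real \<Rightarrow> real \<Rightarrow> real \<Rightarrow> complex" where
  "osc_unit v t u = cis (2 * pi * v * u - t * ln u)"

lemma norm_osc_unit [simp]: "norm (osc_unit v t u) = 1"
  by (simp add: osc_unit_def)

lemma osc_unit_deriv:
  assumes "u > 0"
  shows "(osc_unit v t has_vector_derivative (\<i> * of_real (2 * pi * v - t / u) * osc_unit v t u)) (at u within S)"
proof -
  have "((\<lambda>u. 2 * pi * v * u - t * ln u) has_real_derivative (2 * pi * v - t / u)) (at u within S)"
    using assms by (auto intro!: derivative_eq_intros)
  then have "((\<lambda>u. \<i> * of_real (2 * pi * v * u - t * ln u)) has_vector_derivative
     \<i> * of_real (2 * pi * v - t / u)) (at u within S)"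
    by (intro has_vector_derivative_mult_right has_vector_derivative_of_real)
       (simp add: has_real_derivative_iff_has_vector_derivative)
  from field_vector_diff_chain_within[OF this DERIV_exp[THEN has_field_derivative_at_within]]
  show ?thesis
    by (simp add: o_def osc_unit_def[abs_def] cis_conv_exp mult_ac)
qed

text \<open>Phase derivative times exponential is an exact derivative, whether or not the phase is
  stationary somewhere. All estimates below write their integrand as this function times monotone
  weights.\<close>

lemma osc_base:
  assumes "A > 0"
  shows "osc A B (\<lambda>u. of_real (2 * pi * v - t / u) * osc_unit v t u) 2"
  unfolding osc_def
proof (intro allI impI)
  fix a b assume ab: "A \<le> a \<and> a \<le> b \<and> b \<le> B"
  have "((\<lambda>u. of_real (2 * pi * v - t / u) * osc_unit v t u) has_integral
      (- \<i> * osc_unit v t b - (- \<i> * osc_unit v t a))) {a..b}"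
  proof (rule fundamental_theorem_of_calculus)
    fix x assume "x \<in> {a..b}"
    then have "x > 0" using ab assms by auto
    from has_vector_derivative_mult_right[OF osc_unit_deriv[OF this], of "-\<i>" v t]
    show "((\<lambda>u. - \<i> * osc_unit v t u) has_vector_derivative of_real (2 * pi * v - t / x) * osc_unit v t x) (at x within {a..b})"
      by (simp flip: mult.assoc)
  qed (use ab in auto)
  moreover have "norm (- \<i> * osc_unit v t b - (- \<i> * osc_unit v t a)) \<le> 2"
    by (rule order_trans[OF norm_triangle_ineq4]) (simp add: norm_mult)
  ultimately show "(\<lambda>u. of_real (2 * pi * v - t / u) * osc_unit v t u) integrable_on {a..b} \<and>
      norm (integral {a..b} (\<lambda>u. of_real (2 * pi * v - t / u) * osc_unit v t u)) \<le> 2"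
    by (auto simp: integrable_on_def integral_unique)
qed

lemma osc_cong:
  assumes "osc A B F M" and "\<And>u. A \<le> u \<Longrightarrow> u \<le> B \<Longrightarrow> G u = F u"
  shows "osc A B G M"
  unfolding osc_def
proof (intro allI impI)
  fix a b assume ab: "A \<le> a \<and> a \<le> b \<and> b \<le> B"
  have "integral {a..b} G = integral {a..b} F" "G integrable_on {a..b} \<longleftrightarrow> F integrable_on {a..b}"
    using assms(2) ab by (auto intro!: integral_cong integrable_cong)
  then show "G integrable_on {a..b} \<and> norm (integral {a..b} G) \<le> M"
    using assms(1) ab unfolding osc_def by auto
qed

lemma mono_upto_antimonoI:
  assumes "\<And>x y. A \<le> x \<Longrightarrow> x \<le> y \<Longrightarrow> y \<le> B \<Longrightarrow> p y \<le> p x" "\<And>u. A \<le> u \<Longrightarrow> u \<le> B \<Longrightarrow> \<bar>p u\<bar> \<le> P"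
  shows "mono_upto A B p P"
  using assms by (auto simp: mono_upto_def monotone_on_def)

lemma mono_upto_monoI:
  assumes "\<And>x y. A \<le> x \<Longrightarrow> x \<le> y \<Longrightarrow> y \<le> B \<Longrightarrow> p x \<le> p y" "\<And>u. A \<le> u \<Longrightarrow> u \<le> B \<Longrightarrow> \<bar>p u\<bar> \<le> P"
  shows "mono_upto A B p P"
  using assms by (auto simp: mono_upto_def monotone_on_def)

lemma mono_upto_powr_neg:
  assumes "A > 0" "\<sigma> \<ge> 0"
  shows "mono_upto A B (\<lambda>u. u powr (-\<sigma>)) (A powr (-\<sigma>))"
  by (rule mono_upto_antimonoI) (use assms in \<open>auto intro!: powr_mono2'\<close>)

lemma mono_upto_powr_pos:
  assumes "A > 0" "a \<ge> 0"
  shows "mono_upto A B (\<lambda>u. u powr a) (B powr a)"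
  by (rule mono_upto_monoI) (use assms in \<open>auto intro!: powr_mono2\<close>)

definition osc_fun :: "real \<Rightarrow> real \<Rightarrow> real \<Rightarrow> real \<Rightarrow> complex" where
  "osc_fun \<sigma> v t u = of_real (u powr (-\<sigma>)) * osc_unit v t u"

text \<open>The leading term of integration by parts: u^(-\<sigma>) divided by i times the phase
  derivative (2 pi v u - t) / u.\<close>

definition osc_prim :: "real \<Rightarrow> real \<Rightarrow> real \<Rightarrow> real \<Rightarrow> complex" where
  "osc_prim \<sigma> v t u = - \<i> * (of_real (u powr (1 - \<sigma>) / (2 * pi * v * u - t)) * osc_unit v t u)"

text \<open>The derivative of \<open>osc_prim\<close> is \<open>osc_fun\<close> plus i times the
  integrand in \<open>o\<close>. Dividing that error by the phase derivative once more, whence the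
  cube, brings it to the form of \<open>osc_base\<close> times real weights.\<close>

lemma osc_by_parts:
  assumes "A > 0" "A \<le> B" and L: "\<And>u. A \<le> u \<Longrightarrow> u \<le> B \<Longrightarrow> 2 * pi * v * u - t \<noteq> 0"
    and o: "osc A B (\<lambda>u. of_real (u powr (1 - \<sigma>) * (2 * pi * \<sigma> * v * u + (1 - \<sigma>) * t) / (2 * pi * v * u - t) ^ 3)
                 * (of_real (2 * pi * v - t / u) * osc_unit v t u)) M"
  shows "osc_fun \<sigma> v t integrable_on {A..B}"
    "norm (integral {A..B} (osc_fun \<sigma> v t) - (osc_prim \<sigma> v t B - osc_prim \<sigma> v t A)) \<le> M"
proof -
  let ?R = "\<lambda>u. of_real (u powr (1 - \<sigma>) * (2 * pi * \<sigma> * v * u + (1 - \<sigma>) * t) / (2 * pi * v * u - t) ^ 3)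
                 * (of_real (2 * pi * v - t / u) * osc_unit v t u)"
  have R: "?R integrable_on {A..B}" "norm (integral {A..B} ?R) \<le> M"
    using o \<open>A \<le> B\<close> unfolding osc_def by auto
  have "((\<lambda>u. osc_fun \<sigma> v t u + \<i> * ?R u) has_integral (osc_prim \<sigma> v t B - osc_prim \<sigma> v t A)) {A..B}"
  proof (rule fundamental_theorem_of_calculus)
    fix u assume u: "u \<in> {A..B}"
    then have u0: "u > 0" and L0: "2 * pi * v * u - t \<noteq> 0" using \<open>A > 0\<close> L by auto
    define D where "D = 2 * pi * v * u - t"
    have D0: "D \<noteq> 0" using L0 by (simp add: D_def)
    have ph: "2 * pi * v - t / u = D / u" using u0 by (simp add: D_def field_simps)
    define g' where "g' = - (u powr (-\<sigma>) * (2 * pi * \<sigma> * v * u + (1 - \<sigma>) * t) / D\<^sup>2)"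
    have powr1: "u powr (1 - \<sigma>) = u * u powr (-\<sigma>)"
      using u0 powr_add[of u 1 "-\<sigma>"] by simp
    have "((\<lambda>u. u powr (1 - \<sigma>) / (2 * pi * v * u - t)) has_real_derivative
        ((1 - \<sigma>) * u powr (-\<sigma>) * D - u powr (1 - \<sigma>) * (2 * pi * v)) / (D * D)) (at u within {A..B})"
      unfolding D_def using u0 L0
      by (auto intro!: derivative_eq_intros simp: mult_ac)
    also have "((1 - \<sigma>) * u powr (-\<sigma>) * D - u powr (1 - \<sigma>) * (2 * pi * v)) = 
        - (u powr (-\<sigma>) * (2 * pi * \<sigma> * v * u + (1 - \<sigma>) * t))"
      unfolding powr1 by (simp add: D_def algebra_simps)
    also have "\<dots> / (D * D) = g'" by (simp add: g'_def power2_eq_square)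
    finally have dg: "((\<lambda>u. u powr (1 - \<sigma>) / (2 * pi * v * u - t)) has_real_derivative g') (at u within {A..B})" .
    have dg': "((\<lambda>u. complex_of_real (u powr (1 - \<sigma>) / (2 * pi * v * u - t))) has_vector_derivative of_real g') (at u within {A..B})"
      by (rule has_vector_derivative_of_real) (use dg in \<open>simp add: has_real_derivative_iff_has_vector_derivative\<close>)
    have d: "(osc_prim \<sigma> v t has_vector_derivative
        - \<i> * (of_real (u powr (1 - \<sigma>) / D) * (\<i> * of_real (D / u) * osc_unit v t u) + of_real g' * osc_unit v t u))
        (at u within {A..B})"
      unfolding osc_prim_def [abs_def]
      using has_vector_derivative_mult_right[OF has_vector_derivative_mult[OF dg' osc_unit_deriv[OF u0, of v t]], of "-\<i>"]
      by (simp add: ph flip: D_def)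
    have e1: "u powr (1 - \<sigma>) / D * (D / u) = u powr (-\<sigma>)"
      using u0 D0 powr1 by (simp add: field_simps)
    have e2: "- g' = u powr (1 - \<sigma>) * (2 * pi * \<sigma> * v * u + (1 - \<sigma>) * t) / D ^ 3 * (D / u)"
      using u0 D0 unfolding powr1 g'_def by (simp add: field_simps power3_eq_cube power2_eq_square)
    have "- \<i> * (of_real (u powr (1 - \<sigma>) / D) * (\<i> * of_real (D / u) * osc_unit v t u) + of_real g' * osc_unit v t u)
       = of_real (u powr (1 - \<sigma>) / D * (D / u)) * osc_unit v t u + \<i> * (of_real (- g') * osc_unit v t u)"
      by (simp add: algebra_simps)
    also have "\<dots> = osc_fun \<sigma> v t u + \<i> * ?R u"
      unfolding e1 e2 osc_fun_def ph D_def[symmetric] by (simp only: of_real_mult mult.assoc)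
    finally show "(osc_prim \<sigma> v t has_vector_derivative osc_fun \<sigma> v t u + \<i> * ?R u) (at u within {A..B})"
      using d by simp
  qed (fact \<open>A \<le> B\<close>)
  from has_integral_diff[OF this has_integral_mult_right[OF integrable_integral[OF R(1)], of "\<i>"]]
  have hi: "(osc_fun \<sigma> v t has_integral (osc_prim \<sigma> v t B - osc_prim \<sigma> v t A - \<i> * integral {A..B} ?R)) {A..B}"
    by simp
  then show "osc_fun \<sigma> v t integrable_on {A..B}" by (auto simp: integrable_on_def)
  have "integral {A..B} (osc_fun \<sigma> v t) - (osc_prim \<sigma> v t B - osc_prim \<sigma> v t A) = - (\<i> * integral {A..B} ?R)"
    using integral_unique[OF hi] by simp
  then show "norm (integral {A..B} (osc_fun \<sigma> v t) - (osc_prim \<sigma> v t B - osc_prim \<sigma> v t A)) \<le> M"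
    using R(2) by (simp add: norm_mult)
qed

lemma divide_four_pi_sq_le:
  fixes c :: real
  assumes "c \<ge> 0"
  shows "c / (4 * pi\<^sup>2) \<le> c"
proof -
  have "1 \<le> 4 * pi\<^sup>2" using pi_ge_two power_mono[of 2 pi 2] by simp
  then show ?thesis using frac_le[of c c 1 "4 * pi\<^sup>2"] assms by simp
qed

section \<open>Integrals cut at N, for frequencies v with stationary point N Y / v\<close>

context
  fixes N Y t \<sigma> :: real
  assumes N: "N > 0" and Y: "Y > 0" and t: "t = 2 * pi * N * Y" and \<sigma>: "0 < \<sigma>" "\<sigma> < 1"
begin

lemma osc_param_pos: "t > 0" using N Y t by simp

text \<open>For v > Y the stationary point lies below N. The error weight splits into u^(-\<sigma>),
  u / L, 1 / L and q, all nonincreasing on [N, B], so only their values at N enter and the bound is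
  uniform in B.\<close>

lemma osc_upper_pos:
  assumes v: "v > Y" and B: "N \<le> B"
  shows "norm (integral {N..B} (osc_fun \<sigma> v t) - (osc_prim \<sigma> v t B - osc_prim \<sigma> v t N))
           \<le> 512 * (N powr (-\<sigma>) / N * v / (v - Y) ^ 3)"
proof -
  define L where "L = (\<lambda>u. 2 * pi * v * u - t)"
  define d where "d = 2 * pi * N * (v - Y)"
  have d: "d > 0" using N v by (simp add: d_def)
  have v0: "v > 0" using v Y by simp
  have LN: "L N = d" by (simp add: L_def d_def t algebra_simps)
  have Lmono: "L x \<le> L y" if "x \<le> y" for x y using that v0 by (simp add: L_def)
  have Lpos: "L u \<ge> d" if "N \<le> u" for u using Lmono[OF that] LN by simp
  have Lpos': "L u > 0" if "N \<le> u" for u using Lpos[OF that] d by simp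
  have inv: "mono_upto N B (\<lambda>u. 1 / L u) (1 / d)"
    by (rule mono_upto_antimonoI)
       (use Lmono Lpos d Lpos' in \<open>auto intro!: divide_left_mono mult_pos_pos simp: less_imp_le\<close>)
  have quot: "y / L y \<le> x / L x" if "N \<le> x" "x \<le> y" for x y
  proof -
    have "t * x \<le> t * y" using osc_param_pos that by simp
    then show ?thesis
      using Lpos'[of x] Lpos'[of y] that by (simp add: divide_simps L_def algebra_simps)
  qed
  have quotm: "mono_upto N B (\<lambda>u. u / L u) (N / d)"
  proof (rule mono_upto_antimonoI)
    fix u assume "N \<le> u"
    then show "\<bar>u / L u\<bar> \<le> N / d"
      using quot[of N u] Lpos'[of u] N LN by simp
  qed (use quot in auto)
  define q where "q = (\<lambda>u. (2 * pi * \<sigma> * v) * (u / L u) + ((1 - \<sigma>) * t) * (1 / L u))"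
  have qmono: "q y \<le> q x" if "N \<le> x" "x \<le> y" for x y
    unfolding q_def using \<sigma> v0 osc_param_pos that Lmono[of x y] Lpos'[of x] Lpos'[of y] quot[of x y]
    by (intro add_mono mult_left_mono) (auto simp: frac_le)
  have q0: "q u \<ge> 0" if "N \<le> u" for u
    using \<sigma> v0 osc_param_pos that N Lpos'[of u] by (auto simp: q_def intro!: add_nonneg_nonneg mult_nonneg_nonneg)
  \<comment> \<open>Up to the factor 2 pi N, the numerator at N is a convex combination of v and
    Y.\<close>
  have "q N = (2 * pi * N * (\<sigma> * v + (1 - \<sigma>) * Y)) / d"
    by (simp add: q_def LN t add_divide_distrib[symmetric]) (simp add: algebra_simps)
  also have "\<dots> = (\<sigma> * v + (1 - \<sigma>) * Y) / (v - Y)"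
    using N v by (simp add: d_def field_simps)
  also have "\<dots> \<le> v / (v - Y)"
  proof -
    have "\<sigma> * v + (1 - \<sigma>) * Y \<le> \<sigma> * v + (1 - \<sigma>) * v" using \<sigma> v by (intro add_left_mono mult_left_mono) auto
    then show ?thesis using v by (intro divide_right_mono) (auto simp: algebra_simps)
  qed
  finally have qN: "q N \<le> v / (v - Y)" .
  have qm: "mono_upto N B q (v / (v - Y))"
  proof (rule mono_upto_antimonoI)
    fix u assume "N \<le> u"
    then show "\<bar>q u\<bar> \<le> v / (v - Y)"
      using q0[of u] qmono[of N u] qN by simp
  qed (use qmono in auto)
  note o = osc_mono_mult[OF osc_mono_mult[OF osc_mono_mult[OF osc_mono_mult[OF osc_base[OF N]
      mono_upto_powr_neg[OF N less_imp_le[OF \<sigma>(1)]]] quotm] inv] qm]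
  note bp = osc_by_parts(2)[OF N B, of v t \<sigma>, OF _ osc_cong[OF o[of v t]]]
  have "norm (integral {N..B} (osc_fun \<sigma> v t) - (osc_prim \<sigma> v t B - osc_prim \<sigma> v t N)) \<le>
     4 * (v / (v - Y)) * (4 * (1 / d) * (4 * (N / d) * (4 * N powr (-\<sigma>) * 2)))"
  proof (rule bp)
    fix u assume u: "N \<le> u" "u \<le> B"
    show "2 * pi * v * u - t \<noteq> 0" using Lpos'[of u] u by (simp add: L_def)
    have u0: "u > 0" using N u by simp
    have powr1: "u powr (1 - \<sigma>) = u * u powr (-\<sigma>)"
      using u0 powr_add[of u 1 "-\<sigma>"] by simp
    have "q u = (2 * pi * \<sigma> * v * u + (1 - \<sigma>) * t) / L u"
      by (simp add: q_def add_divide_distrib)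
    then have "u powr (1 - \<sigma>) * (2 * pi * \<sigma> * v * u + (1 - \<sigma>) * t) / (2 * pi * v * u - t) ^ 3
      = q u * (1 / L u * (u / L u * u powr (-\<sigma>)))"
      unfolding L_def[symmetric] powr1 by (simp add: power3_eq_cube)
         (simp add: L_def mult_ac)
    then show "complex_of_real (u powr (1 - \<sigma>) * (2 * pi * \<sigma> * v * u + (1 - \<sigma>) * t) / (2 * pi * v * u - t) ^ 3) *
         (complex_of_real (2 * pi * v - t / u) * osc_unit v t u) =
         complex_of_real (q u) * (complex_of_real (1 / L u) * (complex_of_real (u / L u) *
           (complex_of_real (u powr - \<sigma>) * (complex_of_real (2 * pi * v - t / u) * osc_unit v t u))))"
      by (simp only: of_real_mult mult.assoc)
  qed
  also have "\<dots> = 512 * (N powr (-\<sigma>) / N * v / (v - Y) ^ 3) / (4 * pi\<^sup>2)"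
  proof -
    obtain e where e: "v - Y = e" "e > 0" using v by simp
    show ?thesis using N e(2) unfolding d_def e(1) by (simp add: field_simps power2_eq_square power3_eq_cube)
  qed
  also have "\<dots> \<le> 512 * (N powr (-\<sigma>) / N * v / (v - Y) ^ 3)"
    by (rule divide_four_pi_sq_le) (use N v v0 in simp)
  finally show ?thesis .
qed

text \<open>Mirror situation: for v < Y the stationary point lies above N and L decreases towards
  L(N) = 2 pi N (Y - v). The weights are now u^(1-\<sigma>), q <= t and -1 / L^3; all are bounded
  independently of A, so A may tend to 0.\<close>

lemma osc_lower_pos:
  assumes v: "0 < v" "v < Y" and A: "0 < A" "A \<le> N"
  shows "norm (integral {A..N} (osc_fun \<sigma> v t) - (osc_prim \<sigma> v t N - osc_prim \<sigma> v t A))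
           \<le> 128 * (N powr (-\<sigma>) / N * Y / (Y - v) ^ 3)"
proof -
  define L where "L = (\<lambda>u. t - 2 * pi * v * u)"
  define d where "d = 2 * pi * N * (Y - v)"
  have d: "d > 0" using N v by (simp add: d_def)
  have LN: "L N = d" by (simp add: L_def d_def t algebra_simps)
  have Lmono: "L y \<le> L x" if "x \<le> y" for x y using that v by (simp add: L_def)
  have Lpos: "L u \<ge> d" if "u \<le> N" for u using Lmono[OF that] LN by simp
  have Lpos': "L u > 0" if "u \<le> N" for u using Lpos[OF that] d by simp
  have inv: "mono_upto A N (\<lambda>u. - 1 / L u ^ 3) (1 / d ^ 3)"
  proof (rule mono_upto_antimonoI)
    fix x y assume xy: "A \<le> x" "x \<le> y" "y \<le> N"
    have "L y ^ 3 \<le> L x ^ 3" using Lmono[of x y] Lpos'[of y] xy by (intro power_mono) auto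
    then have "1 / L x ^ 3 \<le> 1 / L y ^ 3" using Lpos'[of y] xy by (intro frac_le) auto
    then show "- 1 / L y ^ 3 \<le> - 1 / L x ^ 3" by simp
  next
    fix u assume u: "A \<le> u" "u \<le> N"
    have "d ^ 3 \<le> L u ^ 3" using Lpos[of u] d u by (intro power_mono) auto
    then show "\<bar>- 1 / L u ^ 3\<bar> \<le> 1 / d ^ 3" using Lpos'[of u] d u
      by (simp add: divide_left_mono frac_le)
  qed
  define q where "q = (\<lambda>u. 2 * pi * \<sigma> * v * u + (1 - \<sigma>) * t)"
  have qm: "mono_upto A N q t"
  proof (rule mono_upto_monoI)
    fix x y :: real assume "x \<le> y"
    then show "q x \<le> q y" using \<sigma> v by (simp add: q_def)
  next
    fix u assume u: "A \<le> u" "u \<le> N"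
    have "q u = \<sigma> * (2 * pi * v * u) + (1 - \<sigma>) * t" by (simp add: q_def)
    also have "\<dots> \<le> \<sigma> * t + (1 - \<sigma>) * t"
      using Lpos'[OF u(2)] \<sigma> by (intro add_right_mono mult_left_mono) (auto simp: L_def)
    finally have "q u \<le> t" by (simp add: algebra_simps)
    moreover have "q u \<ge> 0" using \<sigma> v A u osc_param_pos by (simp add: q_def)
    ultimately show "\<bar>q u\<bar> \<le> t" by simp
  qed
  have s1: "0 \<le> 1 - \<sigma>" using \<sigma> by simp
  note o = osc_mono_mult[OF osc_mono_mult[OF osc_mono_mult[OF osc_base[OF A(1)]
      mono_upto_powr_pos[OF A(1) s1]] qm] inv]
  note bp = osc_by_parts(2)[OF A, of v t \<sigma>, OF _ osc_cong[OF o[of v t]]]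
  have "norm (integral {A..N} (osc_fun \<sigma> v t) - (osc_prim \<sigma> v t N - osc_prim \<sigma> v t A)) \<le>
     4 * (1 / d ^ 3) * (4 * t * (4 * N powr (1 - \<sigma>) * 2))"
  proof (rule bp)
    fix u assume u: "A \<le> u" "u \<le> N"
    show "2 * pi * v * u - t \<noteq> 0" using Lpos'[of u] u by (simp add: L_def)
    have "(2 * pi * v * u - t) ^ 3 = - (L u ^ 3)"
      using power_minus_odd[of 3 "L u"] by (simp add: L_def)
    then have "u powr (1 - \<sigma>) * (2 * pi * \<sigma> * v * u + (1 - \<sigma>) * t) / (2 * pi * v * u - t) ^ 3
      = (- 1 / L u ^ 3) * (q u * u powr (1 - \<sigma>))"
      by (simp add: q_def)
    then show "complex_of_real (u powr (1 - \<sigma>) * (2 * pi * \<sigma> * v * u + (1 - \<sigma>) * t) / (2 * pi * v * u - t) ^ 3) *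
         (complex_of_real (2 * pi * v - t / u) * osc_unit v t u) =
         complex_of_real (- 1 / L u ^ 3) * (complex_of_real (q u) *
           (complex_of_real (u powr (1 - \<sigma>)) * (complex_of_real (2 * pi * v - t / u) * osc_unit v t u)))"
      by (simp only: of_real_mult mult.assoc)
  qed
  also have "\<dots> = 128 * (N powr (-\<sigma>) / N * Y / (Y - v) ^ 3) / (4 * pi\<^sup>2)"
  proof -
    have "N powr (1 - \<sigma>) = N * N powr (-\<sigma>)" using powr_add[of N 1 "-\<sigma>"] N by simp
    moreover obtain e where e: "Y - v = e" "e > 0" using v by simp
    ultimately show ?thesis using N e(2) unfolding d_def e(1) t by (simp add: field_simps power2_eq_square power3_eq_cube)
  qed
  also have "\<dots> \<le> 128 * (N powr (-\<sigma>) / N * Y / (Y - v) ^ 3)"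
    by (rule divide_four_pi_sq_le) (use N v Y in simp)
  finally show ?thesis .
qed

text \<open>For a negative frequency the numerator of the error weight can change sign. Split off as
  \<sigma> - t / L with L = 2 pi m u + t, it is still monotone.\<close>

lemma neg_ratio_mono:
  assumes m: "m > 0" and A: "0 < A"
  shows "mono_upto A B (\<lambda>u. \<sigma> - t / (2 * pi * m * u + t)) 1"
proof (rule mono_upto_monoI)
  fix x y assume xy: "A \<le> x" "x \<le> y"
  then have "2 * pi * m * x + t > 0" using m A osc_param_pos by (intro add_nonneg_pos) auto
  moreover have "2 * pi * m * x \<le> 2 * pi * m * y" using m xy by (intro mult_left_mono) auto
  ultimately have "t / (2 * pi * m * y + t) \<le> t / (2 * pi * m * x + t)" 
    using osc_param_pos by (intro frac_le) auto
  then show "\<sigma> - t / (2 * pi * m * x + t) \<le> \<sigma> - t / (2 * pi * m * y + t)" by simp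
next
  fix u assume u: "A \<le> u"
  have p: "2 * pi * m * u \<ge> 0" using u A m by simp
  then have "t / (2 * pi * m * u + t) \<le> 1" "t / (2 * pi * m * u + t) \<ge> 0" using osc_param_pos by auto
  then show "\<bar>\<sigma> - t / (2 * pi * m * u + t)\<bar> \<le> 1" using \<sigma> by linarith
qed

lemma neg_ratio_eq:
  assumes m: "m > 0" and u: "0 < u"
  shows "(2 * pi * \<sigma> * (- m) * u + (1 - \<sigma>) * t) / (2 * pi * (- m) * u - t) ^ 3
    = (\<sigma> - t / (2 * pi * m * u + t)) * (1 / (2 * pi * m * u + t)\<^sup>2)"
proof -
  define L where "L = 2 * pi * m * u + t"
  have L: "L > 0" using m u osc_param_pos by (auto simp: L_def intro!: add_nonneg_pos)
  have "2 * pi * (- m) * u - t = - L" by (simp add: L_def)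
  moreover have "(- L) ^ 3 = - (L ^ 3)" by (simp add: power3_eq_cube)
  moreover have "2 * pi * \<sigma> * (- m) * u + (1 - \<sigma>) * t = t - \<sigma> * L" by (simp add: L_def algebra_simps)
  ultimately have "(2 * pi * \<sigma> * (- m) * u + (1 - \<sigma>) * t) / (2 * pi * (- m) * u - t) ^ 3 = (\<sigma> * L - t) / L ^ 3"
    by (simp add: divide_simps L)
  also have "\<dots> = (\<sigma> - t / L) * (1 / L\<^sup>2)" using L by (simp add: field_simps power3_eq_cube power2_eq_square)
  finally show ?thesis by (simp add: L_def)
qed

text \<open>Here L >= 2 pi m u, so u / L and 1 / L each gain a factor 1 / m and the errors are
  summable over all frequencies.\<close>

lemma osc_upper_neg:
  assumes m: "m > 0" and B: "N \<le> B"
  shows "norm (integral {N..B} (osc_fun \<sigma> (-m) t) - (osc_prim \<sigma> (-m) t B - osc_prim \<sigma> (-m) t N))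
           \<le> 512 * (N powr (-\<sigma>) / N / m\<^sup>2)"
proof -
  define L where "L = (\<lambda>u. 2 * pi * m * u + t)"
  define d where "d = 2 * pi * m * N"
  have d: "d > 0" using N m by (simp add: d_def)
  have Lmono: "L x \<le> L y" if "x \<le> y" for x y using that m by (simp add: L_def)
  have Lpos: "L u \<ge> d" if "N \<le> u" for u
  proof -
    have "2 * pi * m * N \<le> 2 * pi * m * u" using m that by (intro mult_left_mono) auto
    then show ?thesis using osc_param_pos unfolding L_def d_def by linarith
  qed
  have Lpos': "L u > 0" if "N \<le> u" for u using Lpos[OF that] d by simp
  have inv: "mono_upto N B (\<lambda>u. 1 / L u) (1 / d)"
    by (rule mono_upto_antimonoI)
       (use Lmono Lpos d Lpos' in \<open>auto intro!: divide_left_mono mult_pos_pos simp: less_imp_le\<close>)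
  have quotm: "mono_upto N B (\<lambda>u. u / L u) (1 / (2 * pi * m))"
  proof (rule mono_upto_monoI)
    fix x y assume xy: "N \<le> x" "x \<le> y"
    then have "t * x \<le> t * y" using osc_param_pos by simp
    then show "x / L x \<le> y / L y"
      using Lpos'[of x] Lpos'[of y] xy by (simp add: divide_simps L_def algebra_simps)
  next
    fix u assume u: "N \<le> u"
    have "u * (2 * pi * m) \<le> L u" using osc_param_pos by (simp add: L_def mult_ac)
    then show "\<bar>u / L u\<bar> \<le> 1 / (2 * pi * m)" 
      using u N m Lpos'[OF u] by (simp add: divide_simps mult_ac)
  qed
  note o = osc_mono_mult[OF osc_mono_mult[OF osc_mono_mult[OF osc_mono_mult[OF osc_base[OF N]
      mono_upto_powr_neg[OF N less_imp_le[OF \<sigma>(1)]]] quotm] inv] neg_ratio_mono[OF m N]]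
  note bp = osc_by_parts(2)[OF N B, of "-m" t \<sigma>, OF _ osc_cong[OF o[of "-m" t]]]
  have "norm (integral {N..B} (osc_fun \<sigma> (-m) t) - (osc_prim \<sigma> (-m) t B - osc_prim \<sigma> (-m) t N)) \<le>
     4 * 1 * (4 * (1 / d) * (4 * (1 / (2 * pi * m)) * (4 * N powr (-\<sigma>) * 2)))"
  proof (rule bp)
    fix u assume u: "N \<le> u" "u \<le> B"
    show "2 * pi * (-m) * u - t \<noteq> 0" using Lpos'[of u] u by (simp add: L_def)
    have u0: "u > 0" using N u by simp
    have powr1: "u powr (1 - \<sigma>) = u * u powr (-\<sigma>)"
      using u0 powr_add[of u 1 "-\<sigma>"] by simp
    have "u powr (1 - \<sigma>) * (2 * pi * \<sigma> * (-m) * u + (1 - \<sigma>) * t) / (2 * pi * (-m) * u - t) ^ 3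
      = u powr (1 - \<sigma>) * ((\<sigma> - t / L u) * (1 / (L u)\<^sup>2))"
      by (subst times_divide_eq_right[symmetric], subst neg_ratio_eq[OF m u0]) (simp add: L_def)
    also have "\<dots> = (\<sigma> - t / L u) * (1 / L u * (u / L u * u powr (-\<sigma>)))"
      unfolding powr1 by (simp add: power2_eq_square)
    finally have "u powr (1 - \<sigma>) * (2 * pi * \<sigma> * (-m) * u + (1 - \<sigma>) * t) / (2 * pi * (-m) * u - t) ^ 3
      = (\<sigma> - t / (2 * pi * m * u + t)) * (1 / L u * (u / L u * u powr (-\<sigma>)))"
      by (simp add: L_def)
    then show "complex_of_real (u powr (1 - \<sigma>) * (2 * pi * \<sigma> * (-m) * u + (1 - \<sigma>) * t) / (2 * pi * (-m) * u - t) ^ 3) *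
         (complex_of_real (2 * pi * (-m) - t / u) * osc_unit (-m) t u) =
         complex_of_real (\<sigma> - t / (2 * pi * m * u + t)) * (complex_of_real (1 / L u) * (complex_of_real (u / L u) *
           (complex_of_real (u powr - \<sigma>) * (complex_of_real (2 * pi * (-m) - t / u) * osc_unit (-m) t u))))"
      by (simp only: of_real_mult mult.assoc)
  qed
  also have "\<dots> = 512 * (N powr (-\<sigma>) / N / m\<^sup>2) / (4 * pi\<^sup>2)"
    using N m by (simp add: d_def field_simps power2_eq_square power3_eq_cube)
  also have "\<dots> \<le> 512 * (N powr (-\<sigma>) / N / m\<^sup>2)"
    by (rule divide_four_pi_sq_le) (use N m in simp)
  finally show ?thesis .
qed

text \<open>Near the origin only L >= t is left, so the bound does not decay in m. It is applied to
  the frequencies m <= Y, of which there are at most Y.\<close>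

lemma osc_lower_neg:
  assumes m: "m > 0" and A: "0 < A" "A \<le> N"
  shows "norm (integral {A..N} (osc_fun \<sigma> (-m) t) - (osc_prim \<sigma> (-m) t N - osc_prim \<sigma> (-m) t A))
           \<le> 128 * (N powr (-\<sigma>) / N / Y\<^sup>2)"
proof -
  define L where "L = (\<lambda>u. 2 * pi * m * u + t)"
  have Lmono: "L x \<le> L y" if "x \<le> y" for x y using that m by (simp add: L_def)
  have Lpos: "L u \<ge> t" if "A \<le> u" for u using m A that by (simp add: L_def)
  have Lpos': "L u > 0" if "A \<le> u" for u using Lpos[OF that] osc_param_pos by simp
  have inv: "mono_upto A N (\<lambda>u. 1 / (L u)\<^sup>2) (1 / t\<^sup>2)"
  proof (rule mono_upto_antimonoI)
    fix x y assume xy: "A \<le> x" "x \<le> y"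
    have "(L x)\<^sup>2 \<le> (L y)\<^sup>2" using Lmono[of x y] Lpos'[of x] xy by (intro power_mono) auto
    then show "1 / (L y)\<^sup>2 \<le> 1 / (L x)\<^sup>2" using Lpos'[of x] xy by (intro divide_left_mono) (auto intro!: mult_pos_pos simp: less_imp_neq[symmetric] Lpos')
  next
    fix u assume u: "A \<le> u"
    have "t\<^sup>2 \<le> (L u)\<^sup>2" using Lpos[of u] osc_param_pos u by (intro power_mono) auto
    then show "\<bar>1 / (L u)\<^sup>2\<bar> \<le> 1 / t\<^sup>2" using Lpos'[of u] osc_param_pos u
      by (simp add: frac_le)
  qed
  have s1: "0 \<le> 1 - \<sigma>" using \<sigma> by simp
  note o = osc_mono_mult[OF osc_mono_mult[OF osc_mono_mult[OF osc_base[OF A(1)]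
      mono_upto_powr_pos[OF A(1) s1]] inv] neg_ratio_mono[OF m A(1)]]
  note bp = osc_by_parts(2)[OF A, of "-m" t \<sigma>, OF _ osc_cong[OF o[of "-m" t]]]
  have "norm (integral {A..N} (osc_fun \<sigma> (-m) t) - (osc_prim \<sigma> (-m) t N - osc_prim \<sigma> (-m) t A)) \<le>
     4 * 1 * (4 * (1 / t\<^sup>2) * (4 * N powr (1-\<sigma>) * 2))"
  proof (rule bp)
    fix u assume u: "A \<le> u" "u \<le> N"
    show "2 * pi * (-m) * u - t \<noteq> 0" using Lpos'[of u] u by (simp add: L_def)
    have u0: "u > 0" using A u by simp
    have "u powr (1 - \<sigma>) * (2 * pi * \<sigma> * (-m) * u + (1 - \<sigma>) * t) / (2 * pi * (-m) * u - t) ^ 3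
      = (\<sigma> - t / (2 * pi * m * u + t)) * (1 / (L u)\<^sup>2 * u powr (1 - \<sigma>))"
      by (subst times_divide_eq_right[symmetric], subst neg_ratio_eq[OF m u0]) (simp add: L_def)
    then show "complex_of_real (u powr (1 - \<sigma>) * (2 * pi * \<sigma> * (-m) * u + (1 - \<sigma>) * t) / (2 * pi * (-m) * u - t) ^ 3) *
         (complex_of_real (2 * pi * (-m) - t / u) * osc_unit (-m) t u) =
         complex_of_real (\<sigma> - t / (2 * pi * m * u + t)) * (complex_of_real (1 / (L u)\<^sup>2) * 
           (complex_of_real (u powr (1 - \<sigma>)) * (complex_of_real (2 * pi * (-m) - t / u) * osc_unit (-m) t u)))"
      by (simp only: of_real_mult mult.assoc)
  qed
  also have "\<dots> = 128 * (N powr (-\<sigma>) / N / Y\<^sup>2) / (4 * pi\<^sup>2)"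
  proof -
    have "N powr (1 - \<sigma>) = N * N powr (-\<sigma>)" using powr_add[of N 1 "-\<sigma>"] N by simp
    then show ?thesis using N Y by (simp add: t field_simps power2_eq_square power3_eq_cube)
  qed
  also have "\<dots> \<le> 128 * (N powr (-\<sigma>) / N / Y\<^sup>2)"
    by (rule divide_four_pi_sq_le) (use N Y in simp)
  finally show ?thesis .
qed

text \<open>From distance \<delta> on, L is at least 2 pi v \<delta>, even when v = Y and N itself
  is stationary. One use of u^(-\<sigma>) and u / L as weights then suffices, without integration by
  parts.\<close>

lemma osc_upper_near:
  assumes v: "v \<ge> Y" and \<delta>: "\<delta> > 0" "N + \<delta> \<le> B"
  shows "norm (integral {N+\<delta>..B} (osc_fun \<sigma> v t)) \<le> 32 * (N powr (-\<sigma>) * (N + \<delta>) / (2 * pi * v * \<delta>))"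
proof -
  define L where "L = (\<lambda>u. 2 * pi * v * u - t)"
  have v0: "v > 0" using v Y by simp
  have Lmono: "L x \<le> L y" if "x \<le> y" for x y using that v0 by (simp add: L_def)
  have LN: "L (N + \<delta>) \<ge> 2 * pi * v * \<delta>"
  proof -
    have "t \<le> 2 * pi * v * N" using v N by (simp add: t mult_ac)
    then show ?thesis by (simp add: L_def algebra_simps)
  qed
  have d: "2 * pi * v * \<delta> > 0" using v0 \<delta> by simp
  have Lpos: "L u > 0" if "N + \<delta> \<le> u" for u using Lmono[OF that] LN d by linarith
  have quot: "y / L y \<le> x / L x" if "N + \<delta> \<le> x" "x \<le> y" for x y
  proof -
    have "t * x \<le> t * y" using osc_param_pos that by simp
    then show ?thesis
      using Lpos[of x] Lpos[of y] that by (simp add: divide_simps L_def algebra_simps)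
  qed
  have quotm: "mono_upto (N+\<delta>) B (\<lambda>u. u / L u) ((N + \<delta>) / (2 * pi * v * \<delta>))"
  proof (rule mono_upto_antimonoI)
    fix u assume u: "N + \<delta> \<le> u"
    have "(N + \<delta>) / L (N + \<delta>) \<le> (N + \<delta>) / (2 * pi * v * \<delta>)" 
      using LN d N \<delta> by (intro frac_le) auto
    with quot[OF order_refl u] have "u / L u \<le> (N + \<delta>) / (2 * pi * v * \<delta>)" by linarith
    moreover have "u / L u \<ge> 0" using Lpos[OF u] N \<delta> u by simp
    ultimately show "\<bar>u / L u\<bar> \<le> (N + \<delta>) / (2 * pi * v * \<delta>)" by simp
  qed (use quot in auto)
  have Nd: "N + \<delta> > 0" using N \<delta> by simp
  note o = osc_mono_mult[OF osc_mono_mult[OF osc_base[OF Nd]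
      mono_upto_powr_neg[OF Nd less_imp_le[OF \<sigma>(1)]]] quotm]
  have "osc (N+\<delta>) B (osc_fun \<sigma> v t) (4 * ((N + \<delta>) / (2 * pi * v * \<delta>)) * (4 * (N + \<delta>) powr - \<sigma> * 2))"
  proof (rule osc_cong[OF o[of v t]])
    fix u assume u: "N + \<delta> \<le> u" "u \<le> B"
    then have "u / L u * (2 * pi * v - t / u) = 1" using Lpos[of u] Nd by (simp add: field_simps L_def)
    then have "u powr (-\<sigma>) = u powr (-\<sigma>) * (u / L u * (2 * pi * v - t / u))" by (simp only: mult_1_right)
    then have "u powr (-\<sigma>) = u / L u * (u powr (-\<sigma>) * (2 * pi * v - t / u))" by (simp only: mult_ac)
    then show "osc_fun \<sigma> v t u = complex_of_real (u / L u) * (complex_of_real (u powr - \<sigma>) * (complex_of_real (2 * pi * v - t / u) * osc_unit v t u))"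
      unfolding osc_fun_def by (metis of_real_mult mult.assoc)
  qed
  then have "norm (integral {N+\<delta>..B} (osc_fun \<sigma> v t)) \<le> 32 * ((N + \<delta>) powr (-\<sigma>) * (N + \<delta>) / (2 * pi * v * \<delta>))"
    using \<delta>(2) unfolding osc_def by (force simp: field_simps)
  also have "\<dots> \<le> 32 * (N powr (-\<sigma>) * (N + \<delta>) / (2 * pi * v * \<delta>))"
    using N \<delta> \<sigma> d by (intro mult_left_mono divide_right_mono mult_right_mono powr_mono2') auto
  finally show ?thesis .
qed

text \<open>Towards the origin u^(-\<sigma>) is unbounded; it is replaced by the weight
  u^(1-\<sigma>), the extra factor u going into L = u (2 pi v - t / u).\<close>

lemma osc_lower_near:
  assumes v: "0 < v" "v \<le> Y" and \<delta>: "\<delta> > 0" and A: "0 < A" "A \<le> N - \<delta>"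
  shows "norm (integral {A..N-\<delta>} (osc_fun \<sigma> v t)) \<le> 32 * (N powr (1-\<sigma>) / (2 * pi * v * \<delta>))"
proof -
  define L where "L = (\<lambda>u. 2 * pi * v * u - t)"
  have Lmono: "L x \<le> L y" if "x \<le> y" for x y using that v by (simp add: L_def)
  have LN: "L (N - \<delta>) \<le> - (2 * pi * v * \<delta>)"
  proof -
    have "t \<ge> 2 * pi * v * N" using v N by (simp add: t mult_ac)
    then show ?thesis by (simp add: L_def algebra_simps)
  qed
  have d: "2 * pi * v * \<delta> > 0" using v \<delta> by simp
  have Lb: "L u \<le> - (2 * pi * v * \<delta>)" if "u \<le> N - \<delta>" for u using Lmono[OF that] LN by linarith
  have Lneg: "L u < 0" if "u \<le> N - \<delta>" for u using Lb[OF that] d by linarith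
  have inv: "mono_upto A (N-\<delta>) (\<lambda>u. 1 / L u) (1 / (2 * pi * v * \<delta>))"
  proof (rule mono_upto_antimonoI)
    fix x y assume xy: "A \<le> x" "x \<le> y" "y \<le> N - \<delta>"
    have "1 / (- L x) \<le> 1 / (- L y)" using Lneg[of y] Lneg[of x] Lmono[of x y] xy by (intro frac_le) auto
    then show "1 / L y \<le> 1 / L x" by simp
  next
    fix u assume u: "A \<le> u" "u \<le> N - \<delta>"
    have "\<bar>1 / L u\<bar> = 1 / (- L u)" using Lneg[OF u(2)] by simp
    also have "\<dots> \<le> 1 / (2 * pi * v * \<delta>)" using Lb[OF u(2)] d by (intro frac_le) auto
    finally show "\<bar>1 / L u\<bar> \<le> 1 / (2 * pi * v * \<delta>)" .
  qed
  have s1: "0 \<le> 1 - \<sigma>" using \<sigma> by simp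
  note o = osc_mono_mult[OF osc_mono_mult[OF osc_base[OF A(1)]
      mono_upto_powr_pos[OF A(1) s1]] inv]
  have "osc A (N-\<delta>) (osc_fun \<sigma> v t) (4 * (1 / (2 * pi * v * \<delta>)) * (4 * (N - \<delta>) powr (1 - \<sigma>) * 2))"
  proof (rule osc_cong[OF o[of v t]])
    fix u assume u: "A \<le> u" "u \<le> N - \<delta>"
    then have u0: "u > 0" using A by simp
    have powr1: "u powr (1 - \<sigma>) = u * u powr (-\<sigma>)"
      using u0 powr_add[of u 1 "-\<sigma>"] by simp
    have "u / L u * (2 * pi * v - t / u) = 1" using Lneg[of u] u u0 by (simp add: field_simps L_def)
    moreover have "1 / L u * (u powr (1-\<sigma>) * (2 * pi * v - t / u)) = u powr (-\<sigma>) * (u / L u * (2 * pi * v - t / u))"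
      unfolding powr1 by simp
    ultimately have "u powr (-\<sigma>) = 1 / L u * (u powr (1-\<sigma>) * (2 * pi * v - t / u))" by (simp only: mult_1_right)
    then show "osc_fun \<sigma> v t u = complex_of_real (1 / L u) * (complex_of_real (u powr (1 - \<sigma>)) * (complex_of_real (2 * pi * v - t / u) * osc_unit v t u))"
      unfolding osc_fun_def by (metis of_real_mult mult.assoc)
  qed
  then have "norm (integral {A..N-\<delta>} (osc_fun \<sigma> v t)) \<le> 32 * ((N - \<delta>) powr (1-\<sigma>) / (2 * pi * v * \<delta>))"
    using A unfolding osc_def by (force simp: field_simps)
  also have "\<dots> \<le> 32 * (N powr (1-\<sigma>) / (2 * pi * v * \<delta>))"
    using A \<delta> \<sigma> d by (intro mult_left_mono divide_right_mono powr_mono2) auto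
  finally show ?thesis .
qed

text \<open>Cruder bounds for negative frequencies, whose phase has no stationary point; they serve
  to bound the size of \<open>fe_factor\<close>.\<close>

lemma osc_neg_first:
  assumes m: "m > 0"
  shows "N \<le> B \<Longrightarrow> norm (integral {N..B} (osc_fun \<sigma> (-m) t)) \<le> 32 * (N powr (-\<sigma>) / (2 * pi * m))"
    "0 < A \<Longrightarrow> A \<le> N \<Longrightarrow> norm (integral {A..N} (osc_fun \<sigma> (-m) t)) \<le> 32 * (N powr (1-\<sigma>) / t)"
proof -
  define L where "L = (\<lambda>u. 2 * pi * m * u + t)"
  have Lmono: "L x \<le> L y" if "x \<le> y" for x y using that m by (simp add: L_def)
  have Lpos: "L u \<ge> t" if "0 < u" for u using m that by (simp add: L_def)
  have Lpos': "L u > 0" if "0 < u" for u using Lpos[OF that] osc_param_pos by simp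
  have ident: "u / L u * (2 * pi * (-m) - t / u) = -1" if "u > 0" for u
  proof -
    have "2 * pi * (-m) - t / u = - (L u / u)" using that by (simp add: L_def field_simps)
    then show ?thesis using Lpos'[OF that] that by simp
  qed
  show "norm (integral {N..B} (osc_fun \<sigma> (-m) t)) \<le> 32 * (N powr (-\<sigma>) / (2 * pi * m))" if B: "N \<le> B"
  proof -
    have quotm: "mono_upto N B (\<lambda>u. - (u / L u)) (1 / (2 * pi * m))"
    proof (rule mono_upto_antimonoI)
      fix x y assume xy: "N \<le> x" "x \<le> y"
      then have "t * x \<le> t * y" using osc_param_pos by simp
      then show "- (y / L y) \<le> - (x / L x)"
        using Lpos'[of x] Lpos'[of y] xy N by (simp add: divide_simps L_def algebra_simps)
    next
      fix u assume u: "N \<le> u"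
      have "u * (2 * pi * m) \<le> L u" using osc_param_pos by (simp add: L_def mult_ac)
      then show "\<bar>- (u / L u)\<bar> \<le> 1 / (2 * pi * m)" 
        using u N m Lpos'[of u] by (simp add: divide_simps mult_ac)
    qed
    note o = osc_mono_mult[OF osc_mono_mult[OF osc_base[OF N]
      mono_upto_powr_neg[OF N less_imp_le[OF \<sigma>(1)]]] quotm]
    have "osc N B (osc_fun \<sigma> (-m) t) (4 * (1 / (2 * pi * m)) * (4 * N powr - \<sigma> * 2))"
    proof (rule osc_cong[OF o[of "-m" t]])
      fix u assume u: "N \<le> u" "u \<le> B"
      then have "u powr (-\<sigma>) * (u / L u * (2 * pi * (-m) - t / u)) = u powr (-\<sigma>) * (-1)"
        using ident[of u] N by (simp only:)
      then have "u powr (-\<sigma>) = - (u / L u) * (u powr (-\<sigma>) * (2 * pi * (-m) - t / u))"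
        by (simp only: mult_ac mult_minus_left mult_minus_right mult_1_right)
      then show "osc_fun \<sigma> (-m) t u = complex_of_real (- (u / L u)) * (complex_of_real (u powr - \<sigma>) * (complex_of_real (2 * pi * (-m) - t / u) * osc_unit (-m) t u))"
        unfolding osc_fun_def by (metis of_real_mult mult.assoc)
    qed
    then show ?thesis using B unfolding osc_def by (force simp: field_simps)
  qed
  show "norm (integral {A..N} (osc_fun \<sigma> (-m) t)) \<le> 32 * (N powr (1-\<sigma>) / t)" if A: "0 < A" "A \<le> N"
  proof -
    have inv: "mono_upto A N (\<lambda>u. - 1 / L u) (1 / t)"
    proof (rule mono_upto_monoI)
      fix x y assume xy: "A \<le> x" "x \<le> y"
      have "1 / L y \<le> 1 / L x" using Lpos'[of x] Lmono[of x y] xy A by (intro frac_le) auto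
      then show "- 1 / L x \<le> - 1 / L y" by simp
    next
      fix u assume u: "A \<le> u"
      have "1 / L u \<le> 1 / t" using Lpos[of u] osc_param_pos u A by (intro frac_le) auto
      then show "\<bar>- 1 / L u\<bar> \<le> 1 / t" using Lpos'[of u] u A by simp
    qed
    have s1: "0 \<le> 1 - \<sigma>" using \<sigma> by simp
    note o = osc_mono_mult[OF osc_mono_mult[OF osc_base[OF A(1)]
      mono_upto_powr_pos[OF A(1) s1]] inv]
    have "osc A N (osc_fun \<sigma> (-m) t) (4 * (1 / t) * (4 * N powr (1 - \<sigma>) * 2))"
    proof (rule osc_cong[OF o[of "-m" t]])
      fix u assume u: "A \<le> u" "u \<le> N"
      then have u0: "u > 0" using A by simp
      have powr1: "u powr (1 - \<sigma>) = u * u powr (-\<sigma>)"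
        using u0 powr_add[of u 1 "-\<sigma>"] by simp
      have "- 1 / L u * (u powr (1-\<sigma>) * (2 * pi * (-m) - t / u)) = - (u powr (-\<sigma>) * (u / L u * (2 * pi * (-m) - t / u)))"
        unfolding powr1 by simp
      then have "u powr (-\<sigma>) = - 1 / L u * (u powr (1-\<sigma>) * (2 * pi * (-m) - t / u))"
        unfolding ident[OF u0] by simp
      then show "osc_fun \<sigma> (-m) t u = complex_of_real (- 1 / L u) * (complex_of_real (u powr (1 - \<sigma>)) * (complex_of_real (2 * pi * (-m) - t / u) * osc_unit (-m) t u))"
        unfolding osc_fun_def by (metis of_real_mult mult.assoc)
    qed
    then show ?thesis using A unfolding osc_def by (force simp: field_simps)
  qed
qed

end

section \<open>Fourier series of the sawtooth and Mellin integrals\<close>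

text \<open>Half of 1/6 - B_2({u}) for the second Bernoulli polynomial B_2; the constant 1/6 makes
  it vanish at the integers.\<close>

definition saw :: "real \<Rightarrow> real" where
  "saw u = (frac u - (frac u)\<^sup>2) / 2"

text \<open>A cosine term of the Fourier series of \<open>saw\<close> together with its share of the
  mean 1/12: so each summand is nonnegative and vanishes at every integer.\<close>

definition saw_coeff :: "nat \<Rightarrow> real \<Rightarrow> real" where
  "saw_coeff v u = (1 - cos (2 * pi * real v * u)) / (2 * pi\<^sup>2 * (real v)\<^sup>2)"

lemma saw_coeff_nonneg: "saw_coeff v u \<ge> 0"
  by (simp add: saw_coeff_def)

text \<open>The Fourier series of 1/2 - {x} converges only conditionally. With the Abel factor r^n
  it becomes the logarithm series.\<close>

lemma sin_series_Ln:
  assumes r: "0 \<le> r" "r < 1"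
  shows "(\<lambda>n. r ^ Suc n * sin (2 * pi * real (Suc n) * x) / (pi * real (Suc n))) sums
           (- Im (Ln (1 - of_real r * cis (2 * pi * x))) / pi)"
proof -
  let ?z = "- (of_real r * cis (2 * pi * x))"
  have "norm ?z < 1" using r by (simp add: norm_mult)
  from Ln_series'[OF this] have "(\<lambda>n. - ((of_real r * cis (2 * pi * x)) ^ n) / of_nat n) sums Ln (1 + ?z)" by simp
  then have "(\<lambda>n. - ((of_real r * cis (2 * pi * x)) ^ Suc n) / of_nat (Suc n)) sums Ln (1 + ?z)"
    by (subst sums_Suc_iff) simp
  from sums_divide[OF sums_minus[OF sums_Im[OF this]], of pi]
  have "(\<lambda>n. - Im (- ((of_real r * cis (2 * pi * x)) ^ Suc n) / of_nat (Suc n)) / pi) sums (- Im (Ln (1 + ?z)) / pi)" .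
  moreover have "- Im (- ((of_real r * cis (2 * pi * x)) ^ Suc n) / of_nat (Suc n)) / pi
     = r ^ Suc n * sin (2 * pi * real (Suc n) * x) / (pi * real (Suc n))" for n
  proof -
    have "(of_real r * cis (2 * pi * x)) ^ Suc n = of_real (r ^ Suc n) * cis (2 * pi * real (Suc n) * x)"
    proof -
      have "cis (2 * pi * x) ^ Suc n = cis (real (Suc n) * (2 * pi * x))" by (rule Complex.DeMoivre)
      then show ?thesis by (simp add: power_mult_distrib mult_ac del: power_Suc of_nat_Suc)
    qed
    then show ?thesis by (simp add: Im_divide_of_nat del: power_Suc of_nat_Suc of_real_power)
  qed
  ultimately show ?thesis by simp
qed

text \<open>Because 1 - exp(2 pi i x) = 2 sin(pi x) exp(i pi (x - 1/2)), and for 0 < x < 1 this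
  angle lies in the principal range.\<close>

lemma Im_Ln_one_minus_cis:
  assumes "0 < x" "x < 1"
  shows "Im (Ln (1 - cis (2 * pi * x))) = pi * (x - 1 / 2)" "1 - cis (2 * pi * x) \<notin> \<real>\<^sub>\<le>\<^sub>0"
proof -
  have s: "sin (pi * x) > 0" using assms by (intro sin_gt_zero) auto
  have "1 - cis (2 * pi * x) = of_real (2 * sin (pi * x)) * exp (\<i> * of_real (pi * (x - 1 / 2)))"
  proof -
    have "exp (\<i> * of_real (pi * (x - 1 / 2))) = cis (pi * x - pi / 2)"
      by (simp add: cis_conv_exp algebra_simps)
    moreover have "cis (pi * x - pi / 2) = Complex (sin (pi * x)) (- cos (pi * x))"
      by (simp add: complex_eq_iff cos_diff sin_diff)
    moreover have "2 * pi * x = 2 * (pi * x)" by simp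
    ultimately show ?thesis
      by (simp only:) (simp add: complex_eq_iff sin_double cos_double_sin power2_eq_square)
  qed
  from Arg_unique[OF this[symmetric]]
  have "Arg (1 - cis (2 * pi * x)) = pi * (x - 1 / 2)"
  proof -
    have "pi * (x - 1/2) \<le> pi * 1" using assms by (intro mult_left_mono) auto
    moreover have "pi * (-1) < pi * (x - 1/2)" using assms by (intro mult_strict_left_mono) auto
    ultimately show ?thesis using Arg_unique[OF \<open>1 - cis (2 * pi * x) = _\<close>[symmetric]] s by simp
  qed
  moreover have ne: "cos (2 * pi * x) < 1"
  proof -
    have "cos (2 * (pi * x)) = 1 - 2 * (sin (pi * x))\<^sup>2" by (rule cos_double_sin)
    then show ?thesis using s by (simp add: mult.assoc)
  qed
  ultimately show "Im (Ln (1 - cis (2 * pi * x))) = pi * (x - 1 / 2)"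
    by (subst Arg_eq_Im_Ln[symmetric]) (auto simp: complex_eq_iff)
  show "1 - cis (2 * pi * x) \<notin> \<real>\<^sub>\<le>\<^sub>0"
    using ne by (auto simp: complex_nonpos_Reals_iff)
qed

lemma inverse_squares_summable: "summable (\<lambda>n. 1 / (real (Suc n))\<^sup>2)"
  using inverse_squares_sums by (simp add: sums_iff add.commute)

lemma saw_coeff_le: "saw_coeff v u \<le> 1 / (pi\<^sup>2 * (real v)\<^sup>2)"
proof -
  have "1 - cos (2 * pi * real v * u) \<le> 2" by (smt (verit) cos_ge_minus_one)
  then have "saw_coeff v u \<le> 2 / (2 * pi\<^sup>2 * (real v)\<^sup>2)" unfolding saw_coeff_def by (intro divide_right_mono) auto
  then show ?thesis by simp
qed

lemma saw_coeff_has_integral: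
  assumes "0 \<le> u" "n > 0"
  shows "((\<lambda>x. sin (2 * pi * real n * x) / (pi * real n)) has_integral saw_coeff n u) {0..u}"
proof -
  have "((\<lambda>x. sin (2 * pi * real n * x) / (pi * real n)) has_integral (saw_coeff n u - saw_coeff n 0)) {0..u}"
  proof (rule fundamental_theorem_of_calculus)
    fix x
    have "(saw_coeff n has_real_derivative sin (2 * pi * real n * x) / (pi * real n)) (at x within {0..u})"
      unfolding saw_coeff_def[abs_def] using \<open>n > 0\<close>
      by (auto intro!: derivative_eq_intros simp: field_simps power2_eq_square)
    then show "(saw_coeff n has_vector_derivative sin (2 * pi * real n * x) / (pi * real n)) (at x within {0..u})"
      by (simp add: has_real_derivative_iff_has_vector_derivative)
  qed fact
  then show ?thesis by (simp add: saw_coeff_def)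
qed

text \<open>Integration from 0 to u turns the sine terms into \<open>saw_coeff\<close>; for fixed r
  the geometric series provides a constant majorant.\<close>

lemma saw_abel:
  assumes u: "0 \<le> u" and r: "0 \<le> r" "r < 1"
  shows "(\<lambda>x. - Im (Ln (1 - of_real r * cis (2 * pi * x))) / pi) integrable_on {0<..<u}"
    and "(\<lambda>n. r ^ Suc n * saw_coeff (Suc n) u) sums
      integral {0<..<u} (\<lambda>x. - Im (Ln (1 - of_real r * cis (2 * pi * x))) / pi)"
proof -
  let ?f = "\<lambda>k x. \<Sum>n<k. r ^ Suc n * sin (2 * pi * real (Suc n) * x) / (pi * real (Suc n))"
  let ?g = "\<lambda>x. - Im (Ln (1 - of_real r * cis (2 * pi * x))) / pi"
  have hi: "(?f k has_integral (\<Sum>n<k. r ^ Suc n * saw_coeff (Suc n) u)) {0<..<u}" for k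
  proof -
    have "((\<lambda>x. r ^ Suc n * (sin (2 * pi * real (Suc n) * x) / (pi * real (Suc n)))) has_integral r ^ Suc n * saw_coeff (Suc n) u) {0..u}" for n
      by (intro has_integral_mult_right saw_coeff_has_integral u) simp
    then have "(?f k has_integral (\<Sum>n<k. r ^ Suc n * saw_coeff (Suc n) u)) {0..u}"
      by (intro has_integral_sum) (simp_all del: of_nat_Suc power_Suc)
    then show ?thesis by (simp add: has_integral_Icc_iff_Ioo del: of_nat_Suc power_Suc)
  qed
  have bound: "norm (?f k x) \<le> 1 / (1 - r)" for k x
  proof -
    have "norm (?f k x) \<le> (\<Sum>n<k. r ^ n)"
    proof (rule order_trans[OF norm_sum], rule sum_mono)
      fix n
      have "\<bar>r ^ Suc n * sin (2 * pi * real (Suc n) * x) / (pi * real (Suc n))\<bar> \<le> r ^ Suc n * 1 / 1"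
        unfolding abs_mult abs_divide
      proof (intro frac_le mult_mono)
        have "1 * 1 \<le> pi * real (Suc n)" using pi_ge_two by (intro mult_mono) auto
        then show "1 \<le> \<bar>pi\<bar> * \<bar>real (Suc n)\<bar>" by simp
      qed (use r in auto)
      also have "\<dots> \<le> r ^ n" using r power_decreasing[of n "Suc n" r] by simp
      finally show "norm (r ^ Suc n * sin (2 * pi * real (Suc n) * x) / (pi * real (Suc n))) \<le> r ^ n" by simp
    qed
    also have "\<dots> \<le> (\<Sum>n. r ^ n)" using r by (intro sum_le_suminf) (auto intro: summable_geometric)
    also have "\<dots> = 1 / (1 - r)" using r by (simp add: suminf_geometric)
    finally show ?thesis .
  qed
  note dc = dominated_convergence[of ?f "{0<..<u}" "\<lambda>_. 1 / (1 - r)" ?g]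
  have 1: "?f k integrable_on {0<..<u}" for k using hi[of k] by (auto simp: integrable_on_def)
  have 2: "(\<lambda>_::real. 1 / (1 - r)) integrable_on {0<..<u}" 
    by (simp add: integrable_on_open_interval_real integrable_const_ivl)
  have 3: "(\<lambda>k. ?f k x) \<longlonglongrightarrow> ?g x" for x using sin_series_Ln[OF r, of x] by (simp add: sums_def)
  show "?g integrable_on {0<..<u}" by (rule dc(1)) (use 1 2 3 bound in auto)
  have "(\<lambda>k. integral {0<..<u} (?f k)) \<longlonglongrightarrow> integral {0<..<u} ?g"
    by (rule dc(2)) (use 1 2 3 bound in auto)
  then show "(\<lambda>n. r ^ Suc n * saw_coeff (Suc n) u) sums integral {0<..<u} ?g"
    unfolding sums_def integral_unique[OF hi] .
qed

text \<open>Let r tend to 1 on both sides of \<open>saw_abel\<close>. The integrands are bounded by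
  1, as the imaginary part of \<open>Ln\<close> is at most pi in absolute value; the series is
  dominated termwise by the nonnegative \<open>saw_coeff\<close>.\<close>

lemma saw_fourier_unit:
  assumes u: "0 \<le> u" "u \<le> 1"
  shows "(\<lambda>n. saw_coeff (Suc n) u) sums ((u - u\<^sup>2) / 2)"
proof -
  define r where "r = (\<lambda>k. 1 - 1 / real (Suc (Suc k)))"
  have r: "0 \<le> r k" "r k < 1" for k by (auto simp: r_def field_simps)
  have r1: "r \<longlonglongrightarrow> 1"
  proof -
    have "(\<lambda>k. 1 - 1 / real (Suc (Suc k))) \<longlonglongrightarrow> 1 - 0"
      by (intro tendsto_diff tendsto_const LIMSEQ_Suc[OF lim_1_over_n[THEN LIMSEQ_Suc]])
    then show ?thesis by (simp add: r_def)
  qed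
  let ?f = "\<lambda>k x. - Im (Ln (1 - of_real (r k) * cis (2 * pi * x))) / pi"
  have "(\<lambda>k. integral {0<..<u} (?f k)) \<longlonglongrightarrow> integral {0<..<u} (\<lambda>x. 1 / 2 - x)"
  proof (rule dominated_convergence(2)[where h = "\<lambda>_. 1"])
    show "?f k integrable_on {0<..<u}" for k by (rule saw_abel(1)) (use u r in auto)
    show "(\<lambda>_::real. 1::real) integrable_on {0<..<u}" by (simp add: integrable_on_open_interval_real integrable_const_ivl)
    fix k x
    have "1 - of_real (r k) * cis (2 * pi * x) \<noteq> 0"
    proof
      assume "1 - of_real (r k) * cis (2 * pi * x) = 0"
      then have "norm (of_real (r k) * cis (2 * pi * x)) = 1" by (metis eq_iff_diff_eq_0 norm_one)
      then show False using r[of k] by (simp add: norm_mult)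
    qed
    then have "\<bar>Im (Ln (1 - of_real (r k) * cis (2 * pi * x)))\<bar> \<le> pi"
      using mpi_less_Im_Ln Im_Ln_le_pi by (smt (verit))
    then show "norm (?f k x) \<le> 1" by simp
  next
    fix x assume "x \<in> {0<..<u}"
    then have x: "0 < x" "x < 1" using u by auto
    have "(\<lambda>k. ?f k x) \<longlonglongrightarrow> - Im (Ln (1 - of_real 1 * cis (2 * pi * x))) / pi"
      by (intro tendsto_intros r1) (use Im_Ln_one_minus_cis(2)[OF x] in auto)
    also have "- Im (Ln (1 - of_real 1 * cis (2 * pi * x))) / pi = 1 / 2 - x"
      using Im_Ln_one_minus_cis(1)[OF x] by (simp add: field_simps)
    finally show "(\<lambda>k. ?f k x) \<longlonglongrightarrow> 1 / 2 - x" .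
  qed
  moreover have "((\<lambda>x. 1 / 2 - x) has_integral ((u / 2 - u\<^sup>2 / 2) - (0 / 2 - 0\<^sup>2 / 2))) {0..u}"
    by (rule fundamental_theorem_of_calculus)
       (use u in \<open>auto intro!: derivative_eq_intros simp: has_real_derivative_iff_has_vector_derivative[symmetric]\<close>)
  then have "integral {0<..<u} (\<lambda>x. 1 / 2 - x) = (u - u\<^sup>2) / 2"
    unfolding has_integral_Icc_iff_Ioo by (simp add: integral_unique diff_divide_distrib)
  ultimately have lim1: "(\<lambda>k. integral {0<..<u} (?f k)) \<longlonglongrightarrow> (u - u\<^sup>2) / 2" by simp
  have eq: "integral {0<..<u} (?f k) = (\<Sum>n. r k ^ Suc n * saw_coeff (Suc n) u)" for k
    using saw_abel(2)[OF u(1) r(1) r(2), of k] by (simp add: sums_iff)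
  have sm: "summable (\<lambda>n. saw_coeff (Suc n) u)"
  proof (rule summable_comparison_test')
    show "summable (\<lambda>n. (1 / pi\<^sup>2) * (1 / (real (Suc n))\<^sup>2))" by (intro summable_mult inverse_squares_summable)
    show "norm (saw_coeff (Suc n) u) \<le> (1 / pi\<^sup>2) * (1 / (real (Suc n))\<^sup>2)" for n
      using saw_coeff_le[of "Suc n" u] saw_coeff_nonneg[of "Suc n" u] by simp
  qed
  have "(\<lambda>k. \<Sum>n. r k ^ Suc n * saw_coeff (Suc n) u) \<longlonglongrightarrow> (\<Sum>n. 1 ^ Suc n * saw_coeff (Suc n) u)"
  proof (rule tannerys_theorem[THEN conjunct2, THEN conjunct2])
    show "(\<lambda>k. r k ^ Suc n * saw_coeff (Suc n) u) \<longlonglongrightarrow> 1 ^ Suc n * saw_coeff (Suc n) u" for n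
      by (intro tendsto_intros r1)
    show "\<forall>\<^sub>F (n, k) in at_top \<times>\<^sub>F sequentially. norm (r k ^ Suc n * saw_coeff (Suc n) u) \<le> saw_coeff (Suc n) u"
    proof (intro always_eventually allI, clarify)
      fix n k :: nat
      have "r k ^ Suc n \<le> 1" using r[of k] by (intro power_le_one) auto
      then show "norm (r k ^ Suc n * saw_coeff (Suc n) u) \<le> saw_coeff (Suc n) u"
        using saw_coeff_nonneg[of "Suc n" u] r[of k] by (simp add: abs_mult mult_left_le_one_le del: power_Suc)
    qed
  qed (use sm in auto)
  with lim1 have "(\<Sum>n. saw_coeff (Suc n) u) = (u - u\<^sup>2) / 2"
    unfolding eq using LIMSEQ_unique by fastforce
  with sm show ?thesis by (simp add: sums_iff)
qed

lemma saw_fourier: "(\<lambda>n. saw_coeff (Suc n) u) sums saw u"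
proof -
  have "saw_coeff v (frac u) = saw_coeff v u" for v
  proof -
    have "2 * pi * real v * frac u = 2 * pi * real v * u + 2 * pi * of_int (- (int v * \<lfloor>u\<rfloor>))"
      by (simp add: frac_def algebra_simps)
    then have "cos (2 * pi * real v * frac u) = cos (2 * pi * real v * u)"
      by (simp only: cos_add cos_int_2pin sin_int_2pin mult_1_right mult_zero_right diff_zero)
    then show ?thesis by (simp add: saw_coeff_def)
  qed
  then show ?thesis using saw_fourier_unit[of "frac u"] frac_lt_1[of u] by (simp add: saw_def)
qed


section \<open>Mellin integrals over subsets of the positive axis\<close>

definition mellin_fun :: "(real \<Rightarrow> real) \<Rightarrow> complex \<Rightarrow> real \<Rightarrow> complex" where
  "mellin_fun f s u = of_real (f u) * of_real u powr (- s - 2)"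

text \<open>The Mellin transform at -s - 1 of f restricted to S. The exponent -s - 2 arises from
  differentiating u^(-s) twice in Euler-Maclaurin summation.\<close>

definition mellin :: "real set \<Rightarrow> (real \<Rightarrow> real) \<Rightarrow> complex \<Rightarrow> complex" where
  "mellin S f s = integral S (mellin_fun f s)"

text \<open>A majorant for the whole strip \<sigma>1 <= Re s <= \<sigma>2: for u <= 1 the largest
  real part is the worst, for u > 1 the smallest.\<close>

definition mellin_dom :: "real \<Rightarrow> real \<Rightarrow> real \<Rightarrow> real \<Rightarrow> real \<Rightarrow> real" where
  "mellin_dom C p \<sigma>1 \<sigma>2 u = C * (if u \<le> 1 then u powr (p - \<sigma>2 - 2) else u powr (- \<sigma>1 - 2))"

text \<open>\<open>p\<close> is the order of vanishing at the origin, so that \<open>mellin S f s\<close> converges for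
  \<open>-1 < Re s < p - 1\<close>; it is arbitrary if \<open>S\<close> is contained in \<open>[1, \<infinity>)\<close>.\<close>

definition mellin_bound :: "real set \<Rightarrow> (real \<Rightarrow> real) \<Rightarrow> real \<Rightarrow> real \<Rightarrow> bool" where
  "mellin_bound S f C p \<longleftrightarrow> S \<in> sets lebesgue \<and> S \<subseteq> {0<..} \<and> continuous_on {0<..} f \<and>
     (\<forall>u\<in>S. \<bar>f u\<bar> \<le> C * (if u \<le> 1 then u powr p else 1))"

lemma mellin_dom_integrable:
  assumes "-1 < \<sigma>1" "\<sigma>2 < p - 1" "C \<ge> 0" "S \<subseteq> {0<..}" "S \<in> sets lebesgue"
  shows "mellin_dom C p \<sigma>1 \<sigma>2 integrable_on S"
proof -
  have 1: "mellin_dom C p \<sigma>1 \<sigma>2 integrable_on {0<..1}"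
  proof (rule integrable_eq)
    show "(\<lambda>u. C * u powr (p - \<sigma>2 - 2)) integrable_on {0<..1}"
      by (intro integrable_on_mult_right integrable_on_powr_from_0') (use assms in auto)
  qed (auto simp: mellin_dom_def)
  have "(\<lambda>u. u powr (- \<sigma>1 - 2)) integrable_on {1..}"
    using has_integral_powr_to_inf[of "- \<sigma>1 - 2" 1] assms by (auto simp: integrable_on_def)
  then have "(\<lambda>u. C * u powr (- \<sigma>1 - 2)) integrable_on {1..}" by (rule integrable_on_mult_right)
  then have 2: "mellin_dom C p \<sigma>1 \<sigma>2 integrable_on {1..}"
    by (rule integrable_spike_finite[of "{1}", rotated -1]) (auto simp: mellin_dom_def)
  have "mellin_dom C p \<sigma>1 \<sigma>2 integrable_on ({0<..1} \<union> {1..})"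
    by (rule integrable_Un[OF _ 1 2]) (rule negligible_subset[of "{1}"], auto)
  moreover have "{0<..1} \<union> {1..} = ({0<..} :: real set)" by auto
  ultimately have "mellin_dom C p \<sigma>1 \<sigma>2 integrable_on {0<..}" by simp
  then have "mellin_dom C p \<sigma>1 \<sigma>2 absolutely_integrable_on {0<..}"
    by (subst absolutely_integrable_on_iff_nonneg) (use assms in \<open>auto simp: mellin_dom_def\<close>)
  then have "mellin_dom C p \<sigma>1 \<sigma>2 absolutely_integrable_on S"
    by (rule set_integrable_subset) (use assms in auto)
  then show ?thesis by (rule set_lebesgue_integral_eq_integral)
qed

lemma mellin_fun_le:
  assumes f: "mellin_bound S f C p" and s: "\<sigma>1 \<le> Re s" "Re s \<le> \<sigma>2" and u: "u \<in> S"
  shows "norm (mellin_fun f s u) \<le> mellin_dom C p \<sigma>1 \<sigma>2 u"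
proof -
  have u0: "u > 0" using f u by (auto simp: mellin_bound_def)
  have n: "norm (mellin_fun f s u) = \<bar>f u\<bar> * u powr (- Re s - 2)"
    using u0 by (simp add: mellin_fun_def norm_mult norm_powr_real_powr)
  have fu: "\<bar>f u\<bar> \<le> C * (if u \<le> 1 then u powr p else 1)" using f u by (auto simp: mellin_bound_def)
  have "0 \<le> C * (if u \<le> 1 then u powr p else 1)" using fu by linarith
  moreover have "(if u \<le> 1 then u powr p else 1) > 0" using u0 by auto
  ultimately have C: "C \<ge> 0" by (simp add: zero_le_mult_iff)
  show ?thesis
  proof (cases "u \<le> 1")
    case True
    have "\<bar>f u\<bar> * u powr (- Re s - 2) \<le> (C * u powr p) * u powr (- \<sigma>2 - 2)"
      using fu True s u0 C by (intro mult_mono powr_mono') auto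
    also have "\<dots> = C * u powr (p - \<sigma>2 - 2)" using u0 by (simp add: powr_add[symmetric] algebra_simps)
    finally show ?thesis using n True by (simp add: mellin_dom_def)
  next
    case False
    have "\<bar>f u\<bar> * u powr (- Re s - 2) \<le> C * u powr (- \<sigma>1 - 2)"
      using fu False s u0 C by (intro mult_mono powr_mono) auto
    then show ?thesis using n False by (simp add: mellin_dom_def)
  qed
qed

lemma mellin_bound_C_nonneg: "mellin_bound S f C p \<Longrightarrow> S \<noteq> {} \<Longrightarrow> C \<ge> 0"
proof -
  assume f: "mellin_bound S f C p" and "S \<noteq> {}"
  then obtain u where u: "u \<in> S" by auto
  then have fu: "\<bar>f u\<bar> \<le> C * (if u \<le> 1 then u powr p else 1)" "u > 0" using f by (auto simp: mellin_bound_def)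
  have "0 \<le> C * (if u \<le> 1 then u powr p else 1)" using fu by linarith
  moreover have "(if u \<le> 1 then u powr p else 1) > 0" using fu by auto
  ultimately show "C \<ge> 0" by (simp add: zero_le_mult_iff)
qed

lemma mellin_bound_subset: "mellin_bound S f C p \<Longrightarrow> T \<subseteq> S \<Longrightarrow> T \<in> sets lebesgue \<Longrightarrow> mellin_bound T f C p"
  unfolding mellin_bound_def by blast

lemma mellin_fun_continuous:
  "continuous_on {0<..} f \<Longrightarrow> continuous_on {0<..} (mellin_fun f s)"
  unfolding mellin_fun_def[abs_def] by (intro continuous_intros) (auto simp: complex_nonpos_Reals_iff)

lemma mellin_integrable:
  assumes f: "mellin_bound S f C p" and s: "-1 < Re s" "Re s < p - 1"
  shows "mellin_fun f s integrable_on S"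
proof (cases "S = {}")
  case False
  have S: "S \<in> sets lebesgue" "S \<subseteq> {0<..}" using f by (auto simp: mellin_bound_def)
  show ?thesis
  proof (rule measurable_bounded_by_integrable_imp_integrable)
    show "mellin_fun f s \<in> borel_measurable (lebesgue_on S)"
      by (rule continuous_imp_measurable_on_sets_lebesgue[OF continuous_on_subset[OF mellin_fun_continuous S(2)] S(1)])
         (use f in \<open>simp add: mellin_bound_def\<close>)
    show "mellin_dom C p (Re s) (Re s) integrable_on S"
      by (rule mellin_dom_integrable) (use s S mellin_bound_C_nonneg[OF f False] in auto)
  qed (use mellin_fun_le[OF f order_refl order_refl] S in auto)
qed auto

text \<open>It is the tail of the majorant that is shown to vanish, since this gives convergence
  uniformly in s, as holomorphy of the limit requires.\<close>

lemma mellin_exhaust_dom: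
  assumes f: "mellin_bound S f C p" and s: "-1 < \<sigma>1" "\<sigma>2 < p - 1"
    and T: "\<And>n. T n \<in> sets lebesgue" "\<And>n. T n \<subseteq> S"
    and ev: "\<And>u. u \<in> S \<Longrightarrow> eventually (\<lambda>n. u \<in> T n) sequentially"
  shows "(\<lambda>n. integral (S - T n) (mellin_dom C p \<sigma>1 \<sigma>2)) \<longlonglongrightarrow> 0"
proof (cases "S = {}")
  case False
  have S: "S \<in> sets lebesgue" "S \<subseteq> {0<..}" using f by (auto simp: mellin_bound_def)
  have C: "C \<ge> 0" using mellin_bound_C_nonneg[OF f False] .
  let ?h = "mellin_dom C p \<sigma>1 \<sigma>2"
  have hS: "?h integrable_on S" by (rule mellin_dom_integrable) (use s S C in auto)
  have h: "?h integrable_on (S - T n)" for n by (rule mellin_dom_integrable) (use s S C T in auto)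
  have "(\<lambda>n. integral S (\<lambda>u. if u \<in> S - T n then ?h u else 0)) \<longlonglongrightarrow> integral S (\<lambda>u. 0)"
  proof (rule dominated_convergence(2)[OF _ hS])
    show "(\<lambda>u. if u \<in> S - T n then ?h u else 0) integrable_on S" for n
      using h[of n] by (subst integrable_restrict_Int) (auto simp: Int_absorb2)
    show "norm (if u \<in> S - T n then ?h u else 0) \<le> ?h u" for n u using C by (auto simp: mellin_dom_def)
    show "(\<lambda>n. if u \<in> S - T n then ?h u else 0) \<longlonglongrightarrow> 0" if "u \<in> S" for u
      by (rule tendsto_eventually) (use ev[OF that] in eventually_elim, auto)
  qed
  moreover have "integral S (\<lambda>u. if u \<in> S - T n then ?h u else 0) = integral (S - T n) ?h" for n
    by (subst integral_restrict_Int) (auto simp: Int_absorb2)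
  ultimately show ?thesis by simp
qed simp

lemma mellin_diff_le:
  assumes f: "mellin_bound S f C p" and s: "-1 < \<sigma>1" "\<sigma>2 < p - 1" "\<sigma>1 \<le> Re s" "Re s \<le> \<sigma>2"
    and T: "T \<in> sets lebesgue" "T \<subseteq> S"
  shows "norm (mellin S f s - mellin T f s) \<le> integral (S - T) (mellin_dom C p \<sigma>1 \<sigma>2)"
proof (cases "S = {}")
  case False
  have S: "S \<in> sets lebesgue" "S \<subseteq> {0<..}" using f by (auto simp: mellin_bound_def)
  have ST: "S - T \<in> sets lebesgue" using S T by auto
  have bT: "mellin_bound T f C p" "mellin_bound (S - T) f C p" using mellin_bound_subset[OF f] T ST by auto
  have iT: "mellin_fun f s integrable_on T" "mellin_fun f s integrable_on (S - T)"
    using mellin_integrable[OF bT(1)] mellin_integrable[OF bT(2)] s by auto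
  have "integral (T \<union> (S - T)) (mellin_fun f s) = mellin T f s + integral (S - T) (mellin_fun f s)"
    unfolding mellin_def by (rule integral_Un[OF iT]) (auto simp: Int_Diff)
  moreover have "T \<union> (S - T) = S" using T by auto
  ultimately have "mellin S f s - mellin T f s = integral (S - T) (mellin_fun f s)" by (simp add: mellin_def)
  also have "norm \<dots> \<le> integral (S - T) (mellin_dom C p \<sigma>1 \<sigma>2)"
    by (rule integral_norm_bound_integral[OF iT(2) mellin_dom_integrable])
       (use s S ST mellin_bound_C_nonneg[OF f False] mellin_fun_le[OF f] in auto)
  finally show ?thesis .
qed (use T in \<open>auto simp: mellin_def\<close>)

lemma mellin_exhaust:
  assumes f: "mellin_bound S f C p" and s: "-1 < Re s" "Re s < p - 1"
    and T: "\<And>n. T n \<in> sets lebesgue" "\<And>n. T n \<subseteq> S"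
    and ev: "\<And>u. u \<in> S \<Longrightarrow> eventually (\<lambda>n. u \<in> T n) sequentially"
  shows "(\<lambda>n. mellin (T n) f s) \<longlonglongrightarrow> mellin S f s"
proof -
  have "(\<lambda>n. mellin S f s - mellin (T n) f s) \<longlonglongrightarrow> 0"
    by (rule Lim_null_comparison[OF always_eventually mellin_exhaust_dom[OF f s T ev]])
       (use mellin_diff_le[OF f s order_refl order_refl T] in auto)
  from tendsto_diff[OF tendsto_const[of "mellin S f s"] this] show ?thesis by simp
qed

lemma mellin_interval_holomorphic:
  assumes f: "continuous_on {0<..} f" and a: "0 < a"
  shows "mellin {a..b} f holomorphic_on A"
proof -
  have "mellin {a..b} f holomorphic_on UNIV"
    unfolding holomorphic_on_def
  proof
    fix s0 :: complex
    let ?g = "\<lambda>s t. - (of_real (f t) * of_real t powr (- s - 2) * Ln (of_real t))"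
    have "((\<lambda>s. integral (cbox a b) (mellin_fun f s)) has_field_derivative integral (cbox a b) (?g s0)) (at s0 within UNIV)"
    proof (rule leibniz_rule_field_derivative[where fx = "?g"])
      show "((\<lambda>s. mellin_fun f s t) has_field_derivative ?g s t) (at s within UNIV)" if "t \<in> cbox a b" for s t
      proof -
        have t: "complex_of_real t \<noteq> 0" using that a by auto
        have "((\<lambda>s. - s - 2) has_field_derivative -1) (at s)" for s :: complex
          by (auto intro!: derivative_eq_intros)
        from DERIV_cmult[OF DERIV_chain2[OF has_field_derivative_powr_right[OF t] this], of "of_real (f t)" s]
        show ?thesis unfolding mellin_fun_def by (simp add: mult_ac)
      qed
      show "mellin_fun f s integrable_on cbox a b" for s
        by (rule integrable_continuous, rule continuous_on_subset[OF mellin_fun_continuous[OF f]]) (use a in auto)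
      have "continuous_on (UNIV \<times> cbox a b) (\<lambda>z. f (snd z))"
        by (rule continuous_on_compose2[OF f]) (use a in \<open>auto intro: continuous_intros\<close>)
      then show "continuous_on (UNIV \<times> cbox a b) (\<lambda>(s, t). ?g s t)"
        unfolding case_prod_unfold using a
        by (intro continuous_intros) (auto simp: complex_nonpos_Reals_iff)
    qed auto
    then show "mellin {a..b} f field_differentiable (at s0 within UNIV)"
      unfolding mellin_def[abs_def] field_differentiable_def by auto
  qed
  then show ?thesis by (rule holomorphic_on_subset) auto
qed

text \<open>Truncations to compact intervals are entire, and on a closed disc inside the strip one
  majorant controls all tails, so the convergence is locally uniform.\<close>

lemma mellin_holomorphic:
  assumes f: "mellin_bound S f C p" and S: "S = {0<..} \<or> (\<exists>a>0. S = {a..})"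
  shows "mellin S f holomorphic_on {s. -1 < Re s \<and> Re s < p - 1}"
proof -
  obtain T :: "nat \<Rightarrow> real set" where T: "\<And>n. \<exists>a b. T n = {a..b} \<and> 0 < a" "\<And>n. T n \<subseteq> S"
     and ev: "\<And>u. u \<in> S \<Longrightarrow> eventually (\<lambda>n. u \<in> T n) sequentially"
    using S
  proof
    assume "S = {0<..}"
    have "eventually (\<lambda>n. u \<in> {1 / real (Suc n)..real n}) sequentially" if "u > 0" for u
    proof -
      have "eventually (\<lambda>n. real n \<ge> u) sequentially" by real_asymp
      moreover have "eventually (\<lambda>n. 1 / real (Suc n) < u) sequentially"
        using order_tendstoD(2)[OF LIMSEQ_Suc[OF lim_1_over_n] that] by simp
      ultimately show ?thesis by eventually_elim auto
    qed
    moreover have "{1 / real (Suc n)..real n} \<subseteq> S" for n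
    proof
      fix u assume "u \<in> {1 / real (Suc n)..real n}"
      moreover have "1 / real (Suc n) > 0" by simp
      ultimately have "u > 0" unfolding atLeastAtMost_iff by linarith
      then show "u \<in> S" using \<open>S = {0<..}\<close> by simp
    qed
    moreover have "\<exists>a b. {1 / real (Suc n)..real n} = {a..b} \<and> 0 < a" for n
      by (intro exI[of _ "1 / real (Suc n)"] exI[of _ "real n"]) auto
    ultimately show ?thesis using \<open>S = {0<..}\<close>
      by (intro that[of "\<lambda>n. {1 / real (Suc n)..real n}"]) blast+
  next
    assume "\<exists>a>0. S = {a..}"
    then obtain a where a: "a > 0" "S = {a..}" by auto
    have "eventually (\<lambda>n. u \<in> {a..real n}) sequentially" if "u \<ge> a" for u
    proof -
      have "eventually (\<lambda>n. real n \<ge> u) sequentially" by real_asymp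
      then show ?thesis by (rule eventually_mono) (use that in auto)
    qed
    then show ?thesis using a by (intro that[of "\<lambda>n. {a..real n}"]) auto
  qed
  have Ts: "T n \<in> sets lebesgue" for n using T(1)[of n] by auto
  have cont: "continuous_on {0<..} f" using f by (simp add: mellin_bound_def)
  show ?thesis
  proof (rule holomorphic_uniform_sequence)
    show "open {s. -1 < Re s \<and> Re s < p - 1}"
      by (intro open_Collect_conj open_Collect_less continuous_intros)
    show "mellin (T n) f holomorphic_on {s. -1 < Re s \<and> Re s < p - 1}" for n
      using T(1)[of n] mellin_interval_holomorphic[OF cont] by auto
    fix s assume "s \<in> {s. -1 < Re s \<and> Re s < p - 1}"
    then have s: "-1 < Re s" "Re s < p - 1" by auto
    define d where "d = min (Re s + 1) (p - 1 - Re s) / 2"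
    have d: "d > 0" "-1 < Re s - d" "Re s + d < p - 1" using s by (auto simp: d_def min_def field_simps)
    have strip: "Re s - d \<le> Re z \<and> Re z \<le> Re s + d" if "z \<in> cball s d" for z
      using that abs_Re_le_cmod[of "s - z"] by (auto simp: dist_norm)
    have lim: "(\<lambda>n. integral (S - T n) (mellin_dom C p (Re s - d) (Re s + d))) \<longlonglongrightarrow> 0"
      by (rule mellin_exhaust_dom[OF f d(2,3) Ts T(2) ev])
    have "uniform_limit (cball s d) (\<lambda>n. mellin (T n) f) (mellin S f) sequentially"
    proof (rule uniform_limitI)
      fix e :: real assume "e > 0"
      from order_tendstoD(2)[OF lim this]
      show "\<forall>\<^sub>F n in sequentially. \<forall>x\<in>cball s d. dist (mellin (T n) f x) (mellin S f x) < e"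
      proof eventually_elim
        case (elim n)
        show ?case
        proof
          fix z assume "z \<in> cball s d"
          from mellin_diff_le[OF f d(2,3) conjunct1[OF strip[OF this]] conjunct2[OF strip[OF this]] Ts T(2), of n] elim
          show "dist (mellin (T n) f z) (mellin S f z) < e" by (simp add: dist_norm norm_minus_commute)
        qed
      qed
    qed
    moreover have "cball s d \<subseteq> {s. -1 < Re s \<and> Re s < p - 1}" using strip d by force
    ultimately show "\<exists>d>0. cball s d \<subseteq> {s. -1 < Re s \<and> Re s < p - 1} \<and> uniform_limit (cball s d) (\<lambda>n. mellin (T n) f) (mellin S f) sequentially"
      using d(1) by blast
  qed
qed

section \<open>Continuation of the zeta function\<close>

lemma saw_bounds: "0 \<le> saw u" "saw u \<le> 1" "u > 0 \<Longrightarrow> saw u \<le> u"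
proof -
  have f: "0 \<le> frac u" "frac u < 1" by (auto simp: frac_lt_1)
  have "(frac u)\<^sup>2 \<le> frac u * 1" unfolding power2_eq_square using f by (intro mult_left_mono) auto
  then show "0 \<le> saw u" by (simp add: saw_def)
  have le: "saw u \<le> frac u / 2" by (simp add: saw_def)
  then show "saw u \<le> 1" using f by linarith
  assume "u > 0"
  then have "frac u \<le> u" by (simp add: frac_def)
  then show "saw u \<le> u" using le f by linarith
qed

text \<open>At the right end point \<open>frac\<close> jumps, but the polynomial vanishes there as
  well; this permits the fundamental theorem on closed unit intervals.\<close>

lemma saw_eq:
  assumes "real n \<le> u" "u \<le> real n + 1"
  shows "saw u = ((u - real n) - (u - real n)\<^sup>2) / 2"
proof (cases "u = real n + 1")
  case True
  then have "u = of_int (int n + 1)" by simp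
  then have "frac u = 0" by (simp only: frac_of_int)
  then have "saw u = 0" unfolding saw_def by (simp only:) simp
  then show ?thesis using True by simp
next
  case False
  then have "frac u = u - real n"
    using assms by (subst frac_unique_iff) auto
  then show ?thesis by (simp add: saw_def)
qed

text \<open>The Fourier series converges uniformly, which avoids arguing through the discontinuous
  \<open>frac\<close>.\<close>

lemma continuous_on_saw: "continuous_on A saw"
proof -
  have "continuous_on UNIV (\<lambda>u. \<Sum>n. saw_coeff (Suc n) u)"
  proof (rule uniform_limit_theorem[OF always_eventually])
    show "uniform_limit UNIV (\<lambda>k u. \<Sum>n<k. saw_coeff (Suc n) u) (\<lambda>u. \<Sum>n. saw_coeff (Suc n) u) sequentially"
    proof (rule Weierstrass_m_test)
      show "summable (\<lambda>n. (1 / pi\<^sup>2) * (1 / (real (Suc n))\<^sup>2))" by (intro summable_mult inverse_squares_summable)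
      show "norm (saw_coeff (Suc n) u) \<le> (1 / pi\<^sup>2) * (1 / (real (Suc n))\<^sup>2)" for n u
        using saw_coeff_le[of "Suc n" u] saw_coeff_nonneg[of "Suc n" u] by simp
    qed
    show "\<forall>k. continuous_on UNIV (\<lambda>u. \<Sum>n<k. saw_coeff (Suc n) u)"
      unfolding saw_coeff_def by (intro allI continuous_intros) auto
  qed auto
  moreover have "(\<lambda>u. \<Sum>n. saw_coeff (Suc n) u) = saw" using saw_fourier by (auto simp: sums_iff)
  ultimately show ?thesis by (metis continuous_on_subset top_greatest)
qed

lemma saw_coeff_bounds:
  assumes "v > 0"
  shows "saw_coeff v u \<le> 1" "saw_coeff v u \<le> u\<^sup>2"
proof -
  have "1 * 1 \<le> pi\<^sup>2 * (real v)\<^sup>2" using pi_ge_two assms by (intro mult_mono) (auto simp: one_le_power)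
  then have "1 / (pi\<^sup>2 * (real v)\<^sup>2) \<le> 1" by simp
  then show "saw_coeff v u \<le> 1" using saw_coeff_le[of v u] by linarith
  define x where "x = pi * real v * u"
  have "1 - cos (2 * x) = 2 * (sin x)\<^sup>2" by (simp add: cos_double_sin)
  also have "(sin x)\<^sup>2 \<le> x\<^sup>2" using abs_sin_x_le_abs_x[of x] by (simp add: abs_le_square_iff)
  finally have "1 - cos (2 * x) \<le> 2 * x\<^sup>2" by simp
  then have "saw_coeff v u \<le> 2 * x\<^sup>2 / (2 * pi\<^sup>2 * (real v)\<^sup>2)"
    unfolding saw_coeff_def by (intro divide_right_mono) (auto simp: x_def mult_ac)
  also have "\<dots> = u\<^sup>2" using assms by (simp add: x_def power_mult_distrib)
  finally show "saw_coeff v u \<le> u\<^sup>2" .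
qed

text \<open>The order of vanishing p = 1 makes \<open>saw\<close> admissible on the whole axis for
  -1 < Re s < 0; the single coefficients have p = 2 and are admissible up to Re s < 1.\<close>

lemma mellin_bound_saw: "S \<in> sets lebesgue \<Longrightarrow> S \<subseteq> {0<..} \<Longrightarrow> mellin_bound S saw 1 1"
  unfolding mellin_bound_def using saw_bounds by (auto simp: continuous_on_saw subset_iff abs_of_nonneg)

lemma continuous_on_saw_coeff: "continuous_on A (saw_coeff v)"
  unfolding saw_coeff_def[abs_def] by (cases "v = 0") (auto intro!: continuous_intros)

lemma mellin_bound_saw_coeff:
  "v > 0 \<Longrightarrow> S \<in> sets lebesgue \<Longrightarrow> S \<subseteq> {0<..} \<Longrightarrow> mellin_bound S (saw_coeff v) 1 2"
  unfolding mellin_bound_def using saw_coeff_bounds saw_coeff_nonneg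
  by (auto simp: continuous_on_saw_coeff subset_iff abs_of_nonneg powr_numeral)

text \<open>On [1, infinity) the case u <= 1 means u = 1, where u powr p = 1; hence every p is
  allowed and the integrals converge for all Re s > -1.\<close>

lemma mellin_bound_atLeast:
  assumes "continuous_on {0<..} f" "\<And>u. u \<ge> a \<Longrightarrow> \<bar>f u\<bar> \<le> C" "a \<ge> 1"
  shows "mellin_bound {a..} f C p"
  unfolding mellin_bound_def using assms by (auto simp: antisym_conv)

lemma powr_complex_deriv:
  assumes "u > 0"
  shows "((\<lambda>u. complex_of_real u powr z) has_vector_derivative z * of_real u powr (z - 1)) (at u within S)"
proof -
  have "((\<lambda>w. w powr z) has_field_derivative z * of_real u powr (z - 1)) (at (complex_of_real u))"
    using assms by (intro has_field_derivative_powr) (auto simp: complex_nonpos_Reals_iff)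
  from has_vector_derivative_real_field[OF this] show ?thesis .
qed

lemma saw_interval_mellin:
  assumes n: "n > 0" and s: "s \<noteq> 1"
  shows "s * (s + 1) * mellin {real n..real n + 1} saw s =
    (of_nat (Suc n) powr (- s) + of_nat n powr (- s)) / 2
      - (of_nat (Suc n) powr (1 - s) - of_nat n powr (1 - s)) / (1 - s)"
proof -
  define b where "b = (\<lambda>u. complex_of_real (((u - real n) - (u - real n)\<^sup>2) / 2))"
  \<comment> \<open>Antiderivative from two integrations by parts. Since b' = -(u - n - 1/2), the
    terms with u^(-s-1) cancel in H'; b vanishes at both ends, so only the last two terms of H
    contribute there.\<close>
  define H where "H = (\<lambda>u. - s * (b u * of_real u powr (- s - 1)) + (of_real (u - real n - 1 / 2) * of_real u powr (- s))
     - of_real u powr (1 - s) / (1 - s))"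
  have hi: "((\<lambda>u. s * (s + 1) * mellin_fun saw s u) has_integral (H (real n + 1) - H (real n))) {real n..real n + 1}"
  proof (rule fundamental_theorem_of_calculus)
    fix u assume u: "u \<in> {real n..real n + 1}"
    then have u0: "u > 0" using n by auto
    have db: "(b has_vector_derivative of_real (1 / 2 - (u - real n))) (at u within S)" for S
      unfolding b_def by (rule has_vector_derivative_of_real)
        (auto intro!: derivative_eq_intros simp: has_real_derivative_iff_has_vector_derivative[symmetric])
    have dl: "((\<lambda>u. complex_of_real (u - real n - 1 / 2)) has_vector_derivative of_real 1) (at u within S)" for S
      by (rule has_vector_derivative_of_real)
        (auto intro!: derivative_eq_intros simp: has_real_derivative_iff_has_vector_derivative[symmetric])
    have "(H has_vector_derivative
       (- s * (b u * ((- s - 1) * of_real u powr (- s - 1 - 1)) + of_real (1 / 2 - (u - real n)) * of_real u powr (- s - 1))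
       + (of_real (u - real n - 1 / 2) * (- s * of_real u powr (- s - 1)) + of_real 1 * of_real u powr (- s))
       - (1 - s) * of_real u powr (1 - s - 1) / (1 - s))) (at u within {real n..real n + 1})"
      unfolding H_def
      by (intro has_vector_derivative_diff has_vector_derivative_add has_vector_derivative_mult_right
          has_vector_derivative_divide has_vector_derivative_mult db dl powr_complex_deriv u0)
    also have "(- s * (b u * ((- s - 1) * of_real u powr (- s - 1 - 1)) + of_real (1 / 2 - (u - real n)) * of_real u powr (- s - 1))
       + (of_real (u - real n - 1 / 2) * (- s * of_real u powr (- s - 1)) + of_real 1 * of_real u powr (- s))
       - (1 - s) * of_real u powr (1 - s - 1) / (1 - s)) = s * (s + 1) * (b u * of_real u powr (- s - 2))"
    proof -
      have c: "(1 - s) * x / (1 - s) = x" for x using s by simp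
      show ?thesis unfolding c by (simp add: algebra_simps)
    qed
    also have "b u * of_real u powr (- s - 2) = mellin_fun saw s u"
    proof -
      have "saw u = ((u - real n) - (u - real n)\<^sup>2) / 2" using saw_eq[of n u] u by simp
      then show ?thesis by (simp only: mellin_fun_def b_def)
    qed
    finally show "(H has_vector_derivative s * (s + 1) * mellin_fun saw s u) (at u within {real n..real n + 1})" .
  qed simp
  have "H (real n + 1) - H (real n) = (of_nat (Suc n) powr (- s) + of_nat n powr (- s)) / 2
      - (of_nat (Suc n) powr (1 - s) - of_nat n powr (1 - s)) / (1 - s)"
    by (simp add: H_def b_def add.commute diff_divide_distrib add_divide_distrib)
  then show ?thesis using integral_unique[OF hi] by (simp add: mellin_def)
qed

lemma euler_maclaurin_saw:
  assumes N: "N > 0" and s: "s \<noteq> 1" and "N \<le> L"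
  shows "s * (s + 1) * mellin {real N..real L} saw s =
    (\<Sum>n\<in>{N..L}. of_nat n powr (- s)) - of_nat N powr (- s) / 2 - of_nat L powr (- s) / 2
      - (of_nat L powr (1 - s) - of_nat N powr (1 - s)) / (1 - s)"
  using \<open>N \<le> L\<close>
proof (induction L rule: dec_induct)
  case base
  show ?case by (simp add: mellin_def)
next
  case (step L)
  have i: "mellin_fun saw s integrable_on {real N..real (Suc L)}"
    by (rule integrable_continuous_interval, rule continuous_on_subset[OF mellin_fun_continuous[OF continuous_on_saw]])
       (use N in auto)
  have "mellin {real N..real (Suc L)} saw s = mellin {real N..real L} saw s + mellin {real L..real L + 1} saw s"
    unfolding mellin_def using Henstock_Kurzweil_Integration.integral_combine[OF _ _ i, of "real L"] step by (simp add: add.commute)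
  moreover have "{N..Suc L} = insert (Suc L) {N..L}" using step by auto
  ultimately show ?case
    using step.IH saw_interval_mellin[of L s] step N s
    by (simp add: distrib_left add_divide_distrib diff_divide_distrib)
qed

lemma powr_nat_tendsto_0:
  assumes "Re z < 0"
  shows "(\<lambda>n. of_nat n powr z) \<longlonglongrightarrow> (0 :: complex)"
proof (rule tendsto_norm_zero_cancel)
  have "(\<lambda>n. real n powr (Re z)) \<longlonglongrightarrow> 0"
    using assms by (intro tendsto_neg_powr filterlim_real_sequentially)
  moreover have "eventually (\<lambda>n. real n powr (Re z) = norm (of_nat n powr z :: complex)) sequentially"
    using eventually_gt_at_top[of 0] by eventually_elim (simp add: norm_powr_real_powr)
  ultimately show "(\<lambda>n. norm (of_nat n powr z :: complex)) \<longlonglongrightarrow> 0"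
    by (rule Lim_transform_eventually)
qed

lemma mellin_atLeast_tendsto:
  assumes f: "mellin_bound {a..} f C p" and s: "-1 < Re s" "Re s < p - 1"
  shows "(\<lambda>n. mellin {a..real n} f s) \<longlonglongrightarrow> mellin {a..} f s"
proof (rule mellin_exhaust[OF f s])
  show "eventually (\<lambda>n. u \<in> {a..real n}) sequentially" if "u \<in> {a..}" for u
  proof -
    have "eventually (\<lambda>n. real n \<ge> u) sequentially" by real_asymp
    then show ?thesis by (rule eventually_mono) (use that in auto)
  qed
qed auto

lemma mellin_bound_saw_atLeast: "a \<ge> 1 \<Longrightarrow> mellin_bound {a..} saw 1 p"
  by (rule mellin_bound_atLeast[OF continuous_on_saw]) (use saw_bounds in \<open>auto simp: abs_of_nonneg\<close>)

text \<open>Euler-Maclaurin from 1 to L with L tending to infinity; for Re s > 1 the terms at L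
  vanish.\<close>

lemma zeta_series_mellin:
  assumes "Re s > 1"
  shows "(\<lambda>n. of_nat (Suc n) powr (- s)) sums (1 / 2 + 1 / (s - 1) + s * (s + 1) * mellin {1..} saw s)"
proof -
  have s1: "s \<noteq> 1" using assms by auto
  have "(\<lambda>L. mellin {1..real L} saw s) \<longlonglongrightarrow> mellin {1..} saw s"
    by (rule mellin_atLeast_tendsto[OF mellin_bound_saw_atLeast[of 1 "Re s + 2"]]) (use assms in auto)
  then have "(\<lambda>L. s * (s + 1) * mellin {1..real L} saw s + 1 / 2 + of_nat L powr (- s) / 2 + (of_nat L powr (1 - s) - 1) / (1 - s))
     \<longlonglongrightarrow> s * (s + 1) * mellin {1..} saw s + 1 / 2 + 0 / 2 + (0 - 1) / (1 - s)"
    by (intro tendsto_intros powr_nat_tendsto_0) (use assms s1 in auto)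
  moreover have "eventually (\<lambda>L. s * (s + 1) * mellin {1..real L} saw s + 1 / 2 + of_nat L powr (- s) / 2 + (of_nat L powr (1 - s) - 1) / (1 - s)
      = (\<Sum>n<L. of_nat (Suc n) powr (- s))) sequentially"
    using eventually_gt_at_top[of 0]
  proof eventually_elim
    case (elim L)
    have "(\<Sum>n<L. of_nat (Suc n) powr (- s)) = (\<Sum>n\<in>{1..L}. of_nat n powr (- s))"
      by (rule sum.reindex_bij_witness[of _ "\<lambda>n. n - 1" Suc]) auto
    then show ?case using euler_maclaurin_saw[of 1 s L] elim s1 by simp
  qed
  ultimately have "(\<lambda>L. \<Sum>n<L. of_nat (Suc n) powr (- s)) \<longlonglongrightarrow> s * (s + 1) * mellin {1..} saw s + 1 / 2 + 0 / 2 + (0 - 1) / (1 - s)"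
    by (rule Lim_transform_eventually)
  moreover have "s * (s + 1) * mellin {1..} saw s + 1 / 2 + 0 / 2 + (0 - 1) / (1 - s)
      = 1 / 2 + 1 / (s - 1) + s * (s + 1) * mellin {1..} saw s"
  proof -
    have "(0 - 1) / (1 - s) = 1 / (s - 1)" using s1 by (simp add: divide_simps)
    then show ?thesis by (simp only: add_ac) simp
  qed
  ultimately show ?thesis unfolding sums_def by (simp only:)
qed

lemma holomorphic_mellin_atLeast:
  assumes "continuous_on {0<..} f" "\<And>u. u \<ge> 1 \<Longrightarrow> \<bar>f u\<bar> \<le> C"
  shows "mellin {1..} f holomorphic_on {s. Re s > -1}"
proof -
  have "mellin {1..} f holomorphic_on (\<Union>p::nat. {s. -1 < Re s \<and> Re s < real p - 1})"
  proof (rule holomorphic_on_UN_open)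
    show "open {s. -1 < Re s \<and> Re s < real p - 1}" for p :: nat
      by (intro open_Collect_conj open_Collect_less continuous_intros)
    show "mellin {1..} f holomorphic_on {s. -1 < Re s \<and> Re s < real p - 1}" for p :: nat
      by (rule mellin_holomorphic[OF mellin_bound_atLeast[OF assms]]) auto
  qed
  moreover have "(\<Union>p::nat. {s. -1 < Re s \<and> Re s < real p - 1}) = {s. Re s > -1}"
  proof -
    have "\<exists>p::nat. Re s < real p - 1" for s using reals_Archimedean2[of "Re s + 1"] by (auto simp: algebra_simps)
    then show ?thesis by auto
  qed
  ultimately show ?thesis by simp
qed

section \<open>Continuation by repeated periodic primitives\<close>

lemma periodic_bounded:
  fixes f :: "real \<Rightarrow> real"
  assumes c: "continuous_on {0..1} f" and p: "\<And>u. u \<ge> 0 \<Longrightarrow> f (u + 1) = f u"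
  obtains C where "\<And>u. u \<ge> 0 \<Longrightarrow> \<bar>f u\<bar> \<le> C"
proof -
  have "bounded (f ` {0..1})" by (intro compact_imp_bounded compact_continuous_image c) auto
  then obtain C where "\<forall>y\<in>f ` {0..1}. norm y \<le> C" unfolding bounded_iff by blast
  then have C: "\<And>u. u \<in> {0..1} \<Longrightarrow> \<bar>f u\<bar> \<le> C" by auto
  have pn: "f (u + real n) = f u" if "u \<ge> 0" for u n
    by (induction n) (use p[of "u + real _"] that in \<open>auto simp: add_ac\<close>)
  show ?thesis
  proof (rule that)
    fix u :: real assume "u \<ge> 0"
    then have "u = frac u + real (nat \<lfloor>u\<rfloor>)" by (simp add: frac_def)
    then have "f u = f (frac u)" using pn[of "frac u" "nat \<lfloor>u\<rfloor>"] by simp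
    then show "\<bar>f u\<bar> \<le> C" using C[of "frac u"] frac_lt_1[of u] by simp
  qed
qed


text \<open>Induction on the width of the half-plane: if \<open>g\<close> is the periodic primitive of \<open>f\<close> minus its
  mean, integration by parts turns the integral of \<open>f\<close> at \<open>s\<close> into the one of \<open>g\<close> at \<open>s + 1\<close>.\<close>

lemma periodic_mellin_continuation:
  fixes f :: "real \<Rightarrow> real"
  assumes "\<And>b. continuous_on {0..b} f" and "\<And>u. u \<ge> 0 \<Longrightarrow> f (u + 1) = f u"
  shows "\<exists>G. G holomorphic_on {s. Re s > -1 - real k} \<and>
    (\<forall>s. Re s > -1 \<longrightarrow> mellin {1..} f s = of_real (integral {0..1} f) / (s + 1) + G s)"
  using assms
proof (induction k arbitrary: f)
  case 0
  obtain C where C: "\<And>u. u \<ge> 0 \<Longrightarrow> \<bar>f u\<bar> \<le> C" using periodic_bounded[OF 0(1) 0(2)] by blast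
  have cont: "continuous_on {0<..} f"
  proof (rule continuous_at_imp_continuous_on, rule ballI)
    fix x :: real assume "x \<in> {0<..}"
    then have "x \<in> interior {0..x + 1}" by (simp add: interior_atLeastAtMost_real)
    then show "isCont f x" using continuous_on_interior[OF 0(1)] by blast
  qed
  have "(\<lambda>s. mellin {1..} f s - of_real (integral {0..1} f) / (s + 1)) holomorphic_on {s. Re s > -1}"
    by (intro holomorphic_intros holomorphic_mellin_atLeast[OF cont C]) (auto simp: complex_eq_iff)
  then show ?case by (intro exI[of _ "\<lambda>s. mellin {1..} f s - of_real (integral {0..1} f) / (s + 1)"]) auto
next
  case (Suc k)
  obtain C where C: "\<And>u. u \<ge> 0 \<Longrightarrow> \<bar>f u\<bar> \<le> C" using periodic_bounded[OF Suc.prems] by blast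
  define m where "m = integral {0..1} f"
  \<comment> \<open>Subtracting the mean makes the primitive periodic again, and it vanishes at all
    integers, which removes the boundary terms.\<close>
  define g where "g = (\<lambda>u. integral {0..u} (\<lambda>x. f x - m))"
  have cf: "continuous_on {0..b} (\<lambda>x. f x - m)" for b by (intro continuous_intros Suc.prems)
  have fi: "(\<lambda>x. f x - m) integrable_on {a..b}" if "0 \<le> a" for a b
    by (rule integrable_continuous_interval, rule continuous_on_subset[OF cf[of b]]) (use that in auto)
  have gc: "continuous_on {0..b} g" for b
    unfolding g_def by (rule indefinite_integral_continuous_1[OF fi]) simp
  have g01: "g 0 = 0" "g 1 = 0"
  proof -
    have "((\<lambda>x. f x - m) has_integral (m - (1 - 0) *\<^sub>R m)) {0..1}"
      unfolding m_def
      by (intro has_integral_diff integrable_integral integrable_continuous_interval Suc.prems(1))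
         (use has_integral_const_real[of "integral {0..1} f" 0 1] in simp)
    then have "integral {0..1} (\<lambda>x. f x - m) = 0" by (simp add: integral_unique)
    then show "g 0 = 0" "g 1 = 0" by (auto simp: g_def m_def)
  qed
  have gp: "g (u + 1) = g u" if "u \<ge> 0" for u
  proof -
    have "g (u + 1) = g 1 + integral {1..u+1} (\<lambda>x. f x - m)"
      unfolding g_def by (rule Henstock_Kurzweil_Integration.integral_combine[symmetric]) (use that fi in auto)
    also have "integral {1..u+1} (\<lambda>x. f x - m) = integral {0..u} ((\<lambda>x. f x - m) \<circ> (+) 1)"
      using integral_shift_Icc_real[of 0 u "\<lambda>x. f x - m" 1] by (simp add: add.commute)
    also have "\<dots> = g u" unfolding g_def
      by (rule integral_cong) (use Suc.prems(2) in \<open>auto simp: add.commute\<close>)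
    finally show ?thesis by (simp add: g01)
  qed
  obtain D where D: "\<And>u. u \<ge> 0 \<Longrightarrow> \<bar>g u\<bar> \<le> D" using periodic_bounded[OF gc gp] by blast
  have cont: "continuous_on {0<..} h" if "\<And>b. continuous_on {0..b} h" for h :: "real \<Rightarrow> real"
  proof (rule continuous_at_imp_continuous_on, rule ballI)
    fix x :: real assume "x \<in> {0<..}"
    then have "x \<in> interior {0..x + 1}" by (simp add: interior_atLeastAtMost_real)
    then show "isCont h x" using continuous_on_interior[OF that] by blast
  qed
  have gn: "g (real n) = 0" for n
  proof (induction n)
    case (Suc n)
    then show ?case using gp[of "real n"] by (simp add: add.commute)
  qed (simp add: g01)
  obtain G where G: "G holomorphic_on {s. Re s > -1 - real k}"
    "\<And>s. Re s > -1 \<Longrightarrow> mellin {1..} g s = of_real (integral {0..1} g) / (s + 1) + G s"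
    using Suc.IH[OF gc gp] by blast
  \<comment> \<open>The transform of g at s + 1 has at most a simple pole at s = -2, and the factor
    s + 2 turns the polar part into a constant. So H is holomorphic one unit further left than
    G.\<close>
  define H where "H = (\<lambda>s. of_real (integral {0..1} g) + (s + 2) * G (s + 1))"
  have rec: "mellin {1..} f s = of_real m / (s + 1) + (s + 2) * mellin {1..} g (s + 1)" if s: "Re s > -1" for s
  proof -
    have s1: "s + 1 \<noteq> 0" using s by (auto simp: complex_eq_iff)
    have fin: "mellin {1..real n} f s = of_real m * ((1 - of_nat n powr (- s - 1)) / (s + 1)) + (s + 2) * mellin {1..real n} g (s + 1)"
      if n: "n \<ge> 1" for n
    proof -
      have fti: "mellin_fun f s integrable_on {1..real n}" "mellin_fun g (s + 1) integrable_on {1..real n}"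
        by (rule integrable_continuous_interval, rule continuous_on_subset[OF mellin_fun_continuous[OF cont]], use Suc.prems gc in auto)+
      have "((\<lambda>u. mellin_fun f s u - of_real m * of_real u powr (- s - 2) - (s + 2) * mellin_fun g (s + 1) u) has_integral
         (of_real (g (real n)) * of_real (real n) powr (- s - 2) - of_real (g 1) * of_real 1 powr (- s - 2))) {1..real n}"
      proof (rule fundamental_theorem_of_calculus)
        fix u assume u: "u \<in> {1..real n}"
        then have u0: "u > 0" by auto
        have "(g has_vector_derivative f u - m) (at u within {0..real n})"
          unfolding g_def by (rule integral_has_vector_derivative[OF cf]) (use u in auto)
        then have "(g has_vector_derivative f u - m) (at u within {1..real n})"
          by (rule has_vector_derivative_within_subset) auto
        then have "((\<lambda>u. complex_of_real (g u)) has_vector_derivative of_real (f u - m)) (at u within {1..real n})"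
          by (intro has_vector_derivative_of_real) (simp add: has_real_derivative_iff_has_vector_derivative)
        from has_vector_derivative_mult[OF this powr_complex_deriv[OF u0, of "- s - 2"]]
        show "((\<lambda>u. of_real (g u) * of_real u powr (- s - 2)) has_vector_derivative
           mellin_fun f s u - of_real m * of_real u powr (- s - 2) - (s + 2) * mellin_fun g (s + 1) u) (at u within {1..real n})"
          by (simp add: mellin_fun_def algebra_simps)
      qed (use n in auto)
      then have h1: "((\<lambda>u. mellin_fun f s u - of_real m * of_real u powr (- s - 2) - (s + 2) * mellin_fun g (s + 1) u) has_integral 0) {1..real n}"
        by (simp add: gn g01)
      have "((\<lambda>u. of_real u powr (- s - 2)) has_integral
          (of_real (real n) powr (- s - 1) / (- s - 1) - of_real 1 powr (- s - 1) / (- s - 1))) {1..real n}"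
      proof (rule fundamental_theorem_of_calculus)
        fix u assume u: "u \<in> {1..real n}"
        then have u0: "u > 0" by auto
        have e: "- s - 1 - 1 = - s - 2" by simp
        have "- s - 1 \<noteq> 0" using s by (auto simp: complex_eq_iff)
        then have c: "(- s - 1) * x / (- s - 1) = x" for x by simp
        show "((\<lambda>u. of_real u powr (- s - 1) / (- s - 1)) has_vector_derivative of_real u powr (- s - 2)) (at u within {1..real n})"
          using has_vector_derivative_divide[OF powr_complex_deriv[OF u0, of "- s - 1" "{1..real n}"], of "- s - 1"]
          unfolding c e .
      qed (use n in auto)
      also have "of_real (real n) powr (- s - 1) / (- s - 1) - of_real 1 powr (- s - 1) / (- s - 1) = (1 - of_nat n powr (- s - 1)) / (s + 1)"
      proof -
        have "- s - 1 = - (s + 1)" by simp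
        then show ?thesis by (simp only: divide_minus_right) (simp add: diff_divide_distrib)
      qed
      finally have h2: "((\<lambda>u. of_real m * of_real u powr (- s - 2)) has_integral of_real m * ((1 - of_nat n powr (- s - 1)) / (s + 1))) {1..real n}"
        by (rule has_integral_mult_right)
      have h3: "((\<lambda>u. (s + 2) * mellin_fun g (s + 1) u) has_integral (s + 2) * mellin {1..real n} g (s + 1)) {1..real n}"
        unfolding mellin_def by (intro has_integral_mult_right integrable_integral fti)
      from integral_unique[OF has_integral_add[OF has_integral_add[OF h1 h2] h3]]
      show ?thesis by (simp add: mellin_def)
    qed
    have lf: "(\<lambda>n. mellin {1..real n} f s) \<longlonglongrightarrow> mellin {1..} f s"
      by (rule mellin_atLeast_tendsto[OF mellin_bound_atLeast[OF cont[OF Suc.prems(1)] C, of 1 "Re s + 2"]]) (use s in auto)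
    have lg: "(\<lambda>n. mellin {1..real n} g (s + 1)) \<longlonglongrightarrow> mellin {1..} g (s + 1)"
      by (rule mellin_atLeast_tendsto[OF mellin_bound_atLeast[OF cont[OF gc] D, of 1 "Re s + 3"]]) (use s in auto)
    have "(\<lambda>n. of_real m * ((1 - of_nat n powr (- s - 1)) / (s + 1)) + (s + 2) * mellin {1..real n} g (s + 1))
       \<longlonglongrightarrow> of_real m * ((1 - 0) / (s + 1)) + (s + 2) * mellin {1..} g (s + 1)"
      by (intro tendsto_intros powr_nat_tendsto_0 lg) (use s s1 in auto)
    moreover have "eventually (\<lambda>n. of_real m * ((1 - of_nat n powr (- s - 1)) / (s + 1)) + (s + 2) * mellin {1..real n} g (s + 1) = mellin {1..real n} f s) sequentially"
      using eventually_ge_at_top[of 1] by eventually_elim (simp add: fin)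
    ultimately have "(\<lambda>n. mellin {1..real n} f s) \<longlonglongrightarrow> of_real m * ((1 - 0) / (s + 1)) + (s + 2) * mellin {1..} g (s + 1)"
      by (rule Lim_transform_eventually)
    from LIMSEQ_unique[OF lf this] show ?thesis by simp
  qed
  have "G \<circ> (\<lambda>s. s + 1) holomorphic_on {s. Re s > -1 - real (Suc k)}"
    by (rule holomorphic_on_compose_gen[OF _ G(1)]) (auto intro!: holomorphic_intros)
  then have "(\<lambda>s. G (s + 1)) holomorphic_on {s. Re s > -1 - real (Suc k)}" by (simp add: o_def)
  then have "H holomorphic_on {s. Re s > -1 - real (Suc k)}"
    unfolding H_def by (intro holomorphic_intros)
  moreover have "mellin {1..} f s = of_real m / (s + 1) + H s" if s: "Re s > -1" for s
  proof -
    have "s + 2 \<noteq> 0" using s by (auto simp: complex_eq_iff)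
    then show ?thesis using G(2)[of "s + 1"] s rec[OF s] by (simp add: H_def distrib_left add.assoc)
  qed
  ultimately show ?case unfolding m_def by blast
qed

text \<open>The continuations agree on overlaps by the identity theorem, so any k >= |Re s| may be
  used at s; \<open>E\<close> takes the ceiling of |Re s|.\<close>

lemma holomorphic_exhausting_halfplanes:
  fixes G :: "nat \<Rightarrow> complex \<Rightarrow> complex"
  assumes G: "\<And>k. G k holomorphic_on {s. Re s > -1 - real k}"
    and eq: "\<And>k s. Re s > -1 \<Longrightarrow> G k s = F s"
  obtains E where "E holomorphic_on UNIV" "\<And>s. Re s > -1 \<Longrightarrow> E s = F s"
proof -
  have op: "open {s. Re s > -1 - real k}" for k by (intro open_Collect_less continuous_intros)
  have agree: "G j s = G k s" if "j \<le> k" "Re s > -1 - real j" for j k s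
  proof (rule analytic_continuation_open[of "{s. Re s > -1}" "{s. Re s > -1 - real j}" "G j" "G k"])
    show "open {s. Re s > -1}" by (intro open_Collect_less continuous_intros)
    show "connected {s. Re s > -1 - real j}"
      using convex_halfspace_Re_gt[of "-1 - real j"] by (intro convex_connected) simp
    show "G k holomorphic_on {s. Re s > -1 - real j}" by (rule holomorphic_on_subset[OF G]) (use that in auto)
    show "{s. Re s > -1} \<noteq> {}" by (auto intro: exI[of _ 0])
  qed (use op G eq that in auto)
  define E where "E = (\<lambda>s. G (nat \<lceil>\<bar>Re s\<bar>\<rceil>) s)"
  have EG: "E s = G k s" if "Re s > -1 - real k" for k s
  proof -
    have "real (nat \<lceil>\<bar>Re s\<bar>\<rceil>) \<ge> \<bar>Re s\<bar>" by (simp add: real_nat_ceiling_ge)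
    then have "Re s > -1 - real (nat \<lceil>\<bar>Re s\<bar>\<rceil>)" by linarith
    then show ?thesis unfolding E_def using agree that by (metis nle_le)
  qed
  have "E holomorphic_on (\<Union>k. {s. Re s > -1 - real k})"
    by (rule holomorphic_on_UN_open[OF holomorphic_transform[OF G] op]) (use EG in auto)
  moreover have "(\<Union>k. {s. Re s > -1 - real k}) = UNIV"
  proof -
    have "\<exists>k. Re s > -1 - real k" for s using reals_Archimedean2[of "- 1 - Re s"] by (auto simp: algebra_simps)
    then show ?thesis by auto
  qed
  ultimately show ?thesis using that[of E] EG[of 0] eq[of _ 0] by auto
qed

text \<open>Existence is what gives the \<open>SOME\<close> in \<open>zeta\<close> its defining
  properties.\<close>

lemma zeta_exists:
  "\<exists>f. f holomorphic_on (- {1}) \<and> (\<forall>s. Re s > 1 \<longrightarrow> (\<lambda>n. of_nat (Suc n) powr (- s)) sums f s)"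
proof -
  define m where "m = integral {0..1} saw"
  have per: "saw (u + 1) = saw u" for u by (simp add: saw_def frac_1_eq)
  have "\<forall>k. \<exists>G. G holomorphic_on {s. Re s > -1 - real k} \<and>
    (\<forall>s. Re s > -1 \<longrightarrow> mellin {1..} saw s = of_real m / (s + 1) + G s)"
    unfolding m_def by (intro allI periodic_mellin_continuation continuous_on_saw per)
  then obtain G where G: "\<And>k. G k holomorphic_on {s. Re s > -1 - real k}"
    "\<And>k s. Re s > -1 \<Longrightarrow> mellin {1..} saw s = of_real m / (s + 1) + G k s" by metis
  have eq: "G k s = mellin {1..} saw s - of_real m / (s + 1)" if "Re s > -1" for k s
    using G(2)[OF that, of k] by simp
  obtain E where E: "E holomorphic_on UNIV" "\<And>s. Re s > -1 \<Longrightarrow> E s = mellin {1..} saw s - of_real m / (s + 1)"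
    using holomorphic_exhausting_halfplanes[of G, OF G(1) eq] by blast
  \<comment> \<open>The pole of the Mellin integral at s = -1 is cancelled by the factor s + 1,
    leaving the term s m.\<close>
  define Z where "Z = (\<lambda>s. 1 / 2 + 1 / (s - 1) + (s * of_real m + s * (s + 1) * E s))"
  have "Z holomorphic_on - {1}"
    unfolding Z_def by (intro holomorphic_intros holomorphic_on_subset[OF E(1)]) auto
  moreover have "(\<lambda>n. of_nat (Suc n) powr (- s)) sums Z s" if s: "Re s > 1" for s
  proof -
    have "s + 1 \<noteq> 0" using s by (auto simp: complex_eq_iff)
    have "mellin {1..} saw s = of_real m / (s + 1) + E s" using E(2)[of s] s by simp
    have "s * (s + 1) * mellin {1..} saw s = s * of_real m + s * (s + 1) * E s"
    proof -
      have "s * (s + 1) * mellin {1..} saw s = s * ((s + 1) * (of_real m / (s + 1))) + s * (s + 1) * E s"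
      proof -
        have "s * (s + 1) * (x + y) = s * ((s + 1) * x) + s * (s + 1) * y" for x y :: complex
          by (simp add: algebra_simps)
        then show ?thesis unfolding \<open>mellin {1..} saw s = _\<close> .
      qed
      then show ?thesis using \<open>s + 1 \<noteq> 0\<close> by simp
    qed
    then show ?thesis using zeta_series_mellin[OF s] by (simp add: Z_def)
  qed
  ultimately show ?thesis by blast
qed

lemma zeta_holomorphic: "zeta holomorphic_on - {1}"
  and zeta_sums: "Re s > 1 \<Longrightarrow> (\<lambda>n. of_nat (Suc n) powr (- s)) sums zeta s"
  using someI_ex[OF zeta_exists] unfolding zeta_def[symmetric] by auto

lemma zeta_mellin:
  assumes "Re s > -1" "s \<noteq> 1"
  shows "zeta s = 1 / 2 + 1 / (s - 1) + s * (s + 1) * mellin {1..} saw s"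
proof (rule analytic_continuation_open[of "{s. Re s > 1}" "{s. Re s > -1} - {1}" zeta
    "\<lambda>s. 1 / 2 + 1 / (s - 1) + s * (s + 1) * mellin {1..} saw s"])
  show "open {s. Re s > 1}" by (intro open_Collect_less continuous_intros)
  have op: "open {s. Re s > -1}" by (intro open_Collect_less continuous_intros)
  then show "open ({s. Re s > -1} - {1})" by (intro open_Diff) auto
  show "connected ({s. Re s > -1} - {1})"
    using convex_halfspace_Re_gt[of "-1"] by (intro connected_open_delete convex_connected op) auto
  show "{s. Re s > 1} \<noteq> {}" by (auto intro: exI[of _ 2])
  show "zeta holomorphic_on {s. Re s > -1} - {1}" by (rule holomorphic_on_subset[OF zeta_holomorphic]) auto
  have "mellin {1..} saw holomorphic_on {s. Re s > -1}"
    by (rule holomorphic_mellin_atLeast[OF continuous_on_saw]) (use saw_bounds in \<open>simp add: abs_of_nonneg\<close>)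
  then show "(\<lambda>s. 1 / 2 + 1 / (s - 1) + s * (s + 1) * mellin {1..} saw s) holomorphic_on {s. Re s > -1} - {1}"
    by (intro holomorphic_intros) (auto intro: holomorphic_on_subset)
  show "zeta z = 1 / 2 + 1 / (z - 1) + z * (z + 1) * mellin {1..} saw z" if "z \<in> {s. Re s > 1}" for z
    using sums_unique2[OF zeta_sums zeta_series_mellin] that by auto
qed (use assms in auto)

section \<open>The functional equation\<close>

lemma Icc_inverse_subset: "{1 / real (Suc n)..b} \<subseteq> {0<..b}"
proof
  fix u assume u: "u \<in> {1 / real (Suc n)..b}"
  have "0 < 1 / real (Suc n)" by simp
  also have "\<dots> \<le> u" using u by (simp only: atLeastAtMost_iff)
  finally show "u \<in> {0<..b}" using u by simp
qed

lemma zeta_partial_sum_mellin: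
  assumes s: "Re s > -1" "s \<noteq> 1" and N: "N > 0"
  shows "zeta s = (\<Sum>n\<in>{1..N}. of_nat n powr (- s)) - of_nat N powr (- s) / 2 + of_nat N powr (1 - s) / (s - 1)
     + s * (s + 1) * mellin {real N..} saw s"
proof -
  have b: "mellin_bound {1..} saw 1 (Re s + 2)" by (rule mellin_bound_saw_atLeast) simp
  have sub: "mellin_fun saw s integrable_on T" if "T \<subseteq> {1..}" "T \<in> sets lebesgue" for T
    by (rule mellin_integrable[OF mellin_bound_subset[OF b that]]) (use s in auto)
  have "integral ({1..real N} \<union> {real N..}) (mellin_fun saw s) = mellin {1..real N} saw s + mellin {real N..} saw s"
    unfolding mellin_def using N
    by (intro integral_Un sub) (auto intro: negligible_subset[of "{real N}"])
  moreover have "{1..real N} \<union> {real N..} = {1..}" using N by auto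
  ultimately have "mellin {1..} saw s = mellin {1..real N} saw s + mellin {real N..} saw s" by (simp add: mellin_def)
  then have "s * (s + 1) * mellin {1..} saw s = s * (s + 1) * mellin {real 1..real N} saw s + s * (s + 1) * mellin {real N..} saw s"
    by (simp add: distrib_left)
  also have "s * (s + 1) * mellin {real 1..real N} saw s = (\<Sum>n\<in>{1..N}. of_nat n powr (- s)) - 1 / 2 - of_nat N powr (- s) / 2
      - (of_nat N powr (1 - s) - 1) / (1 - s)"
    using euler_maclaurin_saw[of 1 s N] N s by simp
  also have "(of_nat N powr (1 - s) - 1) / (1 - s) = 1 / (s - 1) - of_nat N powr (1 - s) / (s - 1)"
    using s by (simp add: divide_simps) (simp add: algebra_simps)
  finally show ?thesis using zeta_mellin[OF s] by (simp add: algebra_simps)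
qed

lemma zeta_cnj: 
  assumes "s \<noteq> 1"
  shows "zeta (cnj s) = cnj (zeta s)"
proof -
  have "zeta s = (cnj \<circ> zeta \<circ> cnj) s"
  proof (rule analytic_continuation_open[of "{s. Re s > 1}" "- {1}" zeta "cnj \<circ> zeta \<circ> cnj"])
    show "open {s. Re s > 1}" by (intro open_Collect_less continuous_intros)
    show "connected (- {1 :: complex})" by (rule connected_punctured_universe) simp
    have "cnj ` (- {1}) = - {1}" 
    proof (intro equalityI subsetI)
      fix x :: complex assume "x \<in> - {1}"
      then have "cnj x \<in> - {1}" by (metis Compl_iff complex_cnj_cnj complex_cnj_one singletonD singletonI)
      then show "x \<in> cnj ` (- {1})" by (rule image_eqI[rotated]) simp
    next
      fix x assume "x \<in> cnj ` (- {1})"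
      then show "x \<in> - {1}" by (metis Compl_iff complex_cnj_cnj complex_cnj_one imageE singletonD singletonI)
    qed
    then show "cnj \<circ> zeta \<circ> cnj holomorphic_on - {1}"
      by (intro holomorphic_on_compose_cnj_cnj) (auto simp: zeta_holomorphic)
    show "{s. Re s > 1} \<noteq> {}" by (auto intro: exI[of _ 2])
    fix z assume "z \<in> {s. Re s > 1}"
    then have z: "Re z > 1" "Re (cnj z) > 1" by auto
    have "(\<lambda>n. cnj (of_nat (Suc n) powr (- cnj z))) sums cnj (zeta (cnj z))"
      using zeta_sums[OF z(2)] by (simp only: sums_cnj)
    moreover have "cnj (of_nat (Suc n) powr (- cnj z)) = of_nat (Suc n) powr (- z)" for n
      by (subst cnj_powr) (auto simp: complex_nonpos_Reals_iff complex_eq_iff)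
    ultimately show "zeta z = (cnj \<circ> zeta \<circ> cnj) z"
      using sums_unique2[OF zeta_sums[OF z(1)]] by auto
  qed (use assms zeta_holomorphic in auto)
  then show ?thesis by (metis comp_apply complex_cnj_cnj)
qed

text \<open>The coefficients are nonnegative with sum \<open>saw\<close>, so partial sums and single
  coefficients inherit the given bound for \<open>saw\<close>; dominated convergence then exchanges
  sum and integral.\<close>

lemma mellin_saw_series:
  assumes b: "mellin_bound S saw C p" and s: "-1 < Re s" "Re s < p - 1"
  shows "(\<lambda>n. mellin S (saw_coeff (Suc n)) s) sums mellin S saw s"
proof -
  have S: "S \<in> sets lebesgue" "S \<subseteq> {0<..}" using b by (auto simp: mellin_bound_def)
  have coeff_le: "(\<Sum>n<k. saw_coeff (Suc n) u) \<le> saw u" for k u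
    using sum_le_suminf[of "\<lambda>n. saw_coeff (Suc n) u" "{..<k}"] saw_fourier[of u] saw_coeff_nonneg by (simp add: sums_iff)
  have fb: "mellin_bound S (\<lambda>u. \<Sum>n<k. saw_coeff (Suc n) u) C p" for k
    unfolding mellin_bound_def
  proof (intro conjI ballI S)
    show "continuous_on {0<..} (\<lambda>u. \<Sum>n<k. saw_coeff (Suc n) u)" by (intro continuous_intros continuous_on_saw_coeff)
    fix u assume "u \<in> S"
    have "\<bar>\<Sum>n<k. saw_coeff (Suc n) u\<bar> \<le> \<bar>saw u\<bar>" using coeff_le[where k=k and u=u] saw_coeff_nonneg by (simp add: sum_nonneg)
    also have "\<dots> \<le> C * (if u \<le> 1 then u powr p else 1)" using b \<open>u \<in> S\<close> by (auto simp: mellin_bound_def)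
    finally show "\<bar>\<Sum>n<k. saw_coeff (Suc n) u\<bar> \<le> C * (if u \<le> 1 then u powr p else 1)" .
  qed
  have cb: "mellin_bound S (saw_coeff (Suc n)) C p" for n
    unfolding mellin_bound_def
  proof (intro conjI ballI S continuous_on_saw_coeff)
    fix u assume "u \<in> S"
    have "\<bar>saw_coeff (Suc n) u\<bar> \<le> (\<Sum>n<Suc n. saw_coeff (Suc n) u)" using saw_coeff_nonneg by (simp add: sum_nonneg)
    also have "\<dots> \<le> \<bar>saw u\<bar>" using coeff_le[where k="Suc n" and u=u] by linarith
    also have "\<dots> \<le> C * (if u \<le> 1 then u powr p else 1)" using b \<open>u \<in> S\<close> by (auto simp: mellin_bound_def)
    finally show "\<bar>saw_coeff (Suc n) u\<bar> \<le> C * (if u \<le> 1 then u powr p else 1)" .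
  qed
  have add: "mellin S (\<lambda>u. \<Sum>n<k. saw_coeff (Suc n) u) s = (\<Sum>n<k. mellin S (saw_coeff (Suc n)) s)" for k
  proof -
    have "mellin_fun (\<lambda>u. \<Sum>n<k. saw_coeff (Suc n) u) s = (\<lambda>u. \<Sum>n<k. mellin_fun (saw_coeff (Suc n)) s u)"
      by (simp add: mellin_fun_def fun_eq_iff sum_distrib_right)
    then show ?thesis unfolding mellin_def
      by (simp only:) (intro Henstock_Kurzweil_Integration.integral_sum mellin_integrable[OF cb s] finite_lessThan)
  qed
  show ?thesis
  proof (cases "S = {}")
    case False
    have "(\<lambda>k. integral S (mellin_fun (\<lambda>u. \<Sum>n<k. saw_coeff (Suc n) u) s)) \<longlonglongrightarrow> integral S (mellin_fun saw s)"
    proof (rule dominated_convergence(2)[where h = "mellin_dom C p (Re s) (Re s)"])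
      show "mellin_dom C p (Re s) (Re s) integrable_on S"
        by (rule mellin_dom_integrable) (use s S mellin_bound_C_nonneg[OF b False] in auto)
      show "(\<lambda>k. mellin_fun (\<lambda>u. \<Sum>n<k. saw_coeff (Suc n) u) s u) \<longlonglongrightarrow> mellin_fun saw s u" for u
        unfolding mellin_fun_def using saw_fourier[of u] unfolding sums_def by (intro tendsto_intros)
    qed (use mellin_integrable[OF fb s] mellin_fun_le[OF fb order_refl order_refl] in auto)
    then show ?thesis unfolding mellin_def[symmetric] add sums_def .
  qed (simp add: mellin_def)
qed

text \<open>The free scale c lets the substitution u -> v u map one exhausting sequence onto another
  of the same kind.\<close>

lemma integral_positive_axis_limit:
  assumes f: "mellin_bound {0<..} f C p" and s: "-1 < Re s" "Re s < p - 1" and c: "c > 0"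
  shows "(\<lambda>n. mellin {c / real (Suc n)..c * real n} f s) \<longlonglongrightarrow> mellin {0<..} f s"
proof (rule mellin_exhaust[OF f s])
  fix u :: real assume "u \<in> {0<..}"
  then have u: "u / c > 0" using c by simp
  have "eventually (\<lambda>n. real n \<ge> u / c) sequentially" by real_asymp
  moreover have "eventually (\<lambda>n. 1 / real (Suc n) < u / c) sequentially"
    using order_tendstoD(2)[OF LIMSEQ_Suc[OF lim_1_over_n] u] by simp
  ultimately show "eventually (\<lambda>n. u \<in> {c / real (Suc n)..c * real n}) sequentially"
    by eventually_elim (use c in \<open>auto simp: field_simps\<close>)
next
  show "{c / real (Suc n)..c * real n} \<subseteq> {0<..}" for n
  proof
    fix u assume "u \<in> {c / real (Suc n)..c * real n}"
    moreover have "c / real (Suc n) > 0" using c by simp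
    ultimately show "u \<in> {0<..}" unfolding atLeastAtMost_iff greaterThan_iff by linarith
  qed
qed auto

text \<open>The kernel for v at u is 1 / v^2 times the kernel for 1 at v u; substituting v u
  produces v^(-2) v^(s+2) v^(-1) = v^(s-1).\<close>

lemma mellin_saw_coeff_scale:
  assumes s: "-1 < Re s" "Re s < 1" and v: "v > 0"
  shows "mellin {0<..} (saw_coeff v) s = of_nat v powr (s - 1) * mellin {0<..} (saw_coeff 1) s"
proof -
  have b: "mellin_bound {0<..} (saw_coeff n) 1 2" if "n > 0" for n by (rule mellin_bound_saw_coeff[OF that]) auto
  have eq: "mellin {1 / real (Suc n)..1 * real n} (saw_coeff v) s = of_nat v powr (s - 1) * mellin {real v / real (Suc n)..real v * real n} (saw_coeff 1) s"
    if "n > 0" for n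
  proof -
    have im: "(\<lambda>x. x / real v) ` {real v / real (Suc n)..real v * real n} = {1 / real (Suc n)..1 * real n}"
    proof -
      have "1 / real (Suc n) \<le> 1" by simp
      also have "1 \<le> real n" using that by simp
      finally have "real v * (1 / real (Suc n)) \<le> real v * real n" by (intro mult_left_mono) auto
      then have "real v / real (Suc n) \<le> real v * real n" by simp
      then show ?thesis using v by (subst image_divide_atLeastAtMost) auto
    qed
    have F: "mellin_fun (saw_coeff v) s u = (of_real (real v) powr s) * mellin_fun (saw_coeff 1) s (real v * u)" if "u > 0" for u
    proof -
      have e1: "saw_coeff v u = saw_coeff 1 (real v * u) / (real v)\<^sup>2" by (simp add: saw_coeff_def mult.assoc)
      have e2: "complex_of_real (real v * u) powr (- s - 2) = of_real (real v) powr (- s - 2) * of_real u powr (- s - 2)"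
        using v that by (simp add: powr_times_real)
      have "of_real (real v) powr s * of_real (real v) powr (- s - 2) = (of_nat v powr (- 2) :: complex)"
        by (simp add: powr_add[symmetric])
      also have "\<dots> = 1 / (of_nat v)\<^sup>2" using v by (simp add: powr_minus powr_numeral divide_inverse)
      finally have e3: "of_real (real v) powr s * of_real (real v) powr (- s - 2) = (1 / (of_nat v)\<^sup>2 :: complex)" .
      have "(of_real (real v) powr s) * mellin_fun (saw_coeff 1) s (real v * u) =
        (of_real (real v) powr s * of_real (real v) powr (- s - 2)) * (of_real (saw_coeff 1 (real v * u)) * of_real u powr (- s - 2))"
        unfolding mellin_fun_def e2 by (simp only: mult_ac)
      also have "\<dots> = mellin_fun (saw_coeff v) s u"
        unfolding e3 mellin_fun_def e1 by simp
      finally show ?thesis by simp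
    qed
    have "integral {1 / real (Suc n)..1 * real n} (\<lambda>u. mellin_fun (saw_coeff 1) s (real v * u)) =
       (1 / real v) *\<^sub>R mellin {real v / real (Suc n)..real v * real n} (saw_coeff 1) s"
      unfolding mellin_def im[symmetric] using v by (subst integral_stretch_real) auto
    moreover have "mellin {1 / real (Suc n)..1 * real n} (saw_coeff v) s = 
      integral {1 / real (Suc n)..1 * real n} (\<lambda>u. (of_real (real v) powr s) * mellin_fun (saw_coeff 1) s (real v * u))"
      unfolding mellin_def
    proof (rule integral_cong)
      fix u assume "u \<in> {1 / real (Suc n)..1 * real n}"
      moreover have "1 / real (Suc n) > 0" by simp
      ultimately have "u > 0" unfolding atLeastAtMost_iff by linarith
      then show "mellin_fun (saw_coeff v) s u = of_real (real v) powr s * mellin_fun (saw_coeff 1) s (real v * u)" by (rule F)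
    qed
    moreover have "of_nat v powr (s - 1) = of_real (real v) powr s / (of_nat v :: complex)"
      using v by (simp add: powr_diff)
    ultimately show ?thesis by (simp add: scaleR_conv_of_real)
  qed
  have l1: "(\<lambda>n. mellin {1 / real (Suc n)..1 * real n} (saw_coeff v) s) \<longlonglongrightarrow> mellin {0<..} (saw_coeff v) s"
    by (rule integral_positive_axis_limit[OF b[OF v]]) (use s in auto)
  have "(\<lambda>n. mellin {real v / real (Suc n)..real v * real n} (saw_coeff 1) s) \<longlonglongrightarrow> mellin {0<..} (saw_coeff 1) s"
    by (rule integral_positive_axis_limit[OF b]) (use s v in auto)
  then have "(\<lambda>n. of_nat v powr (s - 1) * mellin {real v / real (Suc n)..real v * real n} (saw_coeff 1) s) \<longlonglongrightarrow> of_nat v powr (s - 1) * mellin {0<..} (saw_coeff 1) s"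
    by (rule tendsto_mult_left)
  moreover have "eventually (\<lambda>n. of_nat v powr (s - 1) * mellin {real v / real (Suc n)..real v * real n} (saw_coeff 1) s
     = mellin {1 / real (Suc n)..1 * real n} (saw_coeff v) s) sequentially"
    using eventually_gt_at_top[of 0] by eventually_elim (use eq in simp)
  ultimately have "(\<lambda>n. mellin {1 / real (Suc n)..1 * real n} (saw_coeff v) s) \<longlonglongrightarrow> of_nat v powr (s - 1) * mellin {0<..} (saw_coeff 1) s"
    by (rule Lim_transform_eventually)
  from LIMSEQ_unique[OF l1 this] show ?thesis .
qed

text \<open>Formally the integral of 2 cos(2 pi u) u^(-s) over the positive axis, classically 2^s
  pi^(s-1) sin(pi s / 2) Gamma(1 - s). It represents chi on the critical strip.\<close>

definition fe_factor :: "complex \<Rightarrow> complex" where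
  "fe_factor s = s * (s + 1) * mellin {0<..} (saw_coeff 1) s"

text \<open>On (0, 1] the kernel is the polynomial (u - u^2) / 2. Its integral reproduces the
  elementary terms of \<open>zeta_mellin\<close>, so that zeta(s) becomes a single integral over the
  whole axis.\<close>

lemma mellin_saw_unit:
  assumes s: "-1 < Re s" "Re s < 0"
  shows "s * (s + 1) * mellin {0<..1} saw s = 1 / 2 + 1 / (s - 1)"
proof -
  have s0: "s \<noteq> 0" "1 - s \<noteq> 0" "s - 1 \<noteq> 0" using s by (auto simp: complex_eq_iff)
  have fin: "mellin {1 / real n..1} saw s = 
     ((1 / (- s) - 1 / (1 - s)) - ((of_real (1 / real n)) powr (- s) / (- s) - of_real (1 / real n) powr (1 - s) / (1 - s))) / 2" if "n > 0" for n
  proof -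
    have "(mellin_fun saw s has_integral ((of_real 1 powr (- s) / (- s) - of_real 1 powr (1 - s) / (1 - s)) / 2 - 
       (of_real (1 / real n) powr (- s) / (- s) - of_real (1 / real n) powr (1 - s) / (1 - s)) / 2)) {1 / real n..1}"
    proof (rule fundamental_theorem_of_calculus)
      fix u assume u: "u \<in> {1 / real n..1}"
      moreover have "1 / real n > 0" using that by simp
      ultimately have u0: "u > 0" unfolding atLeastAtMost_iff by linarith
      have "((\<lambda>u. (of_real u powr (- s) / (- s) - of_real u powr (1 - s) / (1 - s)) / 2) has_vector_derivative
         ((- s * of_real u powr (- s - 1)) / (- s) - ((1 - s) * of_real u powr (1 - s - 1)) / (1 - s)) / 2) (at u within {1 / real n..1})"
        by (intro has_vector_derivative_divide has_vector_derivative_diff powr_complex_deriv u0)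
      also have "((- s * of_real u powr (- s - 1)) / (- s) - ((1 - s) * of_real u powr (1 - s - 1)) / (1 - s)) / 2 = 
         (of_real u powr (- s - 1) - of_real u powr (- s)) / 2"
      proof -
        have "(- s * x) / (- s) = x" "((1 - s) * x) / (1 - s) = x" for x using s0 by auto
        moreover have "1 - s - 1 = - s" by simp
        ultimately show ?thesis by (simp only:)
      qed
      also have "\<dots> = mellin_fun saw s u"
      proof -
        have q: "saw u = (u - u\<^sup>2) / 2" using saw_eq[of 0 u] u u0 by simp
        have p1: "of_real u powr (- s - 1) = of_real u * complex_of_real u powr (- s - 2)"
        proof -
          have "- s - 1 = 1 + (- s - 2)" by simp
          then show ?thesis using u0 by (simp only: powr_add) simp
        qed
        have p2: "of_real u powr (- s) = (of_real u)\<^sup>2 * complex_of_real u powr (- s - 2)"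
        proof -
          have "- s = 2 + (- s - 2)" by simp
          then have "complex_of_real u powr (- s) = of_real u powr 2 * of_real u powr (- s - 2)" by (metis powr_add)
          then show ?thesis using u0 by (simp add: powr_numeral)
        qed
        show ?thesis unfolding mellin_fun_def p1 p2 q by (simp add: algebra_simps diff_divide_distrib)
      qed
      finally show "((\<lambda>u. (of_real u powr (- s) / (- s) - of_real u powr (1 - s) / (1 - s)) / 2) has_vector_derivative mellin_fun saw s u) (at u within {1 / real n..1})" .
    qed (use that in auto)
    then show ?thesis by (simp add: mellin_def integral_unique diff_divide_distrib)
  qed
  have inv: "complex_of_real (1 / real n) powr z = of_nat n powr (- z)" if "n > 0" for n z
  proof -
    have "complex_of_real (1 / real n) powr z = inverse (of_nat n) powr z" by (simp add: divide_inverse)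
    also have "\<dots> = of_nat n powr (- z)" using that by (simp add: powr_def Ln_inverse complex_nonpos_Reals_iff)
    finally show ?thesis .
  qed
  have "(\<lambda>n. mellin {1 / real (Suc n)..1} saw s) \<longlonglongrightarrow> mellin {0<..1} saw s"
  proof (rule mellin_exhaust[OF mellin_bound_saw])
    fix u :: real assume u: "u \<in> {0<..1}"
    then have "eventually (\<lambda>n. 1 / real (Suc n) < u) sequentially"
      using order_tendstoD(2)[OF LIMSEQ_Suc[OF lim_1_over_n]] by auto
    then show "eventually (\<lambda>n. u \<in> {1 / real (Suc n)..1}) sequentially" by (rule eventually_mono) (use u in auto)
  next
    fix n :: nat
    show "{1 / real (Suc n)..1} \<subseteq> {0<..1}" by (rule Icc_inverse_subset)
  qed (use s in auto)
  moreover have "(\<lambda>n. mellin {1 / real (Suc n)..1} saw s) \<longlonglongrightarrow> ((1 / (- s) - 1 / (1 - s)) - (0 / (- s) - 0 / (1 - s))) / 2"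
  proof -
    have "(\<lambda>n. ((1 / (- s) - 1 / (1 - s)) - (of_nat n powr s / (- s) - of_nat n powr (s - 1) / (1 - s))) / 2)
       \<longlonglongrightarrow> ((1 / (- s) - 1 / (1 - s)) - (0 / (- s) - 0 / (1 - s))) / 2"
      by (intro tendsto_intros powr_nat_tendsto_0) (use s s0 in auto)
    moreover have "mellin {1 / real (Suc n)..1} saw s =
       ((1 / (- s) - 1 / (1 - s)) - (of_nat (Suc n) powr s / (- s) - of_nat (Suc n) powr (s - 1) / (1 - s))) / 2" for n
      unfolding fin[OF zero_less_Suc] inv[OF zero_less_Suc] by simp
    ultimately show ?thesis using LIMSEQ_Suc by (simp only:)
  qed
  ultimately have val: "mellin {0<..1} saw s = ((1 / (- s) - 1 / (1 - s)) - (0 / (- s) - 0 / (1 - s))) / 2"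
    using LIMSEQ_unique by blast
  show ?thesis unfolding val using s0 by (simp add: divide_simps) (simp add: algebra_simps)
qed


text \<open>Here zeta(s) is s (s + 1) times the integral of \<open>saw\<close> over the whole axis.
  Expanded by frequencies this is a multiple of the series for zeta(1 - s), which converges because
  Re (1 - s) > 1.\<close>

lemma zeta_functional_left:
  assumes s: "-1 < Re s" "Re s < 0"
  shows "zeta s = fe_factor s * zeta (1 - s)"
proof -
  have s1: "s \<noteq> 1" using s by auto
  have b: "mellin_bound {0<..} saw 1 1" by (rule mellin_bound_saw) auto
  have sub: "mellin_fun saw s integrable_on T" if "T \<subseteq> {0<..}" "T \<in> sets lebesgue" for T
    by (rule mellin_integrable[OF mellin_bound_subset[OF b that]]) (use s in auto)
  have "integral ({0<..1} \<union> {1..}) (mellin_fun saw s) = mellin {0<..1} saw s + mellin {1..} saw s"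
    unfolding mellin_def
    by (intro integral_Un sub) (auto intro: negligible_subset[of "{1}"])
  moreover have "{0<..1} \<union> {1..} = ({0<..} :: real set)" by auto
  ultimately have "mellin {0<..} saw s = mellin {0<..1} saw s + mellin {1..} saw s" by (simp add: mellin_def)
  then have z: "zeta s = s * (s + 1) * mellin {0<..} saw s"
    using zeta_mellin[OF s(1) s1] mellin_saw_unit[OF s] by (simp add: distrib_left)
  have "(\<lambda>n. s * (s + 1) * mellin {0<..} (saw_coeff (Suc n)) s) sums (s * (s + 1) * mellin {0<..} saw s)"
    by (intro sums_mult mellin_saw_series[OF b]) (use s in auto)
  moreover have "s * (s + 1) * mellin {0<..} (saw_coeff (Suc n)) s = fe_factor s * of_nat (Suc n) powr (- (1 - s))" for n
    using mellin_saw_coeff_scale[of s "Suc n"] s by (simp add: fe_factor_def del: of_nat_Suc)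
  ultimately have "(\<lambda>n. fe_factor s * of_nat (Suc n) powr (- (1 - s))) sums zeta s" by (simp only: z)
  moreover have "(\<lambda>n. fe_factor s * of_nat (Suc n) powr (- (1 - s))) sums (fe_factor s * zeta (1 - s))"
    by (intro sums_mult zeta_sums) (use s in auto)
  ultimately show ?thesis using sums_unique2 by blast
qed

lemma fe_factor_holomorphic: "fe_factor holomorphic_on {s. -1 < Re s \<and> Re s < 1}"
proof -
  have "mellin {0<..} (saw_coeff 1) holomorphic_on {s. -1 < Re s \<and> Re s < 2 - 1}"
    by (rule mellin_holomorphic[OF mellin_bound_saw_coeff]) auto
  then show ?thesis unfolding fe_factor_def[abs_def] by (intro holomorphic_intros) auto
qed

text \<open>Continuation across the imaginary axis; the point 0 is removed because 1 - s then meets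
  the pole of zeta at 1.\<close>

lemma zeta_functional:
  assumes s: "s \<in> critical_strip"
  shows "zeta s = fe_factor s * zeta (1 - s)"
proof (rule analytic_continuation_open[of "{s. -1 < Re s \<and> Re s < 0}" "{s. -1 < Re s \<and> Re s < 1} - {0}" zeta "\<lambda>s. fe_factor s * zeta (1 - s)"])
  show "open {s. -1 < Re s \<and> Re s < 0}" by (intro open_Collect_conj open_Collect_less continuous_intros)
  have op: "open {s. -1 < Re s \<and> Re s < 1}" by (intro open_Collect_conj open_Collect_less continuous_intros)
  then show "open ({s. -1 < Re s \<and> Re s < 1} - {0})" by (intro open_Diff) auto
  have "{s. -1 < Re s \<and> Re s < 1} = {s. Re s > -1} \<inter> {s. Re s < 1}" by auto
  then have "convex {s. -1 < Re s \<and> Re s < 1}"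
    using convex_Int[OF convex_halfspace_Re_gt[of "-1"] convex_halfspace_Re_lt[of 1]] by simp
  then show "connected ({s. -1 < Re s \<and> Re s < 1} - {0})"
    by (intro connected_open_delete convex_connected op) auto
  show "{s. -1 < Re s \<and> Re s < 0} \<noteq> {}" by (auto intro: exI[of _ "- 1 / 2"])
  show "zeta holomorphic_on {s. -1 < Re s \<and> Re s < 1} - {0}" by (rule holomorphic_on_subset[OF zeta_holomorphic]) auto
  have "zeta \<circ> (\<lambda>s. 1 - s) holomorphic_on {s. -1 < Re s \<and> Re s < 1} - {0}"
    by (rule holomorphic_on_compose_gen[OF _ zeta_holomorphic]) (auto intro!: holomorphic_intros)
  then show "(\<lambda>s. fe_factor s * zeta (1 - s)) holomorphic_on {s. -1 < Re s \<and> Re s < 1} - {0}"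
    by (intro holomorphic_intros holomorphic_on_subset[OF fe_factor_holomorphic]) (auto simp: o_def)
  show "zeta z = fe_factor z * zeta (1 - z)" if "z \<in> {s. -1 < Re s \<and> Re s < 0}" for z
    using zeta_functional_left that by auto
qed (use s in \<open>auto simp: critical_strip_def\<close>)

lemma zeta_2_nonzero: "zeta 2 \<noteq> 0"
proof
  assume "zeta 2 = 0"
  then have "(\<lambda>n. of_nat (Suc n) powr (- 2)) sums (0 :: complex)" using zeta_sums[of 2] by simp
  then have "(\<lambda>n. Re (of_nat (Suc n) powr (- 2))) sums Re 0" by (rule sums_Re)
  moreover have "Re (of_nat (Suc n) powr (- 2)) = 1 / (real (Suc n))\<^sup>2" for n
  proof -
    have "of_nat (Suc n) powr (- 2) = complex_of_real (1 / (real (Suc n))\<^sup>2)"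
      by (simp add: powr_minus powr_numeral divide_inverse del: of_nat_Suc)
    then show ?thesis by (simp only: Re_complex_of_real)
  qed
  ultimately have "(\<lambda>n. 1 / (real (Suc n))\<^sup>2) sums 0" by simp
  moreover have "(\<lambda>n. 1 / (real (Suc n))\<^sup>2) sums (pi\<^sup>2 / 6)" using inverse_squares_sums by (simp add: add.commute)
  ultimately have "pi\<^sup>2 / 6 = 0" using sums_unique2 by blast
  then show False by simp
qed

lemma critical_strip_open: "open critical_strip"
  unfolding critical_strip_def by (intro open_Collect_conj open_Collect_less continuous_intros)

text \<open>The zeros of zeta(1 - w) are isolated, since zeta does not vanish at 2. Off them the
  quotient equals the continuous \<open>fe_factor\<close>, which is therefore the value that
  \<open>remove_sings\<close> fills in.\<close>

lemma chi_eq_fe_factor: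
  assumes s: "s \<in> critical_strip"
  shows "chi s = fe_factor s"
proof -
  have hol: "(\<lambda>s. zeta (1 - s)) holomorphic_on - {0}"
  proof -
    have "zeta \<circ> (\<lambda>s. 1 - s) holomorphic_on - {0}"
      by (rule holomorphic_on_compose_gen[OF _ zeta_holomorphic]) (auto intro!: holomorphic_intros)
    then show ?thesis by (simp add: o_def)
  qed
  have "eventually (\<lambda>w. zeta (1 - w) \<noteq> 0 \<and> w \<in> - {0}) (at s)"
  proof (rule non_zero_neighbour_alt[OF hol])
    show "connected (- {0 :: complex})" by (rule connected_punctured_universe) simp
    show "zeta (1 - (- 1)) \<noteq> 0" using zeta_2_nonzero by simp
  qed (use s in \<open>auto simp: critical_strip_def\<close>)
  moreover have "eventually (\<lambda>w. w \<in> critical_strip) (at s)"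
    using eventually_at_in_open'[OF critical_strip_open s] .
  ultimately have ev: "eventually (\<lambda>w. fe_factor w = zeta w / zeta (1 - w)) (at s)"
    by eventually_elim (use zeta_functional in auto)
  have "open {s. -1 < Re s \<and> Re s < 1}" by (intro open_Collect_conj open_Collect_less continuous_intros)
  then have "isCont fe_factor s"
    using holomorphic_on_imp_continuous_on[OF fe_factor_holomorphic] s
    by (subst (asm) continuous_on_eq_continuous_at) (auto simp: critical_strip_def)
  then have "fe_factor \<midarrow>s\<rightarrow> fe_factor s" by (simp add: isCont_def)
  then have "(\<lambda>w. zeta w / zeta (1 - w)) \<midarrow>s\<rightarrow> fe_factor s"
    by (rule Lim_transform_eventually[OF _ ev])
  then show ?thesis unfolding chi_def by (rule remove_sings_eqI)
qed

text \<open>The kernel in the integral for \<open>fe_factor\<close> is real.\<close>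

lemma chi_cnj:
  assumes s: "s \<in> critical_strip"
  shows "chi (cnj s) = cnj (chi s)"
proof -
  have "((mellin_fun (saw_coeff 1) s) has_integral mellin {0<..} (saw_coeff 1) s) {0<..}"
    unfolding mellin_def
    by (intro integrable_integral mellin_integrable[OF mellin_bound_saw_coeff]) (use s in \<open>auto simp: critical_strip_def\<close>)
  from has_integral_linear[OF this bounded_linear_cnj]
  have "((\<lambda>u. cnj (mellin_fun (saw_coeff 1) s u)) has_integral cnj (mellin {0<..} (saw_coeff 1) s)) {0<..}" by (simp add: o_def)
  then have "(mellin_fun (saw_coeff 1) (cnj s) has_integral cnj (mellin {0<..} (saw_coeff 1) s)) {0<..}"
    by (rule has_integral_eq[rotated]) (simp add: mellin_fun_def cnj_powr complex_nonpos_Reals_iff)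
  then have "mellin {0<..} (saw_coeff 1) (cnj s) = cnj (mellin {0<..} (saw_coeff 1) s)"
    unfolding mellin_def by (rule integral_unique)
  then have "fe_factor (cnj s) = cnj (fe_factor s)" by (simp add: fe_factor_def)
  moreover have "cnj s \<in> critical_strip" using s by (simp add: critical_strip_def)
  ultimately show ?thesis using chi_eq_fe_factor s by simp
qed

section \<open>Stationary phase estimates\<close>

lemma osc_fun_eq:
  assumes "u > 0"
  shows "osc_fun (Re s) v (Im s) u = cis (2 * pi * v * u) * of_real u powr (- s)"
proof -
  have "of_real u powr (- s) = exp (- s * of_real (ln u))"
    using assms by (simp add: powr_def Ln_of_real)
  also have "\<dots> = of_real (u powr (- Re s)) * cis (- Im s * ln u)"
    using assms by (subst exp_eq_polar) (simp add: powr_def)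
  finally show ?thesis
    by (simp add: osc_fun_def osc_unit_def cis_mult[symmetric] diff_conv_add_uminus del: add_uminus_conv_diff)
qed

lemma osc_fun_continuous: "continuous_on {0<..} (osc_fun \<sigma> v t)"
  unfolding osc_fun_def[abs_def] osc_unit_def[abs_def]
  by (intro continuous_intros continuous_on_cis) auto

lemma osc_fun_integrable: "0 < A \<Longrightarrow> osc_fun \<sigma> v t integrable_on {A..B}"
  by (rule integrable_continuous_interval, rule continuous_on_subset[OF osc_fun_continuous]) auto

lemma norm_osc_fun: "norm (osc_fun \<sigma> v t u) = u powr (-\<sigma>)"
  by (simp add: osc_fun_def norm_mult)

lemma osc_fun_trivial_bound:
  assumes "0 < A" "A \<le> B" "0 \<le> \<sigma>"
  shows "norm (integral {A..B} (osc_fun \<sigma> v t)) \<le> (B - A) * A powr (-\<sigma>)"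
proof -
  have "norm (integral {A..B} (osc_fun \<sigma> v t)) \<le> integral {A..B} (\<lambda>_. A powr (-\<sigma>))"
    by (rule integral_norm_bound_integral)
       (use assms osc_fun_integrable in \<open>auto simp: norm_osc_fun powr_mono2' integrable_const_ivl\<close>)
  then show ?thesis using assms by simp
qed

section \<open>Integration by parts of the frequency terms\<close>

lemma norm_powr_of_real: "u > 0 \<Longrightarrow> norm (complex_of_real u powr z) = u powr Re z"
  by (simp add: norm_powr_real_powr)

text \<open>Boundary terms of the two integrations by parts that lead from \<open>saw_coeff\<close>
  v u times u^(-s-2) to 2 cos(2 pi v u) u^(-s).\<close>

definition saw_boundary :: "nat \<Rightarrow> complex \<Rightarrow> real \<Rightarrow> complex" where
  "saw_boundary v s u = - s * (of_real (saw_coeff v u) * of_real u powr (- s - 1))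
      - of_real (sin (2 * pi * real v * u) / (pi * real v)) * of_real u powr (- s)"

lemma mellin_saw_coeff_parts:
  assumes v: "v > 0" and A: "0 < A" "A \<le> B"
  shows "s * (s + 1) * mellin {A..B} (saw_coeff v) s = saw_boundary v s B - saw_boundary v s A
    + integral {A..B} (osc_fun (Re s) v (Im s)) + integral {A..B} (osc_fun (Re s) (- real v) (Im s))"
proof -
  have h1: "((\<lambda>u. s * (s + 1) * mellin_fun (saw_coeff v) s u - (osc_fun (Re s) v (Im s) u + osc_fun (Re s) (- real v) (Im s) u))
      has_integral (saw_boundary v s B - saw_boundary v s A)) {A..B}"
  proof (rule fundamental_theorem_of_calculus)
    fix u assume "u \<in> {A..B}"
    then have u0: "u > 0" using A by auto
    have dc: "((\<lambda>u. complex_of_real (saw_coeff v u)) has_vector_derivative of_real (sin (2 * pi * real v * u) / (pi * real v))) (at u within {A..B})"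
      by (rule has_vector_derivative_of_real)
         (use v in \<open>auto simp: saw_coeff_def[abs_def] field_simps power2_eq_square intro!: derivative_eq_intros\<close>)
    have ds: "((\<lambda>u. complex_of_real (sin (2 * pi * real v * u) / (pi * real v))) has_vector_derivative of_real (2 * cos (2 * pi * real v * u))) (at u within {A..B})"
      by (rule has_vector_derivative_of_real)
         (use v in \<open>auto simp: field_simps intro!: derivative_eq_intros\<close>)
    have "(saw_boundary v s has_vector_derivative 
      (- s * (of_real (saw_coeff v u) * ((- s - 1) * of_real u powr (- s - 1 - 1)) + of_real (sin (2 * pi * real v * u) / (pi * real v)) * of_real u powr (- s - 1))
       - (of_real (sin (2 * pi * real v * u) / (pi * real v)) * (- s * of_real u powr (- s - 1)) + of_real (2 * cos (2 * pi * real v * u)) * of_real u powr (- s))))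
       (at u within {A..B})"
      unfolding saw_boundary_def[abs_def]
      by (intro has_vector_derivative_diff has_vector_derivative_mult_right has_vector_derivative_mult dc ds powr_complex_deriv u0)
    also have "(- s * (of_real (saw_coeff v u) * ((- s - 1) * of_real u powr (- s - 1 - 1)) + of_real (sin (2 * pi * real v * u) / (pi * real v)) * of_real u powr (- s - 1))
       - (of_real (sin (2 * pi * real v * u) / (pi * real v)) * (- s * of_real u powr (- s - 1)) + of_real (2 * cos (2 * pi * real v * u)) * of_real u powr (- s)))
      = s * (s + 1) * mellin_fun (saw_coeff v) s u - of_real (2 * cos (2 * pi * real v * u)) * of_real u powr (- s)"
    proof -
      have e: "- s - 1 - 1 = - s - 2" by simp
      show ?thesis unfolding mellin_fun_def e by (simp add: algebra_simps)
    qed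
    also have "of_real (2 * cos (2 * pi * real v * u)) * of_real u powr (- s) = osc_fun (Re s) v (Im s) u + osc_fun (Re s) (- real v) (Im s) u"
    proof -
      have "complex_of_real (2 * cos x) = cis x + cis (- x)" for x by (simp add: complex_eq_iff)
      then show ?thesis unfolding osc_fun_eq[OF u0] by (simp add: distrib_right)
    qed
    finally show "(saw_boundary v s has_vector_derivative 
      s * (s + 1) * mellin_fun (saw_coeff v) s u - (osc_fun (Re s) v (Im s) u + osc_fun (Re s) (- real v) (Im s) u)) (at u within {A..B})" .
  qed (use A in auto)
  have h2: "((\<lambda>u. osc_fun (Re s) v (Im s) u + osc_fun (Re s) (- real v) (Im s) u) has_integral
     (integral {A..B} (osc_fun (Re s) v (Im s)) + integral {A..B} (osc_fun (Re s) (- real v) (Im s)))) {A..B}"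
    by (intro has_integral_add integrable_integral osc_fun_integrable A)
  have "((\<lambda>u. s * (s + 1) * mellin_fun (saw_coeff v) s u) has_integral (saw_boundary v s B - saw_boundary v s A +
     (integral {A..B} (osc_fun (Re s) v (Im s)) + integral {A..B} (osc_fun (Re s) (- real v) (Im s))))) {A..B}"
    using has_integral_add[OF h1 h2] by (simp only: diff_add_cancel)
  from integral_unique[OF this] show ?thesis by (simp add: mellin_def add.assoc)
qed

text \<open>This is one reason for an integer cut point: 1 - cos and the sine both vanish
  there.\<close>

lemma saw_boundary_nat [simp]: "saw_boundary v s (real n) = 0"
proof -
  have "2 * pi * real v * real n = 2 * pi * of_int (int (v * n))" by simp
  then have "cos (2 * pi * real v * real n) = 1" "sin (2 * pi * real v * real n) = 0"
    by (simp_all only: cos_int_2pin sin_int_2pin)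
  then show ?thesis by (simp add: saw_boundary_def saw_coeff_def)
qed

lemma saw_boundary_tendsto_0:
  assumes v: "v > 0" and s: "Re s < 1"
  shows "(\<lambda>n. saw_boundary v s (1 / real (Suc n))) \<longlonglongrightarrow> 0"
proof (rule Lim_null_comparison)
  have le: "norm (saw_boundary v s u) \<le> (norm s + 2) * u powr (1 - Re s)" if u: "u > 0" for u
  proof -
    have a1: "norm (s * (of_real (saw_coeff v u) * of_real u powr (- s - 1))) \<le> norm s * u powr (1 - Re s)"
    proof -
      have "norm (complex_of_real (saw_coeff v u) * of_real u powr (- s - 1)) = saw_coeff v u * u powr (- Re s - 1)"
        using u saw_coeff_nonneg[of v u] by (simp add: norm_mult norm_powr_of_real)
      also have "\<dots> \<le> u\<^sup>2 * u powr (- Re s - 1)" using saw_coeff_bounds(2)[OF v] by (intro mult_right_mono) auto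
      also have "\<dots> = u powr (1 - Re s)" using u by (simp add: powr_numeral[symmetric] powr_add[symmetric] del: powr_numeral)
      finally show ?thesis unfolding norm_mult[of s] by (intro mult_left_mono) auto
    qed
    have a2: "norm (of_real (sin (2 * pi * real v * u) / (pi * real v)) * of_real u powr (- s)) \<le> 2 * u powr (1 - Re s)"
    proof -
      have "\<bar>sin (2 * pi * real v * u)\<bar> \<le> \<bar>2 * pi * real v * u\<bar>" by (rule abs_sin_x_le_abs_x)
      then have "\<bar>sin (2 * pi * real v * u) / (pi * real v)\<bar> \<le> \<bar>2 * pi * real v * u\<bar> / (pi * real v)"
        using v unfolding abs_divide by (intro frac_le) auto
      also have "\<dots> = 2 * u" using u v by (simp add: abs_mult)
      finally have "\<bar>sin (2 * pi * real v * u) / (pi * real v)\<bar> * u powr (- Re s) \<le> 2 * u * u powr (- Re s)"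
        by (intro mult_right_mono) auto
      also have "2 * u * u powr (- Re s) = 2 * u powr (1 - Re s)" using u powr_add[of u 1 "- Re s"] by simp
      finally show ?thesis unfolding norm_mult norm_of_real using u by (simp only: norm_powr_of_real uminus_complex.sel)
    qed
    show ?thesis unfolding saw_boundary_def
      using norm_triangle_ineq4[of "- s * (of_real (saw_coeff v u) * of_real u powr (- s - 1))" "of_real (sin (2 * pi * real v * u) / (pi * real v)) * of_real u powr (- s)"] a1 a2
      by (simp add: distrib_right)
  qed
  show "eventually (\<lambda>n. norm (saw_boundary v s (1 / real (Suc n))) \<le> (norm s + 2) * (1 / real (Suc n)) powr (1 - Re s)) sequentially"
    by (intro always_eventually allI le) simp
  have "(\<lambda>n. (1 / real (Suc n)) powr (1 - Re s)) \<longlonglongrightarrow> 0"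
    using s by (intro tendsto_zero_powrI[where b = "1 - Re s"] LIMSEQ_Suc[OF lim_1_over_n] tendsto_const always_eventually) auto
  from tendsto_mult_right_zero[OF this, of "norm s + 2"]
  show "(\<lambda>n. (norm s + 2) * (1 / real (Suc n)) powr (1 - Re s)) \<longlonglongrightarrow> 0" .
qed

lemma norm_limit_le:
  fixes f :: "nat \<Rightarrow> complex"
  assumes "f \<longlonglongrightarrow> l" "g \<longlonglongrightarrow> m" "eventually (\<lambda>n. norm (f n - g n) \<le> B) sequentially"
  shows "norm (l - m) \<le> B"
  by (rule tendsto_upperbound[OF tendsto_norm[OF tendsto_diff[OF assms(1,2)]] assms(3)]) simp

text \<open>For Re s < 1 the integrals of \<open>osc_fun\<close> up to infinity do not converge
  absolutely. The limit along integers, where \<open>saw_boundary\<close> vanishes, identifies their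
  sum with an absolutely convergent Mellin integral.\<close>

lemma mellin_upper_limit:
  assumes v: "v > 0" and s: "s \<in> critical_strip" and N: "N > 0"
  shows "(\<lambda>n. integral {real N..real n} (osc_fun (Re s) v (Im s)) + integral {real N..real n} (osc_fun (Re s) (- real v) (Im s)))
     \<longlonglongrightarrow> s * (s + 1) * mellin {real N..} (saw_coeff v) s"
proof -
  have "mellin_bound {real N..} (saw_coeff v) 1 2" using N by (intro mellin_bound_saw_coeff[OF v]) auto
  then have "(\<lambda>n. mellin {real N..real n} (saw_coeff v) s) \<longlonglongrightarrow> mellin {real N..} (saw_coeff v) s"
    by (rule mellin_atLeast_tendsto) (use s in \<open>auto simp: critical_strip_def\<close>)
  then have "(\<lambda>n. s * (s + 1) * mellin {real N..real n} (saw_coeff v) s) \<longlonglongrightarrow> s * (s + 1) * mellin {real N..} (saw_coeff v) s"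
    by (rule tendsto_mult_left)
  moreover have "eventually (\<lambda>n. s * (s + 1) * mellin {real N..real n} (saw_coeff v) s = 
     integral {real N..real n} (osc_fun (Re s) v (Im s)) + integral {real N..real n} (osc_fun (Re s) (- real v) (Im s))) sequentially"
    using eventually_ge_at_top[of N] by eventually_elim (use mellin_saw_coeff_parts[OF v, of "real N" _ s] N in simp)
  ultimately show ?thesis by (rule Lim_transform_eventually)
qed

lemma mellin_lower_limit:
  assumes v: "v > 0" and s: "s \<in> critical_strip" and N: "N > 0"
  shows "(\<lambda>n. integral {1 / real (Suc n)..real N} (osc_fun (Re s) v (Im s)) + integral {1 / real (Suc n)..real N} (osc_fun (Re s) (- real v) (Im s)))
     \<longlonglongrightarrow> s * (s + 1) * mellin {0<..real N} (saw_coeff v) s"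
proof -
  have sr: "-1 < Re s" "Re s < 2 - 1" "Re s < 1" using s by (auto simp: critical_strip_def)
  have le1: "1 / real (Suc n) \<le> real N" for n
  proof -
    have "1 / real (Suc n) \<le> 1" by simp
    also have "1 \<le> real N" using N by simp
    finally show ?thesis .
  qed
  have "(\<lambda>n. mellin {1 / real (Suc n)..real N} (saw_coeff v) s) \<longlonglongrightarrow> mellin {0<..real N} (saw_coeff v) s"
  proof (rule mellin_exhaust[OF mellin_bound_saw_coeff[OF v] sr(1,2)])
    fix u :: real assume u: "u \<in> {0<..real N}"
    then have "eventually (\<lambda>n. 1 / real (Suc n) < u) sequentially"
      using order_tendstoD(2)[OF LIMSEQ_Suc[OF lim_1_over_n]] by auto
    then show "eventually (\<lambda>n. u \<in> {1 / real (Suc n)..real N}) sequentially" by (rule eventually_mono) (use u in auto)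
  next
    fix n :: nat
    show "{1 / real (Suc n)..real N} \<subseteq> {0<..real N}" by (rule Icc_inverse_subset)
  qed auto
  then have "(\<lambda>n. s * (s + 1) * mellin {1 / real (Suc n)..real N} (saw_coeff v) s + saw_boundary v s (1 / real (Suc n)))
     \<longlonglongrightarrow> s * (s + 1) * mellin {0<..real N} (saw_coeff v) s + 0"
    by (intro tendsto_add tendsto_mult_left saw_boundary_tendsto_0 v sr)
  moreover have "s * (s + 1) * mellin {1 / real (Suc n)..real N} (saw_coeff v) s + saw_boundary v s (1 / real (Suc n)) = 
     integral {1 / real (Suc n)..real N} (osc_fun (Re s) v (Im s)) + integral {1 / real (Suc n)..real N} (osc_fun (Re s) (- real v) (Im s))" for n
    using mellin_saw_coeff_parts[OF v _ le1, of n s] by simp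
  ultimately show ?thesis by simp
qed

lemma fe_factor_limit:
  assumes s: "s \<in> critical_strip"
  shows "(\<lambda>n. integral {1 / real (Suc n)..real n} (osc_fun (Re s) 1 (Im s)) + integral {1 / real (Suc n)..real n} (osc_fun (Re s) (- 1) (Im s)))
     \<longlonglongrightarrow> fe_factor s"
proof -
  have sr: "-1 < Re s" "Re s < 2 - 1" "Re s < 1" using s by (auto simp: critical_strip_def)
  have "(\<lambda>n. mellin {1 / real (Suc n)..1 * real n} (saw_coeff 1) s) \<longlonglongrightarrow> mellin {0<..} (saw_coeff 1) s"
    by (rule integral_positive_axis_limit[OF mellin_bound_saw_coeff sr(1,2)]) auto
  then have "(\<lambda>n. s * (s + 1) * mellin {1 / real (Suc n)..1 * real n} (saw_coeff 1) s + saw_boundary 1 s (1 / real (Suc n)))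
     \<longlonglongrightarrow> s * (s + 1) * mellin {0<..} (saw_coeff 1) s + 0"
    by (intro tendsto_add tendsto_mult_left saw_boundary_tendsto_0 sr) auto
  moreover have "eventually (\<lambda>n. s * (s + 1) * mellin {1 / real (Suc n)..1 * real n} (saw_coeff 1) s + saw_boundary 1 s (1 / real (Suc n)) = 
     integral {1 / real (Suc n)..real n} (osc_fun (Re s) 1 (Im s)) + integral {1 / real (Suc n)..real n} (osc_fun (Re s) (- 1) (Im s))) sequentially"
    using eventually_ge_at_top[of 1]
  proof eventually_elim
    case (elim n)
    have "1 / real (Suc n) \<le> 1" by simp
    also have "1 \<le> real n" using elim by simp
    finally show ?case using mellin_saw_coeff_parts[of 1 "1 / real (Suc n)" "real n" s] by simp
  qed
  ultimately have "(\<lambda>n. integral {1 / real (Suc n)..real n} (osc_fun (Re s) 1 (Im s)) + integral {1 / real (Suc n)..real n} (osc_fun (Re s) (- 1) (Im s)))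
     \<longlonglongrightarrow> s * (s + 1) * mellin {0<..} (saw_coeff 1) s + 0"
    by (rule Lim_transform_eventually)
  then show ?thesis by (simp add: fe_factor_def)
qed

text \<open>Within distance \<delta> of N the integral is trivially of order \<delta> N^(-\<sigma>),
  beyond it of order N^(1-\<sigma>) / (Y \<delta>); the two balance at \<delta> of order N / sqrt
  t.\<close>

lemma near_stationary_bounds:
  fixes N Y t \<sigma> \<kappa> v :: real
  assumes N: "N > 0" and Y: "Y > 0" and t: "t = 2 * pi * N * Y" and \<sigma>: "0 < \<sigma>" "\<sigma> < 1"
    and \<kappa>: "sqrt (t + 1) \<le> \<kappa> * sqrt t"
  shows "v \<ge> Y \<Longrightarrow> N \<le> B \<Longrightarrow> norm (integral {N..B} (osc_fun \<sigma> v t)) \<le> (1 + 128 * \<kappa>) * (N powr (1 - \<sigma>) / sqrt t)"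
    "v \<le> Y \<Longrightarrow> Y \<le> 2 * v \<Longrightarrow> 0 < A \<Longrightarrow> A \<le> N \<Longrightarrow> norm (integral {A..N} (osc_fun \<sigma> v t)) \<le> (1 + 128 * \<kappa>) * (N powr (1 - \<sigma>) / sqrt t)"
proof -
  have t0: "t > 0" using N Y t by simp
  define q where "q = sqrt (t + 1)"
  have q1: "q \<ge> 1" "sqrt t \<le> q" using t0 by (auto simp: q_def)
  \<comment> \<open>Using sqrt (t + 1) instead of sqrt t keeps \<delta> <= N / 2 when t is
    small.\<close>
  define \<delta> where "\<delta> = N / (2 * q)"
  have d: "\<delta> > 0" using N q1 by (simp add: \<delta>_def)
  have dN: "\<delta> \<le> N / 2" using N q1 unfolding \<delta>_def by (intro frac_le) auto
  have st: "sqrt t > 0" "t = sqrt t * sqrt t" using t0 by auto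
  have powr1: "N powr (1 - \<sigma>) = N * N powr (-\<sigma>)" using N powr_add[of N 1 "-\<sigma>"] by simp
  define R where "R = N powr (1 - \<sigma>) / sqrt t"
  have Rd: "2 * (\<delta> * N powr (-\<sigma>)) \<le> R"
  proof -
    have "2 * (\<delta> * N powr (-\<sigma>)) = N powr (1 - \<sigma>) / q" using q1 by (simp add: \<delta>_def powr1)
    also have "\<dots> \<le> R" unfolding R_def using q1 st by (intro divide_left_mono) auto
    finally show ?thesis .
  qed
  \<comment> \<open>Here pi Y \<delta> = t / (4 q), which turns 32 into 128; the quotient q / sqrt t
    is absorbed by \<kappa>.\<close>
  have main: "32 * (N powr (1 - \<sigma>) / (pi * Y * \<delta>)) \<le> 128 * \<kappa> * R"
  proof -
    have "32 * (N powr (1 - \<sigma>) / (pi * Y * \<delta>)) = 128 * (N powr (1 - \<sigma>) * q / t)"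
      using N Y q1 by (simp add: \<delta>_def t field_simps)
    also have "\<dots> \<le> 128 * (N powr (1 - \<sigma>) * (\<kappa> * sqrt t) / t)"
      using \<kappa> t0 unfolding q_def by (intro mult_left_mono divide_right_mono) auto
    also have "\<dots> = 128 * \<kappa> * R" unfolding R_def using st(1) by (subst st(2)) (simp add: field_simps)
    finally show ?thesis .
  qed
  show "norm (integral {N..B} (osc_fun \<sigma> v t)) \<le> (1 + 128 * \<kappa>) * (N powr (1 - \<sigma>) / sqrt t)" if v: "v \<ge> Y" and B: "N \<le> B"
  proof -
    have pos: "32 * (N powr (1 - \<sigma>) / (pi * Y * \<delta>)) \<ge> 0" using Y d by simp
    have "norm (integral {N..B} (osc_fun \<sigma> v t)) \<le> \<delta> * N powr (-\<sigma>) + 32 * (N powr (1 - \<sigma>) / (pi * Y * \<delta>))"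
    proof (cases "B \<le> N + \<delta>")
      case True
      have "norm (integral {N..B} (osc_fun \<sigma> v t)) \<le> (B - N) * N powr (-\<sigma>)"
        by (rule osc_fun_trivial_bound) (use N B \<sigma> in auto)
      also have "\<dots> \<le> \<delta> * N powr (-\<sigma>)" using True by (intro mult_right_mono) auto
      finally show ?thesis using pos by linarith
    next
      case False
      have "integral {N..B} (osc_fun \<sigma> v t) = integral {N..N+\<delta>} (osc_fun \<sigma> v t) + integral {N+\<delta>..B} (osc_fun \<sigma> v t)"
        by (rule Henstock_Kurzweil_Integration.integral_combine[symmetric]) (use False d osc_fun_integrable[OF N] in auto)
      then have "norm (integral {N..B} (osc_fun \<sigma> v t)) \<le> norm (integral {N..N+\<delta>} (osc_fun \<sigma> v t)) + norm (integral {N+\<delta>..B} (osc_fun \<sigma> v t))"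
        by (simp add: norm_triangle_ineq)
      moreover have "norm (integral {N..N+\<delta>} (osc_fun \<sigma> v t)) \<le> \<delta> * N powr (-\<sigma>)"
        using osc_fun_trivial_bound[of N "N + \<delta>" \<sigma> v t] N d \<sigma> by simp
      moreover have "norm (integral {N+\<delta>..B} (osc_fun \<sigma> v t)) \<le> 32 * (N powr (-\<sigma>) * (N + \<delta>) / (2 * pi * v * \<delta>))"
        by (rule osc_upper_near[OF N Y t \<sigma> v d]) (use False in auto)
      moreover have "N powr (-\<sigma>) * (N + \<delta>) / (2 * pi * v * \<delta>) \<le> N powr (-\<sigma>) * (2 * N) / (2 * pi * Y * \<delta>)"
        using N Y v d dN by (intro frac_le mult_left_mono mult_right_mono) auto
      moreover have "N powr (-\<sigma>) * (2 * N) / (2 * pi * Y * \<delta>) = N powr (1 - \<sigma>) / (pi * Y * \<delta>)" using N Y d by (simp add: powr1 mult_ac)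
      ultimately show ?thesis by linarith
    qed
    moreover have "\<delta> * N powr (-\<sigma>) \<ge> 0" using d by simp
    ultimately show ?thesis using Rd main unfolding R_def[symmetric] distrib_right mult_1_left by linarith
  qed
  show "norm (integral {A..N} (osc_fun \<sigma> v t)) \<le> (1 + 128 * \<kappa>) * (N powr (1 - \<sigma>) / sqrt t)"
    if v: "v \<le> Y" "Y \<le> 2 * v" and A: "0 < A" "A \<le> N"
  proof -
    have v0: "v > 0" using v Y by simp
    have pos: "32 * (N powr (1 - \<sigma>) / (pi * Y * \<delta>)) \<ge> 0" using Y d by simp
    \<comment> \<open>Below N the amplitude exceeds N^(-\<sigma>), but on [N / 2, N] by a factor of
      at most 2^\<sigma> <= 2.\<close>
    have half: "a powr (-\<sigma>) \<le> 2 * N powr (-\<sigma>)" if "N / 2 \<le> a" for a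
    proof -
      have "a powr (-\<sigma>) \<le> (N / 2) powr (-\<sigma>)" using that N \<sigma> by (intro powr_mono2') auto
      also have "\<dots> = N powr (-\<sigma>) / 2 powr (-\<sigma>)" by (rule powr_divide)
      also have "\<dots> \<le> N powr (-\<sigma>) / 2 powr (-1)" using \<sigma> by (intro divide_left_mono powr_mono) auto
      also have "(2::real) powr (-1) = 1 / 2" by (simp add: powr_minus)
      finally show ?thesis by simp
    qed
    have "norm (integral {A..N} (osc_fun \<sigma> v t)) \<le> 2 * (\<delta> * N powr (-\<sigma>)) + 32 * (N powr (1 - \<sigma>) / (pi * Y * \<delta>))"
    proof (cases "A \<ge> N - \<delta>")
      case True
      have "norm (integral {A..N} (osc_fun \<sigma> v t)) \<le> (N - A) * A powr (-\<sigma>)"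
        by (rule osc_fun_trivial_bound) (use A \<sigma> in auto)
      also have "\<dots> \<le> \<delta> * (2 * N powr (-\<sigma>))" using True half[of A] dN A d by (intro mult_mono) auto
      finally show ?thesis using pos by linarith
    next
      case False
      have "integral {A..N} (osc_fun \<sigma> v t) = integral {A..N-\<delta>} (osc_fun \<sigma> v t) + integral {N-\<delta>..N} (osc_fun \<sigma> v t)"
        by (rule Henstock_Kurzweil_Integration.integral_combine[symmetric]) (use False d osc_fun_integrable[OF A(1)] in auto)
      then have "norm (integral {A..N} (osc_fun \<sigma> v t)) \<le> norm (integral {A..N-\<delta>} (osc_fun \<sigma> v t)) + norm (integral {N-\<delta>..N} (osc_fun \<sigma> v t))"
        by (simp add: norm_triangle_ineq)
      moreover have "norm (integral {N-\<delta>..N} (osc_fun \<sigma> v t)) \<le> \<delta> * (N - \<delta>) powr (-\<sigma>)"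
        using osc_fun_trivial_bound[of "N - \<delta>" N \<sigma> v t] N d dN \<sigma> by simp
      moreover have "\<delta> * (N - \<delta>) powr (-\<sigma>) \<le> \<delta> * (2 * N powr (-\<sigma>))" using half[of "N - \<delta>"] dN d by (intro mult_left_mono) auto
      moreover have "norm (integral {A..N-\<delta>} (osc_fun \<sigma> v t)) \<le> 32 * (N powr (1-\<sigma>) / (2 * pi * v * \<delta>))"
        by (rule osc_lower_near[OF N Y t \<sigma> v0 v(1) d A(1)]) (use False in auto)
      moreover have "N powr (1-\<sigma>) / (2 * pi * v * \<delta>) \<le> N powr (1-\<sigma>) / (pi * Y * \<delta>)"
      proof (rule divide_left_mono)
        have "pi * (Y * \<delta>) \<le> pi * ((2 * v) * \<delta>)" using v d by (intro mult_left_mono mult_right_mono) auto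
        then show "pi * Y * \<delta> \<le> 2 * pi * v * \<delta>" by (simp add: mult_ac)
      qed (use v0 Y d in auto)
      ultimately show ?thesis by linarith
    qed
    then show ?thesis using Rd main unfolding R_def[symmetric] distrib_right mult_1_left by linarith
  qed
qed

lemma kappa_ge_inverse_sqrt:
  assumes "t > 0" "sqrt (t + 1) \<le> \<kappa> * sqrt t"
  shows "1 / sqrt t \<le> \<kappa>" "\<kappa> \<ge> 1"
proof -
  have "1 \<le> sqrt (t + 1)" "sqrt t \<le> sqrt (t + 1)" using assms by auto
  then have "1 \<le> \<kappa> * sqrt t" "1 * sqrt t \<le> \<kappa> * sqrt t" using assms by linarith+
  then show "1 / sqrt t \<le> \<kappa>" "\<kappa> \<ge> 1" using assms by (simp_all add: field_simps)
qed

text \<open>The frequency 1 is cut exactly at its stationary point N = t / (2 pi), that is Y = 1. N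
  may be any positive real because boundary terms are not evaluated. The constant is 2 (1 + 128
  \<kappa>) + 64 \<kappa>, the last part from the frequency -1.\<close>

lemma fe_factor_bound:
  assumes s: "s \<in> critical_strip" and t0: "Im s > 0" and \<kappa>: "sqrt (Im s + 1) \<le> \<kappa> * sqrt (Im s)"
  shows "norm (fe_factor s) \<le> (2 + 320 * \<kappa>) * ((Im s / (2 * pi)) powr (1 - Re s) / sqrt (Im s))"
proof -
  define N where "N = Im s / (2 * pi)"
  define \<sigma> where "\<sigma> = Re s"
  define t where "t = Im s"
  have N: "N > 0" using t0 by (simp add: N_def)
  have t: "t = 2 * pi * N * 1" by (simp add: N_def t_def)
  have \<sigma>: "0 < \<sigma>" "\<sigma> < 1" using s by (auto simp: \<sigma>_def critical_strip_def)
  have tp: "t > 0" using t0 by (simp add: t_def)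
  have k: "sqrt (t + 1) \<le> \<kappa> * sqrt t" using \<kappa> by (simp add: t_def)
  define R where "R = N powr (1 - \<sigma>) / sqrt t"
  have powr1: "N powr (1 - \<sigma>) = N * N powr (-\<sigma>)" using N powr_add[of N 1 "-\<sigma>"] by simp
  have NR: "N powr (-\<sigma>) \<le> 2 * pi * (\<kappa> * R)"
  proof -
    have "N powr (-\<sigma>) = 2 * pi * ((1 / sqrt t) * R)"
      using N tp unfolding R_def powr1 by (simp add: field_simps) (simp add: t)
    also have "\<dots> \<le> 2 * pi * (\<kappa> * R)"
      using kappa_ge_inverse_sqrt(1)[OF tp k] N tp by (intro mult_left_mono mult_right_mono) (auto simp: R_def)
    finally show ?thesis .
  qed
  let ?f = "\<lambda>n. integral {1 / real (Suc n)..real n} (osc_fun \<sigma> 1 t) + integral {1 / real (Suc n)..real n} (osc_fun \<sigma> (- 1) t)"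
  have lim: "?f \<longlonglongrightarrow> fe_factor s" using fe_factor_limit[OF s] by (simp add: \<sigma>_def t_def)
  have ev: "eventually (\<lambda>n. norm (?f n) \<le> (2 + 320 * \<kappa>) * R) sequentially"
  proof -
    have "eventually (\<lambda>n. real n \<ge> N) sequentially" by real_asymp
    moreover have "eventually (\<lambda>n. 1 / real (Suc n) < N) sequentially"
      using order_tendstoD(2)[OF LIMSEQ_Suc[OF lim_1_over_n] N] by simp
    ultimately show ?thesis
    proof eventually_elim
      case (elim n)
      have p: "0 < 1 / real (Suc n)" "1 / real (Suc n) \<le> N" "N \<le> real n" using elim by auto
      have comb: "norm (integral {1 / real (Suc n)..real n} (osc_fun \<sigma> v t)) \<le> 
         norm (integral {1 / real (Suc n)..N} (osc_fun \<sigma> v t)) + norm (integral {N..real n} (osc_fun \<sigma> v t))" for v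
        using Henstock_Kurzweil_Integration.integral_combine[OF p(2,3) osc_fun_integrable[OF p(1)], of \<sigma> v t]
        by (metis norm_triangle_ineq)
      have a: "norm (integral {1 / real (Suc n)..N} (osc_fun \<sigma> 1 t)) \<le> (1 + 128 * \<kappa>) * R" unfolding R_def
        by (rule near_stationary_bounds(2)[OF N _ t \<sigma> k]) (use p in auto)
      have b: "norm (integral {N..real n} (osc_fun \<sigma> 1 t)) \<le> (1 + 128 * \<kappa>) * R" unfolding R_def
        by (rule near_stationary_bounds(1)[OF N _ t \<sigma> k]) (use p in auto)
      have c: "norm (integral {N..real n} (osc_fun \<sigma> (- 1) t)) \<le> 32 * (N powr (-\<sigma>) / (2 * pi))"
        using osc_neg_first(1)[OF N _ t \<sigma>, of 1 "real n"] p by simp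
      have e: "norm (integral {1 / real (Suc n)..N} (osc_fun \<sigma> (- 1) t)) \<le> 32 * (N powr (1 - \<sigma>) / t)"
        using osc_neg_first(2)[OF N _ t \<sigma>, of 1 "1 / real (Suc n)"] p by simp
      have "N powr (1 - \<sigma>) / t = N powr (-\<sigma>) / (2 * pi)" using N unfolding powr1 t by simp
      moreover have "N powr (-\<sigma>) / (2 * pi) \<le> \<kappa> * R" using NR by (simp add: field_simps)
      ultimately have "norm (integral {N..real n} (osc_fun \<sigma> (- 1) t)) + norm (integral {1 / real (Suc n)..N} (osc_fun \<sigma> (- 1) t)) \<le> 64 * (\<kappa> * R)"
        using c e by linarith
      moreover have "norm (?f n) \<le> norm (integral {1 / real (Suc n)..real n} (osc_fun \<sigma> 1 t)) + norm (integral {1 / real (Suc n)..real n} (osc_fun \<sigma> (- 1) t))"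
        by (rule norm_triangle_ineq)
      ultimately have "norm (?f n) \<le> 2 * ((1 + 128 * \<kappa>) * R) + 64 * (\<kappa> * R)"
        using comb[of 1] comb[of "- 1"] a b by linarith
      also have "\<dots> = (2 + 320 * \<kappa>) * R" by (simp add: algebra_simps)
      finally show ?case .
    qed
  qed
  have "norm (fe_factor s) \<le> (2 + 320 * \<kappa>) * R"
    by (rule tendsto_upperbound[OF tendsto_norm[OF lim] ev]) simp
  then show ?thesis by (simp add: R_def N_def \<sigma>_def t_def)
qed

section \<open>Boundary values and the estimate for each frequency\<close>

lemma norm_osc_prim: "norm (osc_prim \<sigma> v t u) = u powr (1 - \<sigma>) / \<bar>2 * pi * v * u - t\<bar>"
  unfolding osc_prim_def norm_mult norm_of_real abs_divide by simp

lemma osc_prim_at_infinity: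
  assumes "\<sigma> > 0" "v \<noteq> 0"
  shows "(\<lambda>n. osc_prim \<sigma> v t (real n)) \<longlonglongrightarrow> 0"
proof (rule Lim_null_comparison)
  define w where "w = pi * \<bar>v\<bar>"
  have w: "w > 0" using assms by (simp add: w_def)
  have "eventually (\<lambda>n. real n \<ge> \<bar>t\<bar> / w) sequentially" by real_asymp
  then show "eventually (\<lambda>n. norm (osc_prim \<sigma> v t (real n)) \<le> real n powr (-\<sigma>) / w) sequentially"
    using eventually_gt_at_top[of 0]
  proof eventually_elim
    case (elim n)
    have "\<bar>t\<bar> \<le> w * real n" using elim w by (simp add: field_simps)
    moreover have "\<bar>2 * pi * v * real n\<bar> = 2 * (w * real n)" by (simp add: w_def abs_mult)
    ultimately have D: "\<bar>2 * pi * v * real n - t\<bar> \<ge> w * real n" by linarith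
    have "norm (osc_prim \<sigma> v t (real n)) = real n powr (1 - \<sigma>) / \<bar>2 * pi * v * real n - t\<bar>"
      by (rule norm_osc_prim)
    also have "\<dots> \<le> real n powr (1 - \<sigma>) / (w * real n)"
      using D w elim by (intro frac_le) (auto intro!: mult_pos_pos)
    also have "\<dots> = real n powr (-\<sigma>) / w" using elim powr_add[of "real n" 1 "-\<sigma>"] by simp
    finally show ?case .
  qed
  have "(\<lambda>n. real n powr (-\<sigma>)) \<longlonglongrightarrow> 0" using assms by (intro tendsto_neg_powr filterlim_real_sequentially) auto
  from tendsto_divide_zero[OF this] show "(\<lambda>n. real n powr (-\<sigma>) / w) \<longlonglongrightarrow> 0" .
qed

lemma osc_prim_at_zero:
  assumes "\<sigma> < 1" "t > 0"
  shows "(\<lambda>n. osc_prim \<sigma> v t (1 / real (Suc n))) \<longlonglongrightarrow> 0"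
proof (rule tendsto_norm_zero_cancel)
  have u: "(\<lambda>n. 1 / real (Suc n)) \<longlonglongrightarrow> 0" by (rule LIMSEQ_Suc[OF lim_1_over_n])
  have "(\<lambda>n. (1 / real (Suc n)) powr (1 - \<sigma>)) \<longlonglongrightarrow> 0"
    using assms by (intro tendsto_zero_powrI[where b = "1 - \<sigma>"] u tendsto_const always_eventually) auto
  then have "(\<lambda>n. (1 / real (Suc n)) powr (1 - \<sigma>) / \<bar>2 * pi * v * (1 / real (Suc n)) - t\<bar>) \<longlonglongrightarrow> 0 / \<bar>2 * pi * v * 0 - t\<bar>"
    by (intro tendsto_divide tendsto_rabs tendsto_diff tendsto_mult_left u tendsto_const) (use assms in auto)
  moreover have "norm (osc_prim \<sigma> v t (1 / real (Suc n))) = (1 / real (Suc n)) powr (1 - \<sigma>) / \<bar>2 * pi * v * (1 / real (Suc n)) - t\<bar>" for n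
    by (rule norm_osc_prim)
  ultimately show "(\<lambda>n. norm (osc_prim \<sigma> v t (1 / real (Suc n)))) \<longlonglongrightarrow> 0" by (simp only: div_0)
qed

text \<open>For integers v and N the factor exp(2 pi i v N) is 1, so apart from 1 / (v - Y) the
  boundary value does not depend on v. The cancellation between frequencies rests on this.\<close>

lemma osc_prim_nat:
  assumes N: "N > 0" and t: "Im s = 2 * pi * real N * Y" and v: "v \<in> \<int>"
  shows "osc_prim (Re s) v (Im s) (real N) = - (\<i> * of_nat N powr (- s) / (2 * of_real pi)) / of_real (v - Y)"
proof -
  obtain k where k: "v = of_int k" using v by (auto elim: Ints_cases)
  have "2 * pi * v * real N = 2 * pi * of_int (k * int N)" by (simp add: k)
  then have c: "cis (2 * pi * v * real N) = 1" by (simp only: complex_eq_iff cis.sel cos_int_2pin sin_int_2pin one_complex.sel)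
  have "of_real (real N powr (- Re s)) * osc_unit v (Im s) (real N) = of_nat N powr (- s)"
    using osc_fun_eq[of "real N" s v] N c by (simp add: osc_fun_def)
  moreover have "real N powr (1 - Re s) / (2 * pi * v * real N - Im s) = real N powr (- Re s) * (1 / (2 * pi * (v - Y)))"
  proof -
    have "real N powr (1 - Re s) = real N * real N powr (- Re s)" using N powr_add[of "real N" 1 "- Re s"] by simp
    moreover have "2 * pi * v * real N - Im s = real N * (2 * pi * (v - Y))" by (simp add: t algebra_simps)
    ultimately show ?thesis using N by simp
  qed
  ultimately have "osc_prim (Re s) v (Im s) (real N) = - \<i> * (of_real (1 / (2 * pi * (v - Y))) * of_nat N powr (- s))"
    unfolding osc_prim_def by (simp only: of_real_mult) (simp add: mult_ac)
  then show ?thesis by simp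
qed


text \<open>\<open>U\<close> and \<open>L\<close> are the parts of frequency v above and below N.
  Away from Y the boundary terms at N of both v and -v are extracted. Next to Y the term 1 / (v - Y)
  may be arbitrarily large; there the positive frequency is bounded as a whole by
  \<open>near_stationary_bounds\<close>, and only -1 / (v + Y) is extracted.\<close>

lemma mellin_coeff_estimates:
  fixes v N :: nat and s :: complex and Y \<kappa> :: real
  assumes s: "s \<in> critical_strip" and v: "v > 0" and N: "N > 0" and Y: "Y > 0" and t: "Im s = 2 * pi * real N * Y"
    and \<kappa>: "sqrt (Im s + 1) \<le> \<kappa> * sqrt (Im s)"
  defines "U \<equiv> s * (s + 1) * mellin {real N..} (saw_coeff v) s"
    and "L \<equiv> s * (s + 1) * mellin {0<..real N} (saw_coeff v) s"
    and "c \<equiv> \<i> * of_nat N powr (- s) / (2 * of_real pi)"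
    and "R \<equiv> real N powr (1 - Re s) / sqrt (Im s)" and "E \<equiv> real N powr (- Re s) / real N"
  shows "real v > Y \<Longrightarrow> norm (U - c * of_real (1 / (real v - Y) - 1 / (real v + Y))) \<le> 512 * (E * real v / (real v - Y) ^ 3) + 512 * (E / (real v)\<^sup>2)"
    and "real v \<ge> Y \<Longrightarrow> norm (U - c * of_real (- 1 / (real v + Y))) \<le> (1 + 128 * \<kappa>) * R + 512 * (E / (real v)\<^sup>2)"
    and "real v < Y \<Longrightarrow> norm (L + c * of_real (1 / (real v - Y) - 1 / (real v + Y))) \<le> 128 * (E * Y / (Y - real v) ^ 3) + 128 * (E / Y\<^sup>2)"
    and "real v \<le> Y \<Longrightarrow> Y \<le> 2 * real v \<Longrightarrow> norm (L + c * of_real (- 1 / (real v + Y))) \<le> (1 + 128 * \<kappa>) * R + 128 * (E / Y\<^sup>2)"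
proof -
  define \<sigma> where "\<sigma> = Re s"
  define \<tau> where "\<tau> = Im s"
  have \<sigma>: "0 < \<sigma>" "\<sigma> < 1" using s by (auto simp: \<sigma>_def critical_strip_def)
  have N': "real N > 0" and v': "real v > 0" using N v by auto
  have t': "\<tau> = 2 * pi * real N * Y" using t by (simp add: \<tau>_def)
  have tp: "\<tau> > 0" using t' N' Y by simp
  have k: "sqrt (\<tau> + 1) \<le> \<kappa> * sqrt \<tau>" using \<kappa> by (simp add: \<tau>_def)
  let ?P = "osc_prim \<sigma> (real v) \<tau>" and ?Q = "osc_prim \<sigma> (- real v) \<tau>"
  let ?I = "\<lambda>a b. integral {a..b} (osc_fun \<sigma> (real v) \<tau>)" and ?J = "\<lambda>a b. integral {a..b} (osc_fun \<sigma> (- real v) \<tau>)"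
  have PN: "?P (real N) = - c / of_real (real v - Y)" "?Q (real N) = - c / of_real (- real v - Y)"
    using osc_prim_nat[OF N t, of "real v"] osc_prim_nat[OF N t, of "- real v"] by (simp_all add: c_def \<sigma>_def \<tau>_def)
  have QN: "?Q (real N) = - (c * of_real (- 1 / (real v + Y)))"
  proof -
    have "- real v - Y = - (real v + Y)" by simp
    then show ?thesis unfolding PN(2) by (simp only: of_real_minus of_real_divide divide_minus_right) simp
  qed
  have PQ: "?P (real N) + ?Q (real N) = - (c * of_real (1 / (real v - Y) - 1 / (real v + Y)))"
  proof -
    have "?P (real N) = - (c * of_real (1 / (real v - Y)))" unfolding PN(1) by simp
    then show ?thesis unfolding QN by (simp add: algebra_simps)
  qed
  have limU: "(\<lambda>n. ?I (real N) (real n) + ?J (real N) (real n)) \<longlonglongrightarrow> U"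
    using mellin_upper_limit[OF v s N] by (simp add: U_def \<sigma>_def \<tau>_def)
  have limL: "(\<lambda>n. ?I (1 / real (Suc n)) (real N) + ?J (1 / real (Suc n)) (real N)) \<longlonglongrightarrow> L"
    using mellin_lower_limit[OF v s N] by (simp add: L_def \<sigma>_def \<tau>_def)
  have Pinf: "(\<lambda>n. ?P (real n)) \<longlonglongrightarrow> 0" "(\<lambda>n. ?Q (real n)) \<longlonglongrightarrow> 0"
    by (rule osc_prim_at_infinity; use \<sigma> v in simp)+
  have P0: "(\<lambda>n. ?P (1 / real (Suc n))) \<longlonglongrightarrow> 0" "(\<lambda>n. ?Q (1 / real (Suc n))) \<longlonglongrightarrow> 0"
    by (rule osc_prim_at_zero; use \<sigma> tp in simp)+
  have E: "E = real N powr (-\<sigma>) / real N" "R = real N powr (1 - \<sigma>) / sqrt \<tau>" by (simp_all add: E_def R_def \<sigma>_def \<tau>_def)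
  have evN: "eventually (\<lambda>n. real N \<le> real n) sequentially" using eventually_ge_at_top[of N] by eventually_elim simp
  have small: "0 < 1 / real (Suc n)" "1 / real (Suc n) \<le> real N" for n
  proof -
    have "1 / real (Suc n) \<le> 1" by simp
    also have "1 \<le> real N" using N by simp
    finally show "1 / real (Suc n) \<le> real N" .
  qed simp
  have J_up: "norm (?J (real N) (real n) - (?Q (real n) - ?Q (real N))) \<le> 512 * (E / (real v)\<^sup>2)" if "real N \<le> real n" for n
    unfolding E by (rule osc_upper_neg[OF N' Y t' \<sigma> v' that])
  have J_lo: "norm (?J (1 / real (Suc n)) (real N) - (?Q (real N) - ?Q (1 / real (Suc n)))) \<le> 128 * (E / Y\<^sup>2)" for n
    unfolding E by (rule osc_lower_neg[OF N' Y t' \<sigma> v' small])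
  have tri: "norm ((a + b) - (a' + b')) \<le> A + B" if "norm (a - a') \<le> A" "norm (b - b') \<le> B" for a b a' b' :: complex and A B
  proof -
    have "(a + b) - (a' + b') = (a - a') + (b - b')" by simp
    show ?thesis unfolding \<open>_ = (a - a') + (b - b')\<close> by (rule order_trans[OF norm_triangle_ineq add_mono[OF that]])
  qed
  have tri0: "norm ((a + b) - b') \<le> A + B" if "norm a \<le> A" "norm (b - b') \<le> B" for a b b' :: complex and A B
    using tri[of a 0 A b b' B] that by simp
  show "norm (U - c * of_real (1 / (real v - Y) - 1 / (real v + Y))) \<le> 512 * (E * real v / (real v - Y) ^ 3) + 512 * (E / (real v)\<^sup>2)" if vY: "real v > Y"
  proof (rule norm_limit_le[OF limU])
    have "(\<lambda>n. (?P (real n) - ?P (real N)) + (?Q (real n) - ?Q (real N))) \<longlonglongrightarrow> (0 - ?P (real N)) + (0 - ?Q (real N))"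
      by (intro tendsto_intros Pinf)
    also have "(0 - ?P (real N)) + (0 - ?Q (real N)) = c * of_real (1 / (real v - Y) - 1 / (real v + Y))" using PQ by (simp add: algebra_simps)
    finally show "(\<lambda>n. (?P (real n) - ?P (real N)) + (?Q (real n) - ?Q (real N))) \<longlonglongrightarrow> c * of_real (1 / (real v - Y) - 1 / (real v + Y))" .
    show "eventually (\<lambda>n. norm (?I (real N) (real n) + ?J (real N) (real n) - ((?P (real n) - ?P (real N)) + (?Q (real n) - ?Q (real N))))
       \<le> 512 * (E * real v / (real v - Y) ^ 3) + 512 * (E / (real v)\<^sup>2)) sequentially"
      using evN
    proof eventually_elim
      case (elim n)
      show ?case by (rule tri[OF _ J_up[OF elim]]) (unfold E, rule osc_upper_pos[OF N' Y t' \<sigma> vY elim])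
    qed
  qed
  show "norm (U - c * of_real (- 1 / (real v + Y))) \<le> (1 + 128 * \<kappa>) * R + 512 * (E / (real v)\<^sup>2)" if vY: "real v \<ge> Y"
  proof (rule norm_limit_le[OF limU])
    have "(\<lambda>n. ?Q (real n) - ?Q (real N)) \<longlonglongrightarrow> 0 - ?Q (real N)" by (intro tendsto_intros Pinf)
    then show "(\<lambda>n. ?Q (real n) - ?Q (real N)) \<longlonglongrightarrow> c * of_real (- 1 / (real v + Y))" unfolding QN by simp
    show "eventually (\<lambda>n. norm (?I (real N) (real n) + ?J (real N) (real n) - (?Q (real n) - ?Q (real N)))
       \<le> (1 + 128 * \<kappa>) * R + 512 * (E / (real v)\<^sup>2)) sequentially"
      using evN
    proof eventually_elim
      case (elim n)
      show ?case by (rule tri0[OF _ J_up[OF elim]]) (unfold E, rule near_stationary_bounds(1)[OF N' Y t' \<sigma> k vY elim])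
    qed
  qed
  show "norm (L + c * of_real (1 / (real v - Y) - 1 / (real v + Y))) \<le> 128 * (E * Y / (Y - real v) ^ 3) + 128 * (E / Y\<^sup>2)" if vY: "real v < Y"
  proof -
    have "norm (L - - (c * of_real (1 / (real v - Y) - 1 / (real v + Y)))) \<le> 128 * (E * Y / (Y - real v) ^ 3) + 128 * (E / Y\<^sup>2)"
    proof (rule norm_limit_le[OF limL])
      have "(\<lambda>n. (?P (real N) - ?P (1 / real (Suc n))) + (?Q (real N) - ?Q (1 / real (Suc n)))) \<longlonglongrightarrow> (?P (real N) - 0) + (?Q (real N) - 0)"
        by (intro tendsto_add tendsto_diff tendsto_const P0)
      then show "(\<lambda>n. (?P (real N) - ?P (1 / real (Suc n))) + (?Q (real N) - ?Q (1 / real (Suc n)))) \<longlonglongrightarrow> - (c * of_real (1 / (real v - Y) - 1 / (real v + Y)))"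
        unfolding diff_zero PQ .
      show "eventually (\<lambda>n. norm (?I (1 / real (Suc n)) (real N) + ?J (1 / real (Suc n)) (real N) - ((?P (real N) - ?P (1 / real (Suc n))) + (?Q (real N) - ?Q (1 / real (Suc n)))))
         \<le> 128 * (E * Y / (Y - real v) ^ 3) + 128 * (E / Y\<^sup>2)) sequentially"
      proof (intro always_eventually allI)
        fix n
        show "norm (?I (1 / real (Suc n)) (real N) + ?J (1 / real (Suc n)) (real N) - ((?P (real N) - ?P (1 / real (Suc n))) + (?Q (real N) - ?Q (1 / real (Suc n)))))
         \<le> 128 * (E * Y / (Y - real v) ^ 3) + 128 * (E / Y\<^sup>2)"
          by (rule tri[OF _ J_lo]) (unfold E, rule osc_lower_pos[OF N' Y t' \<sigma> v' vY small])
      qed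
    qed
    then show ?thesis by simp
  qed
  show "norm (L + c * of_real (- 1 / (real v + Y))) \<le> (1 + 128 * \<kappa>) * R + 128 * (E / Y\<^sup>2)" if vY: "real v \<le> Y" "Y \<le> 2 * real v"
  proof -
    have "norm (L - - (c * of_real (- 1 / (real v + Y)))) \<le> (1 + 128 * \<kappa>) * R + 128 * (E / Y\<^sup>2)"
    proof (rule norm_limit_le[OF limL])
      have "(\<lambda>n. ?Q (real N) - ?Q (1 / real (Suc n))) \<longlonglongrightarrow> ?Q (real N) - 0" by (intro tendsto_diff tendsto_const P0)
      then show "(\<lambda>n. ?Q (real N) - ?Q (1 / real (Suc n))) \<longlonglongrightarrow> - (c * of_real (- 1 / (real v + Y)))" unfolding QN diff_zero .
      show "eventually (\<lambda>n. norm (?I (1 / real (Suc n)) (real N) + ?J (1 / real (Suc n)) (real N) - (?Q (real N) - ?Q (1 / real (Suc n))))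
         \<le> (1 + 128 * \<kappa>) * R + 128 * (E / Y\<^sup>2)) sequentially"
      proof (intro always_eventually allI)
        fix n
        show "norm (?I (1 / real (Suc n)) (real N) + ?J (1 / real (Suc n)) (real N) - (?Q (real N) - ?Q (1 / real (Suc n))))
         \<le> (1 + 128 * \<kappa>) * R + 128 * (E / Y\<^sup>2)"
          by (rule tri0[OF _ J_lo]) (unfold E, rule near_stationary_bounds(2)[OF N' Y t' \<sigma> k vY small])
      qed
    qed
    then show ?thesis by simp
  qed
qed

section \<open>The approximate functional equation\<close>

text \<open>Comparison with a telescoping sum. The term k = 0 is 1 / 0 = 0, which lets later sums
  over the distance to M or M + 1 include distance 0.\<close>

lemma sum_inverse_squares_le: "(\<Sum>k<n. 1 / (real k)\<^sup>2) \<le> 2"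
proof -
  have "(\<Sum>k<Suc (Suc n). 1 / (real k)\<^sup>2) \<le> 2 - 1 / real (Suc n)" for n
  proof (induction n)
    case (Suc n)
    have "1 / (real (Suc (Suc n)))\<^sup>2 \<le> 1 / (real (Suc n) * real (Suc (Suc n)))"
      unfolding power2_eq_square by (intro frac_le mult_right_mono) auto
    also have "\<dots> = 1 / real (Suc n) - 1 / real (Suc (Suc n))" by (simp add: field_simps)
    finally show ?case using Suc by simp
  qed simp
  then have "(\<Sum>k<Suc (Suc n). 1 / (real k)\<^sup>2) \<le> 2" by (smt (verit) divide_nonneg_nonneg of_nat_0_le_iff)
  moreover have "(\<Sum>k<n. 1 / (real k)\<^sup>2) \<le> (\<Sum>k<Suc (Suc n). 1 / (real k)\<^sup>2)" by (rule sum_mono2) auto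
  ultimately show ?thesis by linarith
qed

text \<open>With \<theta> = Y - M, the terms below Y and all terms 1 / (v + Y) are negatives of h(k)
  = 1 / (k + \<theta>); together they fill k = 1, ..., M + L except k = M. The terms above Y are 1 /
  (j - \<theta>) for 2 <= j <= L - M. Pairing j with k = j makes the two harmonic sums
  cancel.\<close>

lemma boundary_sum_bound:
  fixes Y :: real and M L :: nat
  assumes Y: "Y > 0" and M: "M = nat \<lfloor>Y\<rfloor>" and L: "L \<ge> 2 * M + 2"
  shows "\<bar>\<Sum>v\<in>{1..L}. (if v = M \<or> v = Suc M then 0 else 1 / (real v - Y)) - 1 / (real v + Y)\<bar> \<le> 6"
proof -
  define \<theta> where "\<theta> = Y - real M"
  have \<theta>: "0 \<le> \<theta>" "\<theta> < 1" using Y by (auto simp: \<theta>_def M) linarith+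
  define h where "h = (\<lambda>k::nat. 1 / (real k + \<theta>))"
  define J where "J = L - M"
  have J: "J \<ge> M + 2" "L = J + M" using L by (auto simp: J_def)
  have S1: "(\<Sum>v\<in>{1..<M}. 1 / (real v - Y)) = - sum h {1..<M}"
    unfolding sum_negf[symmetric]
  proof (rule sum.reindex_bij_witness[where i = "\<lambda>k. M - k" and j = "\<lambda>v. M - v"])
    fix v assume v: "v \<in> {1..<M}"
    have "real v - Y = - (real (M - v) + \<theta>)" using v by (simp add: \<theta>_def of_nat_diff)
    then show "- h (M - v) = 1 / (real v - Y)" by (simp only: h_def divide_minus_right)
  qed auto
  have S2: "(\<Sum>v\<in>{M+2..L}. 1 / (real v - Y)) = (\<Sum>j\<in>{2..J}. 1 / (real j - \<theta>))"
    by (rule sum.reindex_bij_witness[where i = "\<lambda>k. k + M" and j = "\<lambda>v. v - M"]) (use J in \<open>auto simp: \<theta>_def of_nat_diff\<close>)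
  have S3: "(\<Sum>v\<in>{1..L}. 1 / (real v + Y)) = sum h {M+1..M+L}"
    by (rule sum.reindex_bij_witness[where i = "\<lambda>k. k - M" and j = "\<lambda>v. v + M"]) (auto simp: h_def \<theta>_def of_nat_diff)
  have "(\<Sum>v\<in>{1..L}. (if v = M \<or> v = Suc M then 0 else 1 / (real v - Y))) = (\<Sum>v\<in>{1..<M} \<union> {M+2..L}. 1 / (real v - Y))"
    by (rule sum.mono_neutral_cong_right) (use J in auto)
  also have "\<dots> = (\<Sum>v\<in>{1..<M}. 1 / (real v - Y)) + (\<Sum>v\<in>{M+2..L}. 1 / (real v - Y))"
    by (rule sum.union_disjoint) auto
  finally have far: "(\<Sum>v\<in>{1..L}. (if v = M \<or> v = Suc M then 0 else 1 / (real v - Y))) = \<dots>" .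
  have tot: "(\<Sum>v\<in>{1..L}. (if v = M \<or> v = Suc M then 0 else 1 / (real v - Y)) - 1 / (real v + Y)) =
     (\<Sum>j\<in>{2..J}. 1 / (real j - \<theta>)) - (sum h {1..<M} + sum h {M+1..M+L})"
    unfolding sum_subtractf far S1 S2 S3 by simp
  define hM where "hM = (if M = 0 then 0 else h M)"
  have hM: "0 \<le> hM" "hM \<le> 1" using \<theta> by (auto simp: hM_def h_def field_simps)
  have split1: "sum h {1..<M} + sum h {M+1..M+L} = sum h {1..M+L} - hM"
  proof (cases "M = 0")
    case False
    then have "{1..M+L} = insert M ({1..<M} \<union> {M+1..M+L})" by auto
    then have "sum h {1..M+L} = h M + sum h ({1..<M} \<union> {M+1..M+L})" by simp
    also have "sum h ({1..<M} \<union> {M+1..M+L}) = sum h {1..<M} + sum h {M+1..M+L}" by (rule sum.union_disjoint) auto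
    finally show ?thesis using False by (simp add: hM_def)
  qed (simp add: hM_def)
  have "{1..M+L} = insert 1 ({2..J} \<union> {J+1..J+2*M})" using J by auto
  then have "sum h {1..M+L} = h 1 + sum h ({2..J} \<union> {J+1..J+2*M})" using J by simp
  also have "sum h ({2..J} \<union> {J+1..J+2*M}) = sum h {2..J} + sum h {J+1..J+2*M}" by (rule sum.union_disjoint) auto
  finally have split2: "sum h {1..M+L} = h 1 + (sum h {2..J} + sum h {J+1..J+2*M})" .
  \<comment> \<open>Each difference is at most 2 / ((j - 1) j), which telescopes.\<close>
  have pairs: "0 \<le> (\<Sum>j\<in>{2..K}. 1 / (real j - \<theta>) - h j) \<and> (\<Sum>j\<in>{2..K}. 1 / (real j - \<theta>) - h j) \<le> 2 - 2 / real K" if "K \<ge> 1" for K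
    using that
  proof (induction K rule: dec_induct)
    case (step K)
    have e: "{2..Suc K} = insert (Suc K) {2..K}" using step by auto
    have a: "real (Suc K) - \<theta> \<ge> real K" "real (Suc K) + \<theta> \<ge> real (Suc K)" "real K > 0" using \<theta> step by auto
    have t: "1 / (real (Suc K) - \<theta>) - h (Suc K) = 2 * \<theta> / ((real (Suc K) - \<theta>) * (real (Suc K) + \<theta>))"
      using a \<theta> by (simp add: h_def divide_simps)
    have "2 * \<theta> / ((real (Suc K) - \<theta>) * (real (Suc K) + \<theta>)) \<le> 2 * 1 / (real K * real (Suc K))"
      using a \<theta> by (intro frac_le mult_mono) auto
    also have "\<dots> = 2 / real K - 2 / real (Suc K)" using step by (simp add: field_simps)
    finally have "1 / (real (Suc K) - \<theta>) - h (Suc K) \<le> 2 / real K - 2 / real (Suc K)" using t by simp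
    moreover have "1 / (real (Suc K) - \<theta>) - h (Suc K) \<ge> 0" unfolding t using a \<theta> by (intro divide_nonneg_nonneg mult_nonneg_nonneg) auto
    ultimately show ?case using step.IH unfolding e by (simp del: of_nat_Suc)
  qed simp
  have pJ: "0 \<le> (\<Sum>j\<in>{2..J}. 1 / (real j - \<theta>) - h j)" "(\<Sum>j\<in>{2..J}. 1 / (real j - \<theta>) - h j) \<le> 2"
    using pairs[of J] J by (auto intro: order_trans)
  \<comment> \<open>The 2 M unpaired terms are at most 1 / J each; the lower bound on
    \<open>L\<close> ensures J >= M.\<close>
  have tail: "0 \<le> sum h {J+1..J+2*M}" "sum h {J+1..J+2*M} \<le> 2"
  proof -
    show "0 \<le> sum h {J+1..J+2*M}" using \<theta> by (intro sum_nonneg) (auto simp: h_def)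
    have "sum h {J+1..J+2*M} \<le> real (card {J+1..J+2*M}) * (1 / real J)"
      using \<theta> J by (intro sum_bounded_above) (auto simp: h_def intro!: frac_le)
    also have "\<dots> = 2 * (real M / real J)" by simp
    also have "real M / real J \<le> 1" using J by simp
    finally show "sum h {J+1..J+2*M} \<le> 2" by simp
  qed
  have h1: "0 \<le> h 1" "h 1 \<le> 1" using \<theta> by (auto simp: h_def)
  have "(\<Sum>j\<in>{2..J}. 1 / (real j - \<theta>)) = (\<Sum>j\<in>{2..J}. 1 / (real j - \<theta>) - h j) + sum h {2..J}" by (simp add: sum_subtractf)
  then show ?thesis unfolding tot split1 split2 using pJ tail h1 hM by linarith
qed

text \<open>Splitting the whole-axis integral at N; this trades the upper part for minus the lower
  part at the frequencies v <= M.\<close>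

lemma fe_factor_split:
  assumes s: "s \<in> critical_strip" and N: "N > 0" and v: "v > 0"
  shows "fe_factor s * of_nat v powr (s - 1) = s * (s + 1) * mellin {real N..} (saw_coeff v) s + s * (s + 1) * mellin {0<..real N} (saw_coeff v) s"
proof -
  have sr: "-1 < Re s" "Re s < 2 - 1" "Re s < 1" using s by (auto simp: critical_strip_def)
  have i: "mellin_fun (saw_coeff v) s integrable_on T" if "T \<subseteq> {0<..}" "T \<in> sets lebesgue" for T
    by (rule mellin_integrable[OF mellin_bound_saw_coeff[OF v that(2,1)] sr(1,2)])
  have "integral ({0<..real N} \<union> {real N..}) (mellin_fun (saw_coeff v) s) = mellin {0<..real N} (saw_coeff v) s + mellin {real N..} (saw_coeff v) s"
    unfolding mellin_def using N by (intro integral_Un i) (auto intro: negligible_subset[of "{real N}"])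
  moreover have "{0<..real N} \<union> {real N..} = {0<..}" using N by auto
  ultimately have "mellin {0<..} (saw_coeff v) s = mellin {0<..real N} (saw_coeff v) s + mellin {real N..} (saw_coeff v) s" by (simp add: mellin_def)
  then have "s * (s + 1) * (of_nat v powr (s - 1) * mellin {0<..} (saw_coeff 1) s) = s * (s + 1) * mellin {real N..} (saw_coeff v) s + s * (s + 1) * mellin {0<..real N} (saw_coeff v) s"
    using mellin_saw_coeff_scale[OF sr(1,3) v] by (simp add: distrib_left)
  then show ?thesis by (simp add: fe_factor_def mult_ac)
qed

text \<open>Subtracting the dual sum from the frequency series leaves -Lo v for v <= M and U v for v
  > M. Each is compared with c times a real number D v; the sums of D v are bounded and the errors
  summable, uniformly in the number L of frequencies.\<close>

lemma approximate_functional_equation_nat: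
  fixes s :: complex and N M :: nat and Y \<kappa> :: real
  assumes s: "s \<in> critical_strip" and N: "N > 0" and Y: "Y > 0" "Y \<le> real N" and t: "Im s = 2 * pi * real N * Y"
    and \<kappa>: "sqrt (Im s + 1) \<le> \<kappa> * sqrt (Im s)" and M: "M = nat \<lfloor>Y\<rfloor>"
  shows "norm (zeta s - (\<Sum>n\<in>{1..N}. of_nat n powr (- s)) - fe_factor s * (\<Sum>v\<in>{1..M}. of_nat v powr (s - 1)))
    \<le> 6000 * real N powr (- Re s) + (2 + 300 * \<kappa>) * (real N powr (1 - Re s) / sqrt (Im s))"
proof -
  define U where "U = (\<lambda>v. s * (s + 1) * mellin {real N..} (saw_coeff v) s)"
  define Lo where "Lo = (\<lambda>v. s * (s + 1) * mellin {0<..real N} (saw_coeff v) s)"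
  define c where "c = \<i> * of_nat N powr (- s) / (2 * of_real pi)"
  define R where "R = real N powr (1 - Re s) / sqrt (Im s)"
  define P where "P = real N powr (- Re s)"
  define E where "E = P / real N"
  have sr: "-1 < Re s" "Re s < 1" "0 < Re s" using s by (auto simp: critical_strip_def)
  have tp: "Im s > 0" using t N Y by simp
  have s1: "s \<noteq> 1" using sr by auto
  have \<kappa>1: "\<kappa> \<ge> 1" "1 / sqrt (Im s) \<le> \<kappa>" using kappa_ge_inverse_sqrt[OF tp \<kappa>] by auto
  have P0: "P \<ge> 0" and E0: "E \<ge> 0" and R0: "R \<ge> 0" using tp by (auto simp: P_def E_def R_def)
  have EP: "E \<le> P" "E * (Y + 1) \<le> 2 * P"
  proof -
    show "E \<le> P" using N P0 unfolding E_def by (simp add: divide_le_eq mult_le_cancel_left1)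
    have "1 \<le> real N" using N by simp
    then have "P * (Y + 1) \<le> P * (2 * real N)" using Y P0 by (intro mult_left_mono) linarith+
    then show "E * (Y + 1) \<le> 2 * P" using N unfolding E_def by (simp add: field_simps)
  qed
  have nc: "norm c \<le> P"
  proof -
    have "norm c = P / (2 * pi)" using N by (simp add: c_def P_def norm_mult norm_divide norm_powr_real_powr)
    also have "\<dots> \<le> P / 1" using P0 pi_ge_two by (intro divide_left_mono) auto
    finally show ?thesis by simp
  qed
  have MY: "real M \<le> Y" "Y < real M + 1" using Y unfolding M by linarith+
  \<comment> \<open>The frequencies M and M + 1 around Y keep only the part coming from -v.\<close>
  define D where "D = (\<lambda>v. (if v = M \<or> v = Suc M then 0 else 1 / (real v - Y)) - 1 / (real v + Y))"
  define w where "w = (\<lambda>v. if v \<le> M then - Lo v else U v)"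
  \<comment> \<open>In this order: cubic errors away from Y, errors of the lower and of the upper
    negative frequencies, and the two frequencies next to Y. At v = M and v = M + 1 the first
    summand is 0 through 1 / 0 = 0.\<close>
  define b where "b = (\<lambda>v. 512 * (E * (Y + 1)) * (if v \<le> M then 1 / (real M - real v)\<^sup>2 else 1 / (real v - real M - 1)\<^sup>2)
     + (if v \<le> M then 128 * (E / Y\<^sup>2) else 0) + 512 * E * (1 / (real v)\<^sup>2) + (if v = M \<or> v = Suc M then (1 + 128 * \<kappa>) * R else 0))"
  note est = mellin_coeff_estimates[OF s _ N Y(1) t \<kappa>, folded U_def Lo_def c_def R_def P_def, folded E_def]
  have estU: "norm (U v - c * of_real (1 / (real v - Y) - 1 / (real v + Y))) \<le> 512 * (E * real v / (real v - Y) ^ 3) + 512 * (E / (real v)\<^sup>2)" if "v > 0" "real v > Y" for v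
    using est(1)[OF that] by (simp add: U_def)
  have estU': "norm (U v - c * of_real (- 1 / (real v + Y))) \<le> (1 + 128 * \<kappa>) * R + 512 * (E / (real v)\<^sup>2)" if "v > 0" "real v \<ge> Y" for v
    using est(2)[OF that] by (simp add: U_def)
  have estL: "norm (Lo v + c * of_real (1 / (real v - Y) - 1 / (real v + Y))) \<le> 128 * (E * Y / (Y - real v) ^ 3) + 128 * (E / Y\<^sup>2)" if "v > 0" "real v < Y" for v
    using est(3)[OF that] by (simp add: Lo_def)
  have estL': "norm (Lo v + c * of_real (- 1 / (real v + Y))) \<le> (1 + 128 * \<kappa>) * R + 128 * (E / Y\<^sup>2)" if "v > 0" "real v \<le> Y" "Y \<le> 2 * real v" for v
    using est(4)[OF that] by (simp add: Lo_def)
  have cube: "x / j' ^ 3 \<le> x / j\<^sup>2" if "x \<ge> 0" "j' \<ge> j" "j \<ge> 1" for x j j' :: real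
  proof -
    have "j\<^sup>2 * 1 \<le> j'\<^sup>2 * j'" using that by (intro mult_mono power_mono) auto
    then have "j\<^sup>2 \<le> j' ^ 3" by (simp add: power2_eq_square power3_eq_cube)
    then show ?thesis using that by (intro frac_le) auto
  qed
  have neg: "norm (- x - y) = norm (x + y)" for x y :: complex
  proof -
    have "- x - y = - (x + y)" by simp
    then show ?thesis by (simp only: norm_minus_cancel)
  qed
  have termwise: "norm (w v - c * of_real (D v)) \<le> b v" if v: "v > 0" for v
  proof -
    consider "v < M" | "v = M" | "v = Suc M" | "v \<ge> M + 2" by linarith
    then show ?thesis
    proof cases
      case 1
      then have j: "real M - real v \<ge> 1" "Y - real v \<ge> real M - real v" "real v < Y" using MY by linarith+
      have "norm (w v - c * of_real (D v)) = norm (Lo v + c * of_real (1 / (real v - Y) - 1 / (real v + Y)))"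
        unfolding neg[symmetric] using 1 by (simp add: w_def D_def)
      also have "\<dots> \<le> 128 * (E * Y / (Y - real v) ^ 3) + 128 * (E / Y\<^sup>2)" by (rule estL[OF v j(3)])
      also have "E * Y / (Y - real v) ^ 3 \<le> E * Y / (real M - real v)\<^sup>2" using cube[OF _ j(2,1), of "E * Y"] E0 Y by simp
      also have "\<dots> \<le> E * (Y + 1) / (real M - real v)\<^sup>2" using E0 Y by (intro divide_right_mono mult_left_mono) auto
      also have "128 * (E * (Y + 1) / (real M - real v)\<^sup>2) + 128 * (E / Y\<^sup>2) \<le> b v"
      proof -
        have "E * (Y + 1) / (real M - real v)\<^sup>2 \<ge> 0" "512 * E * (1 / (real v)\<^sup>2) \<ge> 0" using E0 Y by auto
        then show ?thesis using 1 by (simp add: b_def)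
      qed
      finally show ?thesis by simp
    next
      case 2
      \<comment> \<open>Here v = M >= 1, so Y < M + 1 <= 2 M.\<close>
      have "Y \<le> 2 * real v" using MY 2 v by linarith
      have "norm (w v - c * of_real (D v)) = norm (Lo v + c * of_real (- 1 / (real v + Y)))"
        unfolding neg[symmetric] using 2 by (simp add: w_def D_def)
      also have "\<dots> \<le> (1 + 128 * \<kappa>) * R + 128 * (E / Y\<^sup>2)" by (rule estL'[OF v]) (use MY 2 \<open>Y \<le> 2 * real v\<close> in auto)
      also have "\<dots> \<le> b v"
      proof -
        have "512 * E * (1 / (real v)\<^sup>2) \<ge> 0" using E0 by auto
        then show ?thesis using 2 by (simp add: b_def)
      qed
      finally show ?thesis .
    next
      case 3
      have "norm (w v - c * of_real (D v)) = norm (U v - c * of_real (- 1 / (real v + Y)))"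
        using 3 by (simp add: w_def D_def)
      also have "\<dots> \<le> (1 + 128 * \<kappa>) * R + 512 * (E / (real v)\<^sup>2)" by (rule estU'[OF v]) (use MY 3 in auto)
      also have "\<dots> \<le> b v" using 3 by (simp add: b_def)
      finally show ?thesis .
    next
      case 4
      then have j: "real v - real M - 1 \<ge> 1" "real v - Y \<ge> real v - real M - 1" "real v > Y" using MY by linarith+
      have "norm (w v - c * of_real (D v)) = norm (U v - c * of_real (1 / (real v - Y) - 1 / (real v + Y)))"
        using 4 by (simp add: w_def D_def)
      also have "\<dots> \<le> 512 * (E * real v / (real v - Y) ^ 3) + 512 * (E / (real v)\<^sup>2)" by (rule estU[OF v j(3)])
      also have "E * real v / (real v - Y) ^ 3 \<le> E * (Y + 1) / (real v - real M - 1)\<^sup>2"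
      proof -
        define j' where "j' = real v - Y"
        have j': "j' \<ge> 1" "j' \<ge> real v - real M - 1" "j' > 0" using j by (auto simp: j'_def)
        \<comment> \<open>Writing v = Y + j' gives a summable bound although v is unbounded.\<close>
        have "real v / j' ^ 3 = Y / j' ^ 3 + 1 / j'\<^sup>2"
          using j' by (simp add: j'_def[symmetric] field_simps power2_eq_square power3_eq_cube) (simp add: j'_def)
        also have "\<dots> \<le> Y / (real v - real M - 1)\<^sup>2 + 1 / (real v - real M - 1)\<^sup>2"
        proof (rule add_mono)
          show "Y / j' ^ 3 \<le> Y / (real v - real M - 1)\<^sup>2" using cube[OF _ j'(2) j(1), of Y] Y by simp
          show "1 / j'\<^sup>2 \<le> 1 / (real v - real M - 1)\<^sup>2" using j j' by (intro frac_le power_mono) auto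
        qed
        finally have "E * (real v / j' ^ 3) \<le> E * (Y / (real v - real M - 1)\<^sup>2 + 1 / (real v - real M - 1)\<^sup>2)"
          using E0 by (intro mult_left_mono)
        then show ?thesis by (simp add: j'_def add_divide_distrib distrib_left)
      qed
      also have "512 * (E * (Y + 1) / (real v - real M - 1)\<^sup>2) + 512 * (E / (real v)\<^sup>2) \<le> b v"
        using 4 by (simp add: b_def)
      finally show ?thesis by simp
    qed
  qed
  have sum_b: "(\<Sum>v\<in>{1..L}. b v) \<le> 5300 * P + 2 * ((1 + 128 * \<kappa>) * R)" if L: "L \<ge> 2 * M + 2" for L
  proof -
    have g: "(\<Sum>v\<in>{1..L}. (if v \<le> M then 1 / (real M - real v)\<^sup>2 else 1 / (real v - real M - 1)\<^sup>2)) \<le> 4"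
    proof -
      have "{1..L} = {1..M} \<union> {M+1..L}" using L by auto
      then have "(\<Sum>v\<in>{1..L}. (if v \<le> M then 1 / (real M - real v)\<^sup>2 else 1 / (real v - real M - 1)\<^sup>2)) =
         (\<Sum>v\<in>{1..M}. (if v \<le> M then 1 / (real M - real v)\<^sup>2 else 1 / (real v - real M - 1)\<^sup>2)) + (\<Sum>v\<in>{M+1..L}. (if v \<le> M then 1 / (real M - real v)\<^sup>2 else 1 / (real v - real M - 1)\<^sup>2))"
        by (simp only:) (rule sum.union_disjoint, auto)
      also have "(\<Sum>v\<in>{1..M}. (if v \<le> M then 1 / (real M - real v)\<^sup>2 else 1 / (real v - real M - 1)\<^sup>2)) = (\<Sum>k<M. 1 / (real k)\<^sup>2)"
        by (rule sum.reindex_bij_witness[where i = "\<lambda>k. M - k" and j = "\<lambda>v. M - v"]) (auto simp: of_nat_diff)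
      also have "(\<Sum>v\<in>{M+1..L}. (if v \<le> M then 1 / (real M - real v)\<^sup>2 else 1 / (real v - real M - 1)\<^sup>2)) = (\<Sum>k<L-M. 1 / (real k)\<^sup>2)"
        by (rule sum.reindex_bij_witness[where i = "\<lambda>k. k + M + 1" and j = "\<lambda>v. v - M - 1"]) (auto simp: of_nat_diff)
      finally show ?thesis using sum_inverse_squares_le[of M] sum_inverse_squares_le[of "L - M"] by linarith
    qed
    have e: "(\<Sum>v\<in>{1..L}. (if v \<le> M then 128 * (E / Y\<^sup>2) else 0)) \<le> 128 * P"
    proof -
      have "(\<Sum>v\<in>{1..L}. (if v \<le> M then 128 * (E / Y\<^sup>2) else 0)) = (\<Sum>v\<in>{1..M}. 128 * (E / Y\<^sup>2))"
        by (rule sum.mono_neutral_cong_right) (use L in auto)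
      also have "\<dots> = 128 * E * (real M / Y\<^sup>2)" by simp
      also have "real M / Y\<^sup>2 \<le> 1"
      proof (cases "M = 0")
        case False
        then have "1 \<le> Y" using MY by linarith
        then have "real M * 1 \<le> Y * Y" using MY by (intro mult_mono) auto
        then show ?thesis using Y by (simp add: power2_eq_square)
      qed simp
      then have "128 * E * (real M / Y\<^sup>2) \<le> 128 * E * 1" using E0 by (intro mult_left_mono) auto
      finally show ?thesis using EP by simp
    qed
    have q: "(\<Sum>v\<in>{1..L}. 1 / (real v)\<^sup>2) \<le> 2"
    proof -
      have "(\<Sum>v\<in>{1..L}. 1 / (real v)\<^sup>2) \<le> (\<Sum>v<Suc L. 1 / (real v)\<^sup>2)" by (rule sum_mono2) auto
      then show ?thesis using sum_inverse_squares_le[of "Suc L"] by linarith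
    qed
    have r: "(\<Sum>v\<in>{1..L}. (if v = M \<or> v = Suc M then (1 + 128 * \<kappa>) * R else 0)) \<le> 2 * ((1 + 128 * \<kappa>) * R)"
    proof -
      have "(\<Sum>v\<in>{1..L}. (if v = M \<or> v = Suc M then (1 + 128 * \<kappa>) * R else 0)) \<le> (\<Sum>v\<in>{M, Suc M}. (1 + 128 * \<kappa>) * R)"
        unfolding sum.inter_filter[OF finite_atLeastAtMost, symmetric] by (rule sum_mono2) (use R0 \<kappa>1 in auto)
      then show ?thesis by simp
    qed
    have "(\<Sum>v\<in>{1..L}. b v) = 512 * (E * (Y + 1)) * (\<Sum>v\<in>{1..L}. (if v \<le> M then 1 / (real M - real v)\<^sup>2 else 1 / (real v - real M - 1)\<^sup>2))
       + (\<Sum>v\<in>{1..L}. (if v \<le> M then 128 * (E / Y\<^sup>2) else 0)) + 512 * E * (\<Sum>v\<in>{1..L}. 1 / (real v)\<^sup>2)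
       + (\<Sum>v\<in>{1..L}. (if v = M \<or> v = Suc M then (1 + 128 * \<kappa>) * R else 0))"
      unfolding b_def sum.distrib sum_distrib_left ..
    also have "\<dots> \<le> 512 * (E * (Y + 1)) * 4 + 128 * P + 512 * E * 2 + 2 * ((1 + 128 * \<kappa>) * R)"
      using g e q r E0 Y by (intro add_mono mult_left_mono) auto
    \<comment> \<open>The sum is 512 * 2 * 4 + 128 + 512 * 2 = 5248.\<close>
    also have "\<dots> \<le> 5300 * P + 2 * ((1 + 128 * \<kappa>) * R)" using EP P0 by linarith
    finally show ?thesis .
  qed
  have W: "norm (\<Sum>v\<in>{1..L}. w v) \<le> 5306 * P + 2 * ((1 + 128 * \<kappa>) * R)" if L: "L \<ge> 2 * M + 2" for L
  proof -
    have "(\<Sum>v\<in>{1..L}. w v) = (\<Sum>v\<in>{1..L}. w v - c * of_real (D v)) + c * of_real (\<Sum>v\<in>{1..L}. D v)"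
      by (simp add: sum_subtractf sum_distrib_left)
    then have "norm (\<Sum>v\<in>{1..L}. w v) \<le> norm (\<Sum>v\<in>{1..L}. w v - c * of_real (D v)) + norm (c * of_real (\<Sum>v\<in>{1..L}. D v))"
      by (metis norm_triangle_ineq)
    also have "norm (\<Sum>v\<in>{1..L}. w v - c * of_real (D v)) \<le> (\<Sum>v\<in>{1..L}. b v)"
      by (rule sum_norm_le) (use termwise in auto)
    also have "(\<Sum>v\<in>{1..L}. b v) \<le> 5300 * P + 2 * ((1 + 128 * \<kappa>) * R)" by (rule sum_b[OF L])
    also have "norm (c * of_real (\<Sum>v\<in>{1..L}. D v)) \<le> P * 6"
      unfolding norm_mult norm_of_real D_def
      by (intro mult_mono nc boundary_sum_bound[OF Y(1) M L]) (use P0 in auto)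
    finally show ?thesis by simp
  qed
  have "(\<lambda>n. U (Suc n)) sums (s * (s + 1) * mellin {real N..} saw s)"
    unfolding U_def
    by (intro sums_mult mellin_saw_series[OF mellin_bound_saw_atLeast[of "real N" "Re s + 2"]]) (use N sr in auto)
  then have "(\<lambda>L. \<Sum>n<L. U (Suc n)) \<longlonglongrightarrow> s * (s + 1) * mellin {real N..} saw s" by (simp add: sums_def)
  moreover have "(\<Sum>n<L. U (Suc n)) = (\<Sum>v\<in>{1..L}. U v)" for L
    by (rule sum.reindex_bij_witness[of _ "\<lambda>n. n - 1" Suc]) auto
  ultimately have "(\<lambda>L. \<Sum>v\<in>{1..L}. U v) \<longlonglongrightarrow> s * (s + 1) * mellin {real N..} saw s" by simp
  then have "(\<lambda>L. (\<Sum>v\<in>{1..L}. U v) - fe_factor s * (\<Sum>v\<in>{1..M}. of_nat v powr (s - 1))) \<longlonglongrightarrow>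
     s * (s + 1) * mellin {real N..} saw s - fe_factor s * (\<Sum>v\<in>{1..M}. of_nat v powr (s - 1))"
    by (intro tendsto_diff tendsto_const)
  moreover have "eventually (\<lambda>L. norm ((\<Sum>v\<in>{1..L}. U v) - fe_factor s * (\<Sum>v\<in>{1..M}. of_nat v powr (s - 1))) \<le> 5306 * P + 2 * ((1 + 128 * \<kappa>) * R)) sequentially"
    using eventually_ge_at_top[of "2 * M + 2"]
  proof eventually_elim
    case (elim L)
    have "{1..L} = {1..M} \<union> {M+1..L}" using elim by auto
    then have sp: "sum f {1..L} = sum f {1..M} + sum f {M+1..L}" for f :: "nat \<Rightarrow> complex"
      by (simp only:) (rule sum.union_disjoint, auto)
    have "fe_factor s * (\<Sum>v\<in>{1..M}. of_nat v powr (s - 1)) = (\<Sum>v\<in>{1..M}. U v + Lo v)"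
      unfolding sum_distrib_left U_def Lo_def by (intro sum.cong fe_factor_split[OF s N]) auto
    then have "(\<Sum>v\<in>{1..L}. U v) - fe_factor s * (\<Sum>v\<in>{1..M}. of_nat v powr (s - 1)) = (\<Sum>v\<in>{1..M}. - Lo v) + (\<Sum>v\<in>{M+1..L}. U v)"
      unfolding sp by (simp add: sum.distrib sum_negf)
    also have "\<dots> = (\<Sum>v\<in>{1..L}. w v)" unfolding sp by (intro arg_cong2[of _ _ _ _ "(+)"] sum.cong) (auto simp: w_def)
    finally show ?case using W[OF elim] by simp
  qed
  ultimately have main: "norm (s * (s + 1) * mellin {real N..} saw s - fe_factor s * (\<Sum>v\<in>{1..M}. of_nat v powr (s - 1))) \<le> 5306 * P + 2 * ((1 + 128 * \<kappa>) * R)"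
    by (intro tendsto_upperbound[OF tendsto_norm]) auto
  have z: "zeta s - (\<Sum>n\<in>{1..N}. of_nat n powr (- s)) - fe_factor s * (\<Sum>v\<in>{1..M}. of_nat v powr (s - 1)) =
     (s * (s + 1) * mellin {real N..} saw s - fe_factor s * (\<Sum>v\<in>{1..M}. of_nat v powr (s - 1))) + (- (of_nat N powr (- s) / 2) + of_nat N powr (1 - s) / (s - 1))"
    using zeta_partial_sum_mellin[OF sr(1) s1 N] by simp
  have n1: "norm (- (of_nat N powr (- s) / 2 :: complex)) \<le> P" using N P0 by (simp add: P_def norm_divide norm_powr_real_powr)
  have n2: "norm (of_nat N powr (1 - s) / (s - 1)) \<le> \<kappa> * R"
  proof -
    have "norm (of_nat N powr (1 - s) / (s - 1)) = real N powr (1 - Re s) / norm (s - 1)"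
      using N by (simp add: norm_divide norm_powr_real_powr)
    also have "\<dots> \<le> real N powr (1 - Re s) / Im s"
      using abs_Im_le_cmod[of "s - 1"] tp by (intro divide_left_mono) (auto intro!: mult_pos_pos simp: s1)
    also have "\<dots> = (1 / sqrt (Im s)) * R"
    proof -
      have "Im s = sqrt (Im s) * sqrt (Im s)" using tp by simp
      then show ?thesis unfolding R_def by (metis divide_divide_eq_left mult_1 times_divide_eq_left mult.commute times_divide_eq_right)
    qed
    also have "\<dots> \<le> \<kappa> * R" using \<kappa>1 R0 by (intro mult_right_mono) auto
    finally show ?thesis .
  qed
  have "norm (zeta s - (\<Sum>n\<in>{1..N}. of_nat n powr (- s)) - fe_factor s * (\<Sum>v\<in>{1..M}. of_nat v powr (s - 1))) \<le>
     (5306 * P + 2 * ((1 + 128 * \<kappa>) * R)) + (P + \<kappa> * R)"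
    unfolding z by (intro order_trans[OF norm_triangle_ineq] add_mono main n1 n2)
  also have "\<dots> \<le> 6000 * P + (2 + 300 * \<kappa>) * R"
  proof -
    have "\<kappa> * R \<ge> 0" using \<kappa>1 R0 by simp
    then show ?thesis using P0 by (simp add: algebra_simps)
  qed
  finally show ?thesis by (simp add: P_def R_def)
qed

section \<open>Real cut points and reflection\<close>

lemma powr_critical_identity:
  fixes X Y \<sigma> :: real
  assumes "X > 0" "Y > 0"
  shows "(X * Y) powr (1 - \<sigma>) * Y powr (\<sigma> - 1) = X powr (1 - \<sigma>)"
proof -
  have "Y powr (1 - \<sigma>) * Y powr (\<sigma> - 1) = 1" using assms by (simp add: powr_add[symmetric])
  then show ?thesis using assms by (simp add: powr_mult)
qed

text \<open>Replace X by N = floor X + 1 and Y by Y0 = X Y / N, keeping t. The first sum gains the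
  term n = N; since Y - Y0 = Y (N - X) / N <= 1 for Y <= X < N, the second loses at most one
  term.\<close>

lemma E_one_bound_dominant:
  fixes s :: complex and X Y c \<kappa> :: real
  assumes s: "s \<in> critical_strip" and c: "c > 0" "X \<ge> c" "Y \<ge> c" and XY: "X * Y = Im s / (2 * pi)" and YX: "Y \<le> X"
    and \<kappa>: "sqrt (Im s + 1) \<le> \<kappa> * sqrt (Im s)"
  shows "norm (E_one s X) \<le> (6001 + (2 + 300 * \<kappa>) * (1 + 1 / c) + 2 * (2 + 320 * \<kappa>)) * (X powr (- Re s) + X powr (1 - Re s) / sqrt (Im s))"
proof -
  define t where "t = Im s"
  \<comment> \<open>Rounding up keeps N positive even if X < 1.\<close>
  define N where "N = nat \<lfloor>X\<rfloor> + 1"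
  define Y0 where "Y0 = X * Y / real N"
  define M where "M = nat \<lfloor>Y0\<rfloor>"
  define R where "R = X powr (1 - Re s) / sqrt t"
  define P where "P = X powr (- Re s)"
  have pos: "X > 0" "Y > 0" using c by auto
  have sr: "0 < Re s" "Re s < 1" using s by (auto simp: critical_strip_def)
  have tXY: "t = 2 * pi * (X * Y)" using XY by (simp add: t_def)
  have tp: "t > 0" using tXY pos by simp
  have \<kappa>1: "\<kappa> \<ge> 1" using kappa_ge_inverse_sqrt(2)[OF _ \<kappa>] tp by (simp add: t_def)
  have N: "N > 0" "X < real N" "real N \<le> X + 1" using pos unfolding N_def by linarith+
  have Y0: "Y0 > 0" using pos N by (simp add: Y0_def)
  have Y0Y: "Y0 \<le> Y"
  proof -
    have "X * Y \<le> Y * real N" using N pos by (simp add: mult.commute)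
    then show ?thesis using N by (simp add: Y0_def divide_le_eq)
  qed
  have YY0: "Y \<le> Y0 + 1"
  proof -
    have "Y * (real N - X) \<le> Y * 1" using N pos by (intro mult_left_mono) auto
    also have "\<dots> \<le> real N" using YX N by simp
    finally have "Y * real N \<le> X * Y + real N" by (simp add: algebra_simps)
    then have "Y \<le> (X * Y + real N) / real N" using N by (simp add: le_divide_eq)
    then show ?thesis using N by (simp add: Y0_def add_divide_distrib)
  qed
  have tN: "Im s = 2 * pi * real N * Y0" using N tXY by (simp add: Y0_def t_def)
  have Y0N: "Y0 \<le> real N" using Y0Y YX N by linarith
  have chi: "chi s = fe_factor s" by (rule chi_eq_fe_factor[OF s])
  have P0: "P \<ge> 0" and R0: "R \<ge> 0" using tp by (auto simp: P_def R_def)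
  have main: "norm (zeta s - (\<Sum>n\<in>{1..N}. of_nat n powr (- s)) - chi s * (\<Sum>v\<in>{1..M}. of_nat v powr (s - 1))) \<le> 6000 * P + (2 + 300 * \<kappa>) * ((1 + 1 / c) * R)"
  proof -
    have "real N powr (- Re s) \<le> P" unfolding P_def using N pos sr by (intro powr_mono2') auto
    moreover have "real N powr (1 - Re s) / sqrt (Im s) \<le> (1 + 1 / c) * R"
    proof -
      \<comment> \<open>X >= c makes N comparable with X also when X is small.\<close>
      have "X + 1 \<le> (1 + 1 / c) * X" using c pos by (simp add: field_simps)
      then have "real N \<le> (1 + 1 / c) * X" using N by linarith
      then have "real N powr (1 - Re s) \<le> ((1 + 1 / c) * X) powr (1 - Re s)" using sr by (intro powr_mono2) auto
      also have "\<dots> = (1 + 1 / c) powr (1 - Re s) * X powr (1 - Re s)" by (rule powr_mult)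
      also have "\<dots> \<le> (1 + 1 / c) powr 1 * X powr (1 - Re s)" using sr c by (intro mult_right_mono powr_mono) auto
      also have "(1 + 1 / c) powr 1 = 1 + 1 / c" using c by (subst powr_one) (auto intro: add_nonneg_nonneg)
      finally have "real N powr (1 - Re s) / sqrt t \<le> ((1 + 1 / c) * X powr (1 - Re s)) / sqrt t"
        using tp by (intro divide_right_mono) auto
      then show ?thesis by (simp add: R_def t_def)
    qed
    ultimately have "6000 * real N powr (- Re s) + (2 + 300 * \<kappa>) * (real N powr (1 - Re s) / sqrt (Im s)) \<le> 6000 * P + (2 + 300 * \<kappa>) * ((1 + 1 / c) * R)"
      using \<kappa>1 by (intro add_mono mult_left_mono) auto
    then show ?thesis
      using approximate_functional_equation_nat[OF s N(1) Y0 Y0N tN \<kappa> M_def] unfolding chi by linarith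
  qed
  have XN: "nats_upto X = {1..nat \<lfloor>X\<rfloor>}" by (rule nats_upto_eq)
  have sX: "(\<Sum>n\<in>{1..N}. of_nat n powr (- s)) = (\<Sum>n\<in>nats_upto X. of_nat n powr (- s)) + of_nat N powr (- s)"
  proof -
    have "{1..N} = insert N {1..nat \<lfloor>X\<rfloor>}" by (auto simp: N_def)
    then show ?thesis unfolding XN by (simp add: N_def)
  qed
  have nN: "norm (of_nat N powr (- s) :: complex) \<le> P"
    unfolding P_def using N pos sr by (simp add: norm_powr_real_powr powr_mono2')
  have KY: "norm (chi s) * (2 * Y powr (Re s - 1)) \<le> 2 * (2 + 320 * \<kappa>) * R"
  proof -
    have "norm (chi s) \<le> (2 + 320 * \<kappa>) * ((X * Y) powr (1 - Re s) / sqrt t)"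
      using fe_factor_bound[OF s _ \<kappa>] tp XY unfolding chi by (simp add: t_def)
    then have "norm (chi s) * (2 * Y powr (Re s - 1)) \<le> (2 + 320 * \<kappa>) * ((X * Y) powr (1 - Re s) / sqrt t) * (2 * Y powr (Re s - 1))"
      by (intro mult_right_mono) auto
    also have "\<dots> = 2 * (2 + 320 * \<kappa>) * (((X * Y) powr (1 - Re s) * Y powr (Re s - 1)) / sqrt t)" by simp
    also have "\<dots> = 2 * (2 + 320 * \<kappa>) * R" unfolding powr_critical_identity[OF pos] R_def ..
    finally show ?thesis .
  qed
  define \<Delta> where "\<Delta> = (\<Sum>v\<in>nats_upto Y. of_nat v powr (s - 1)) - (\<Sum>v\<in>{1..M}. of_nat v powr (s - 1) :: complex)"
  have \<Delta>: "norm \<Delta> \<le> 2 * Y powr (Re s - 1)"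
  proof -
    have "nat \<lfloor>Y\<rfloor> = M \<or> nat \<lfloor>Y\<rfloor> = Suc M" using Y0Y YY0 Y0 unfolding M_def by linarith
    then show ?thesis
    proof
      assume "nat \<lfloor>Y\<rfloor> = M"
      then show ?thesis by (simp add: \<Delta>_def nats_upto_eq)
    next
      assume e: "nat \<lfloor>Y\<rfloor> = Suc M"
      then have "\<Delta> = of_nat (Suc M) powr (s - 1)" by (simp add: \<Delta>_def nats_upto_eq)
      then have "norm \<Delta> = real (Suc M) powr (Re s - 1)" by (simp add: norm_powr_real_powr del: of_nat_Suc)
      \<comment> \<open>The omitted index is M + 1, and Y < M + 2 <= 2 (M + 1).\<close>
      also have "\<dots> \<le> (Y / 2) powr (Re s - 1)"
      proof (rule powr_mono2')
        have "Y < real (Suc M) + 1" using e pos by linarith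
        then show "Y / 2 \<le> real (Suc M)" by simp
      qed (use sr pos in auto)
      also have "\<dots> = Y powr (Re s - 1) / 2 powr (Re s - 1)" by (rule powr_divide)
      also have "\<dots> \<le> Y powr (Re s - 1) / 2 powr (- 1)" using sr by (intro divide_left_mono powr_mono) auto
      also have "(2::real) powr (- 1) = 1 / 2" by (simp add: powr_minus)
      finally show ?thesis by simp
    qed
  qed
  have Yt: "Im s / (2 * pi) / X = Y" using XY pos by (simp add: field_simps)
  have p: "- (1 - s) = s - 1" by simp
  have "E_one s X = (zeta s - (\<Sum>n\<in>{1..N}. of_nat n powr (- s)) - chi s * (\<Sum>v\<in>{1..M}. of_nat v powr (s - 1))) + (of_nat N powr (- s) - chi s * \<Delta>)"
    unfolding E_one_def dirichlet_psum_def Yt sX \<Delta>_def p by (simp add: algebra_simps)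
  also have "norm \<dots> \<le> (6000 * P + (2 + 300 * \<kappa>) * ((1 + 1 / c) * R)) + (P + 2 * (2 + 320 * \<kappa>) * R)"
  proof (rule order_trans[OF norm_triangle_ineq add_mono[OF main]])
    have "norm (chi s * \<Delta>) \<le> norm (chi s) * (2 * Y powr (Re s - 1))" unfolding norm_mult by (intro mult_left_mono \<Delta>) auto
    then have "norm (chi s * \<Delta>) \<le> 2 * (2 + 320 * \<kappa>) * R" using KY by linarith
    then show "norm (of_nat N powr (- s) - chi s * \<Delta>) \<le> P + 2 * (2 + 320 * \<kappa>) * R"
      by (rule order_trans[OF norm_triangle_ineq4 add_mono[OF nN]])
  qed
  also have "\<dots> = 6001 * P + ((2 + 300 * \<kappa>) * (1 + 1 / c) + 2 * (2 + 320 * \<kappa>)) * R" by (simp add: algebra_simps)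
  also have "\<dots> \<le> (6001 + (2 + 300 * \<kappa>) * (1 + 1 / c) + 2 * (2 + 320 * \<kappa>)) * P + (6001 + (2 + 300 * \<kappa>) * (1 + 1 / c) + 2 * (2 + 320 * \<kappa>)) * R"
    using P0 R0 \<kappa>1 c by (intro add_mono mult_right_mono) (auto intro!: add_nonneg_nonneg mult_nonneg_nonneg)
  finally show ?thesis by (simp add: P_def R_def t_def distrib_left)
qed

lemma cnj_dirichlet_psum_one: "cnj (dirichlet_psum (\<lambda>_. 1) x s) = dirichlet_psum (\<lambda>_. 1) x (cnj s)"
proof -
  have "cnj (of_nat n powr (- s)) = of_nat n powr (- cnj s)" if "n \<in> nats_upto x" for n
    using that by (simp add: cnj_powr complex_nonpos_Reals_iff nats_upto_iff)
  then show ?thesis unfolding dirichlet_psum_def by (simp add: cnj_sum)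
qed

text \<open>The map s -> 1 - cnj s keeps Im s and lets X and Y exchange roles, whereas s -> 1 - s
  would leave the range t > 0 of the estimates. Conjugating the relation at 1 - cnj s and
  multiplying by chi(s) exchanges its two sums.\<close>

lemma E_one_reflect:
  assumes s: "s \<in> critical_strip" and r: "chi s * chi (1 - s) = 1"
    and pos: "X > 0" "Y > 0" and XY: "X * Y = Im s / (2 * pi)"
  shows "E_one s X = chi s * cnj (E_one (1 - cnj s) Y)"
proof -
  have s': "1 - cnj s \<in> critical_strip" "1 - s \<in> critical_strip" using s by (auto simp: critical_strip_def)
  have ne: "1 - cnj s \<noteq> 1" using s by (auto simp: critical_strip_def complex_eq_iff)
  have Y1: "Im s / (2 * pi) / X = Y" "Im (1 - cnj s) / (2 * pi) / Y = X" using XY pos by (simp_all add: field_simps)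
  have z: "cnj (zeta (1 - cnj s)) = zeta (1 - s)" using zeta_cnj[OF ne] by simp
  have k: "cnj (chi (1 - cnj s)) = chi (1 - s)" using chi_cnj[OF s'(1)] by simp
  have "cnj (E_one (1 - cnj s) Y) = zeta (1 - s) - dirichlet_psum (\<lambda>_. 1) Y (1 - s) - chi (1 - s) * dirichlet_psum (\<lambda>_. 1) X s"
    unfolding E_one_def Y1 by (simp add: z k cnj_dirichlet_psum_one)
  then have "chi s * cnj (E_one (1 - cnj s) Y) = chi s * (zeta (1 - s) - dirichlet_psum (\<lambda>_. 1) Y (1 - s) - chi (1 - s) * dirichlet_psum (\<lambda>_. 1) X s)"
    by (simp only:)
  also have "\<dots> = chi s * zeta (1 - s) - chi s * dirichlet_psum (\<lambda>_. 1) Y (1 - s) - (chi s * chi (1 - s)) * dirichlet_psum (\<lambda>_. 1) X s"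
    by (simp add: algebra_simps)
  also have "chi s * zeta (1 - s) = zeta s" using zeta_functional[OF s] chi_eq_fe_factor[OF s] by simp
  finally show ?thesis unfolding r E_one_def Y1 by simp
qed

lemma E_one_bound:
  fixes c :: real
  assumes c: "c > 0" and r: "\<And>s. s \<in> critical_strip \<Longrightarrow> chi s * chi (1 - s) = 1"
  obtains C where "\<And>s X Y. s \<in> critical_strip \<Longrightarrow> X \<ge> c \<Longrightarrow> Y \<ge> c \<Longrightarrow> X * Y = Im s / (2 * pi) \<Longrightarrow>
     norm (E_one s X) \<le> C * (X powr (- Re s) + X powr (1 - Re s) / sqrt (Im s))"
proof -
  \<comment> \<open>X, Y >= c forces t >= 2 pi c^2, and (t + 1) / t = 1 + 1 / t.\<close>
  define \<kappa> where "\<kappa> = sqrt (1 + 1 / (2 * pi * c\<^sup>2))"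
  define A where "A = 6001 + (2 + 300 * \<kappa>) * (1 + 1 / c) + 2 * (2 + 320 * \<kappa>)"
  define B where "B = 2 + 320 * \<kappa>"
  have "\<kappa> \<ge> 0" by (simp add: \<kappa>_def)
  then have A0: "A \<ge> 0" and B1: "B \<ge> 1" using c by (auto simp: A_def B_def)
  have \<kappa>: "sqrt (Im s + 1) \<le> \<kappa> * sqrt (Im s)" "Im s > 0" if "X \<ge> c" "Y \<ge> c" "X * Y = Im s / (2 * pi)" for s X Y
  proof -
    have "c * c \<le> X * Y" using that c by (intro mult_mono) auto
    moreover have "Im s = 2 * pi * (X * Y)" using that by simp
    ultimately have t: "Im s \<ge> 2 * pi * c\<^sup>2" by (simp add: power2_eq_square)
    then show tp: "Im s > 0" using c by (intro less_le_trans[OF _ t]) simp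
    have "1 \<le> Im s / (2 * pi * c\<^sup>2)" using t c by simp
    then have "Im s + 1 \<le> (1 + 1 / (2 * pi * c\<^sup>2)) * Im s" by (simp add: algebra_simps)
    then have "sqrt (Im s + 1) \<le> sqrt ((1 + 1 / (2 * pi * c\<^sup>2)) * Im s)" by (rule real_sqrt_le_mono)
    then show "sqrt (Im s + 1) \<le> \<kappa> * sqrt (Im s)" by (simp only: \<kappa>_def real_sqrt_mult)
  qed
  show ?thesis
  proof (rule that[of "B * A"])
    fix s X Y assume s: "s \<in> critical_strip" and X: "X \<ge> c" and Y: "Y \<ge> c" and XY: "X * Y = Im s / (2 * pi)"
    note k = \<kappa>[OF X Y XY]
    have pos: "X > 0" "Y > 0" using X Y c by auto
    show "norm (E_one s X) \<le> B * A * (X powr (- Re s) + X powr (1 - Re s) / sqrt (Im s))"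
    proof (cases "Y \<le> X")
      case True
      have nn: "X powr (- Re s) + X powr (1 - Re s) / sqrt (Im s) \<ge> 0" using k by simp
      have "norm (E_one s X) \<le> A * (X powr (- Re s) + X powr (1 - Re s) / sqrt (Im s))"
        unfolding A_def by (rule E_one_bound_dominant[OF s c X Y XY True k(1)])
      also have "\<dots> \<le> B * A * (X powr (- Re s) + X powr (1 - Re s) / sqrt (Im s))"
        using A0 B1 nn by (intro mult_right_mono) (auto simp: mult_le_cancel_right1)
      finally show ?thesis .
    next
      case False
      define s' where "s' = 1 - cnj s"
      have s': "s' \<in> critical_strip" "Re s' = 1 - Re s" "Im s' = Im s" using s by (auto simp: s'_def critical_strip_def)
      have E': "norm (E_one s' Y) \<le> A * (Y powr (- Re s') + Y powr (1 - Re s') / sqrt (Im s'))"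
        unfolding A_def by (rule E_one_bound_dominant[OF s'(1) c Y X]) (use XY k False s' in \<open>auto simp: mult.commute\<close>)
      have chi: "norm (chi s) \<le> B * ((X * Y) powr (1 - Re s) / sqrt (Im s))"
        using fe_factor_bound[OF s k(2,1)] XY chi_eq_fe_factor[OF s] by (simp add: B_def)
      have "norm (E_one s X) = norm (chi s) * norm (E_one s' Y)"
        unfolding E_one_reflect[OF s r[OF s] pos XY] s'_def by (simp add: norm_mult)
      also have "\<dots> \<le> (B * ((X * Y) powr (1 - Re s) / sqrt (Im s))) * (A * (Y powr (Re s - 1) + Y powr Re s / sqrt (Im s)))"
        using E' chi B1 k by (intro mult_mono) (auto simp: s')
      also have "\<dots> = B * A * (((X * Y) powr (1 - Re s) * Y powr (Re s - 1)) / sqrt (Im s) + ((X * Y) powr (1 - Re s) * Y powr Re s) / (sqrt (Im s) * sqrt (Im s)))"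
        by (simp add: algebra_simps)
      \<comment> \<open>The factor from chi(s) makes the two error terms change places:
        Y^(\<sigma>-1) becomes X^(1-\<sigma>), and Y^\<sigma> becomes t X^(-\<sigma>) / (2 pi),
        where \<sigma> = Re s.\<close>
      also have "(X * Y) powr (1 - Re s) * Y powr (Re s - 1) = X powr (1 - Re s)" by (rule powr_critical_identity[OF pos])
      also have "((X * Y) powr (1 - Re s) * Y powr Re s) / (sqrt (Im s) * sqrt (Im s)) = X powr (- Re s) / (2 * pi)"
      proof -
        have "Y powr Re s = Y powr (Re s - 1) * Y" using powr_add[of Y "Re s - 1" 1] pos by simp
        then have "(X * Y) powr (1 - Re s) * Y powr Re s = X powr (1 - Re s) * Y"
          using powr_critical_identity[OF pos, of "Re s"] by (metis mult.assoc)
        also have "\<dots> = X powr (- Re s) * (X * Y)" using powr_add[of X 1 "- Re s"] pos by simp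
        finally show ?thesis using k XY by simp
      qed
      also have "B * A * (X powr (1 - Re s) / sqrt (Im s) + X powr (- Re s) / (2 * pi)) \<le> B * A * (X powr (1 - Re s) / sqrt (Im s) + X powr (- Re s) / 1)"
        using A0 B1 pi_ge_two by (intro mult_left_mono add_left_mono divide_left_mono) auto
      finally show ?thesis by (simp add: add.commute)
    qed
  qed
qed

theorem mainTheorem3:
  fixes log_zeta rz rchi :: "complex \<Rightarrow> complex" and a :: "nat \<Rightarrow> complex"
  assumes log_holo: "log_zeta holomorphic_on {s. Re s > 1}"
    and log_exp: "\<And>s. Re s > 1 \<Longrightarrow> exp (log_zeta s) = zeta s"
    and log_real: "\<And>x::real. x > 1 \<Longrightarrow> log_zeta (of_real x) \<in> \<real>"
    and rz_right: "\<And>s. Re s > 1 \<Longrightarrow> rz s = exp (1 / 2 * log_zeta s)"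
    and coeffs: "\<And>s. Re s > 1 \<Longrightarrow> (\<lambda>n. a (Suc n) * of_nat (Suc n) powr (- s)) sums rz s"
    and rz_strip: "\<And>s. s \<in> critical_strip \<Longrightarrow> (rz s)\<^sup>2 = zeta s"
    and rchi_strip: "\<And>s. s \<in> critical_strip \<Longrightarrow> (rchi s)\<^sup>2 = chi s"
    and compat: "\<And>s. s \<in> critical_strip \<Longrightarrow> rz s = rchi s * rz (1 - s)"
    and rchi_reflect: "\<And>s. s \<in> critical_strip \<Longrightarrow> rchi s * rchi (1 - s) = 1"
  shows "\<forall>c>0. \<exists>C. \<forall>s X Y.
      s \<in> critical_strip \<and> Im s \<ge> 0 \<and> X \<ge> c \<and> Y \<ge> c \<and> X * Y = Im s / (2 * pi) \<longrightarrow>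
        E_one s X =
          2 * ((\<Sum>n\<in>nats_upto (sqrt X).
                  a n * of_nat n powr (- s) * E_half rz rchi a s (X / real n))
             + chi s * (\<Sum>n\<in>nats_upto (sqrt Y).
                  a n * of_nat n powr (s - 1) * E_half rz rchi a (1 - s) (Y / real n))
             + diagonal_term rchi a s X Y)
          + (E_half rz rchi a s (sqrt X))\<^sup>2
        \<and> norm (E_one s X) \<le> C * (X powr (- Re s) + X powr (1 - Re s) / sqrt (Im s))
        \<and> (sqrt (X / Y) \<notin> \<rat> \<longrightarrow> diagonal_term rchi a s X Y = 0)"
proof (intro allI impI)
  fix c :: real assume c: "c > 0"
  have sq: "(rz s)\<^sup>2 = zeta s" if "Re s > 1" for s
  proof -
    have "(rz s)\<^sup>2 = exp (2 * (1 / 2 * log_zeta s))" unfolding rz_right[OF that] by (rule exp_double[symmetric])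
    then show ?thesis using log_exp[OF that] by simp
  qed
  have conv: "(\<Sum>d | d dvd k. a d * a (k div d)) = 1" if "k > 0" for k
    by (rule dirichlet_square_root_coeffs[OF coeffs _ that]) (use sq zeta_sums in auto)
  \<comment> \<open>The reflection formula for chi is obtained from the chosen roots, by squaring
    \<open>rchi_reflect\<close>.\<close>
  have refl: "chi s * chi (1 - s) = 1" if s: "s \<in> critical_strip" for s
  proof -
    have "1 - s \<in> critical_strip" using s by (simp add: critical_strip_def)
    then have "chi s * chi (1 - s) = (rchi s * rchi (1 - s))\<^sup>2"
      using rchi_strip[OF s] rchi_strip[of "1 - s"] by (simp add: power_mult_distrib)
    then show ?thesis using rchi_reflect[OF s] by simp
  qed
  \<comment> \<open>The bound speaks of zeta and chi only, so it does not involve the roots or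
    \<open>a\<close>.\<close>
  obtain C where C: "\<And>s X Y. s \<in> critical_strip \<Longrightarrow> X \<ge> c \<Longrightarrow> Y \<ge> c \<Longrightarrow> X * Y = Im s / (2 * pi) \<Longrightarrow>
     norm (E_one s X) \<le> C * (X powr (- Re s) + X powr (1 - Re s) / sqrt (Im s))"
    using E_one_bound[OF c refl] by blast
  show "\<exists>C. \<forall>s X Y.
      s \<in> critical_strip \<and> Im s \<ge> 0 \<and> X \<ge> c \<and> Y \<ge> c \<and> X * Y = Im s / (2 * pi) \<longrightarrow>
        E_one s X =
          2 * ((\<Sum>n\<in>nats_upto (sqrt X).
                  a n * of_nat n powr (- s) * E_half rz rchi a s (X / real n))
             + chi s * (\<Sum>n\<in>nats_upto (sqrt Y).
                  a n * of_nat n powr (s - 1) * E_half rz rchi a (1 - s) (Y / real n))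
             + diagonal_term rchi a s X Y)
          + (E_half rz rchi a s (sqrt X))\<^sup>2
        \<and> norm (E_one s X) \<le> C * (X powr (- Re s) + X powr (1 - Re s) / sqrt (Im s))
        \<and> (sqrt (X / Y) \<notin> \<rat> \<longrightarrow> diagonal_term rchi a s X Y = 0)"
  proof (intro exI[of _ C] allI impI, elim conjE, intro conjI)
    fix s X Y assume s: "s \<in> critical_strip" and X: "X \<ge> c" and Y: "Y \<ge> c" and XY: "X * Y = Im s / (2 * pi)"
    show "norm (E_one s X) \<le> C * (X powr (- Re s) + X powr (1 - Re s) / sqrt (Im s))"
      by (rule C[OF s X Y XY])
    show "sqrt (X / Y) \<notin> \<rat> \<longrightarrow> diagonal_term rchi a s X Y = 0"
      by (intro impI diagonal_term_irrational)
    show "E_one s X =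
          2 * ((\<Sum>n\<in>nats_upto (sqrt X).
                  a n * of_nat n powr (- s) * E_half rz rchi a s (X / real n))
             + chi s * (\<Sum>n\<in>nats_upto (sqrt Y).
                  a n * of_nat n powr (s - 1) * E_half rz rchi a (1 - s) (Y / real n))
             + diagonal_term rchi a s X Y)
          + (E_half rz rchi a s (sqrt X))\<^sup>2"
      by (rule E_one_hyperbola[OF conv rz_strip[OF s] rchi_strip[OF s] compat[OF s] rchi_reflect[OF s] _ _ XY])
         (use X Y c in auto)
  qed
qed

end
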